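(* For every fixed $\alpha>0$ and fixed $d\geq 3$ there exists a constant $\beta>0$ such that, if $p=n^{-\alpha}$, $G$ is a graph sampled from $\mathcal{G}_{n,d}$, and $\widehat{G}$ is obtained from $G$ by deleting every vertex independently with probability $p$, then w.h.p. $\widehat{G}$ has a connected component of size $n-o(n)$ that is a $\beta$-expander and all other connected components are of cardinality at most $\frac{4(d-1)}{\alpha(d-2)^2}+1$. Moreover, \begin{enumerate} \item if $\alpha>\frac{1}{2(d-1)}$, then w.h.p. all small connected components of $\widehat{G}$ are isolated vertices; \item if $\alpha>\frac{1}{d}$, then w.h.p. $\widehat{G}$ is connected. \end{enumerate}
   Context: $\mathcal{G}_{n,d}$ is the uniform probability distribution on all (simple) $d$-regular graphs on $n$ labeled vertices, where $dn$ is even. For $U\subseteq V(H)$, $N_H(U)=\{v\notin U: v\text{ has a neighbor in }U\}$. A graph $H$ on $m$ vertices is a $\beta$-expander ($\beta>0$) if $|N_H(U)|\ge\beta|U|$ for every set $U$ of at most $m/2$ vertices. A connected component is a $\beta$-expander if its induced subgraph is a $\beta$-expander with respect to its own number of vertices. Deletion process: given $G$, each vertex is deleted independently with probability $n^{-\alpha}$; $\widehat{G}$ is the subgraph of $G$ induced by the non-deleted vertices. The small connected components of $\widehat{G}$ are all its connected components except the largest one. An event holds w.h.p. if its probability (over both the choice of $G$ and the deletions) tends to $1$ as $n\to\infty$ (with $dn$ even). *)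

theory Defs
  imports "HOL-Probability.Probability" "HOL-Library.Landau_Symbols"
begin

text \<open>A graph is a pair of its vertex set and its edge set, edges being two-element sets of
  vertices.\<close>

type_synonym 'a graph = "'a set \<times> 'a set set"

abbreviation verts :: "'a graph \<Rightarrow> 'a set" where
  "verts \<equiv> fst"

abbreviation edges :: "'a graph \<Rightarrow> 'a set set" where
  "edges \<equiv> snd"

definition simple_graph :: "'a graph \<Rightarrow> bool" where
  "simple_graph G \<longleftrightarrow> edges G \<subseteq> {e. e \<subseteq> verts G \<and> card e = 2}"

definition regular_graph :: "nat \<Rightarrow> 'a graph \<Rightarrow> bool" where
  "regular_graph d G \<longleftrightarrow> (\<forall>v \<in> verts G. card {e \<in> edges G. v \<in> e} = d)"

definition induced_subgraph :: "'a graph \<Rightarrow> 'a set \<Rightarrow> 'a graph" where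
  "induced_subgraph G S = (verts G \<inter> S, {e \<in> edges G. e \<subseteq> S})"

definition adjacency :: "'a graph \<Rightarrow> ('a \<times> 'a) set" where
  "adjacency G = {(u, v). {u, v} \<in> edges G}"

definition conn_components :: "'a graph \<Rightarrow> 'a set set" where
  "conn_components G = {{v \<in> verts G. (u, v) \<in> (adjacency G)\<^sup>*} | u. u \<in> verts G}"

definition connected_graph :: "'a graph \<Rightarrow> bool" where
  "connected_graph G \<longleftrightarrow>
     verts G \<noteq> {} \<and> (\<forall>u \<in> verts G. \<forall>v \<in> verts G. (u, v) \<in> (adjacency G)\<^sup>*)"

definition neighborhood :: "'a graph \<Rightarrow> 'a set \<Rightarrow> 'a set" where
  "neighborhood H U = {v \<in> verts H. v \<notin> U \<and> (\<exists>u \<in> U. (u, v) \<in> adjacency H)}"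

definition expander :: "real \<Rightarrow> 'a graph \<Rightarrow> bool" where
  "expander \<beta> H \<longleftrightarrow>
     (\<forall>U \<subseteq> verts H. real (card U) \<le> real (card (verts H)) / 2 \<longrightarrow>
        real (card (neighborhood H U)) \<ge> \<beta> * real (card U))"

definition largest_component :: "'a graph \<Rightarrow> 'a set \<Rightarrow> bool" where
  "largest_component G L \<longleftrightarrow>
     L \<in> conn_components G \<and> (\<forall>C \<in> conn_components G. card C \<le> card L)"

text \<open>If several components have maximal size, any one of them may play the role of the largest
  one. The choice does not matter here: if all components other than some largest one are
  singletons, then the same holds for every other largest one.\<close>

definition small_components_isolated :: "'a graph \<Rightarrow> bool" where
  "small_components_isolated G \<longleftrightarrow>
     (\<exists>L. largest_component G L \<and> (\<forall>C \<in> conn_components G - {L}. \<exists>v. C = {v}))"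

definition regular_graphs :: "nat \<Rightarrow> nat \<Rightarrow> nat graph set" where
  "regular_graphs n d = {G. verts G = {..<n} \<and> simple_graph G \<and> regular_graph d G}"

text \<open>The uniform distribution is meaningful only if such a graph exists, that is, for
  \<open>d * n\<close> even and \<open>d < n\<close> (or \<open>n = 0\<close>); all other \<open>n\<close> are
  irrelevant to the limits below.\<close>

definition random_regular_graph :: "nat \<Rightarrow> nat \<Rightarrow> nat graph pmf" where
  "random_regular_graph n d = pmf_of_set (regular_graphs n d)"

text \<open>The Boolean \<open>D v\<close> says whether the vertex \<open>v\<close> is deleted.\<close>

definition delete_vertices :: "real \<Rightarrow> 'a graph \<Rightarrow> 'a graph pmf" where
  "delete_vertices p G =
     map_pmf (\<lambda>D. induced_subgraph G {v. \<not> D v})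
       (Pi_pmf (verts G) False (\<lambda>_. bernoulli_pmf p))"

definition deleted_regular_graph :: "nat \<Rightarrow> real \<Rightarrow> nat \<Rightarrow> nat graph pmf" where
  "deleted_regular_graph d \<alpha> n =
     bind_pmf (random_regular_graph n d) (delete_vertices (real n powr (- \<alpha>)))"

text \<open>The limit is taken along those \<open>n\<close> for which \<open>d * n\<close> is even.\<close>

definition whp :: "nat \<Rightarrow> real \<Rightarrow> (nat \<Rightarrow> nat graph \<Rightarrow> bool) \<Rightarrow> bool" where
  "whp d \<alpha> P \<longleftrightarrow>
     ((\<lambda>n. measure_pmf.prob (deleted_regular_graph d \<alpha> n) {H. P n H}) \<longlongrightarrow> 1)
       (inf at_top (principal {n. even (d * n)}))"

end

theory Submission
  imports Defs "HOL-Real_Asymp.Real_Asymp"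
begin

text \<open>
The proof separates the two sources of randomness. A random regular graph \<open>G\<close> has, with
probability tending to \<open>1\<close>, two properties: every set of at most half of the vertices has
at least a constant proportion of its size as neighbours (\<open>prob_not_expanding\<close>), and only few
bounded sets of vertices span a cycle (\<open>prob_many_cyclic_sets\<close>). For every graph with these
properties, random deletions leave the described structure with high probability.

Both properties of \<open>G\<close> come from switchings: two edges \<open>uv\<close> and \<open>xy\<close> of a regular
graph are replaced by \<open>ux\<close> and \<open>vy\<close>, and counting the switchings between two families of
graphs from both ends compares the sizes of the families (\<open>switch_double_count\<close>). This is
used twice. Switching a prescribed edge away shows that \<open>m\<close> prescribed edges are present
with probability at most \<open>(2d/n)^m\<close>, as long as \<open>m\<close> is below about half of the number of
edges. So small sets of vertices are sparse: sets of up to a small constant fraction of the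
vertices span fewer than \<open>5/4\<close> edges per vertex, and bounded sets
with as many edges as vertices are bounded in number on average. If a small set had few
neighbours, its closed neighbourhood would be too dense. For sets of linear size this union
bound is too weak. There, an edge inside the set \<open>U\<close> is switched with an edge outside, which
moves the number of edges leaving \<open>U\<close> up by two. The resulting ratios multiply up to products
of two binomial coefficients, and Vandermonde's identity shows that a sparse cut around
\<open>U\<close> has a probability of roughly one over the number of ways to choose \<open>dk/2\<close> out of
\<open>dn/2\<close> edges, where \<open>k\<close> is the size of \<open>U\<close>. As \<open>d \<ge> 3\<close>, this beats the number of
sets of size \<open>k\<close> by an exponential factor.

Now let \<open>G\<close> be fixed. It has at most \<open>n * d^(2k)\<close> connected sets of \<open>k\<close> vertices, since a
walk around a spanning tree determines such a set. Deleting half of the guaranteed neighbours of one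
of them has, for some \<open>c > 0\<close>, a probability of order \<open>n\<close> to the power \<open>-c * k\<close>, so this happens for no connected set with at
least \<open>K\<close> and at most \<open>n/2\<close> vertices, for a constant \<open>K\<close> (\<open>prob_few_survivors\<close>). Hence every
component has fewer than \<open>K\<close> or more than \<open>n/2\<close> vertices. Each small one is adjacent to a deleted
vertex, so they cover few vertices in total and exactly one large component is left
(\<open>giant_component\<close>). It is an expander because it suffices to bound edge boundaries of
connected sets (\<open>edge_boundary_induct\<close>, \<open>expander_component\<close>).

For the sizes of the small components, a connected set of \<open>k\<close> vertices with a tree-like
neighbourhood has at least \<open>(d - 2) * k + 2\<close> neighbours. There are linearly many such sets, so they
are cut off only if \<open>\<alpha> * ((d - 2) * k + 2) \<le> 1\<close>. The connected sets whose closed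
neighbourhood contains a cycle are so few that none of them is cut off
(\<open>prob_small_isolated\<close>). The inequality is stronger than the claimed bound for \<open>k\<close>; it excludes \<open>k \<ge> 2\<close> if \<open>\<alpha> > 1 / (2 * (d - 1))\<close>, and every
\<open>k \<ge> 1\<close> if \<open>\<alpha> > 1 / d\<close>.
\<close>

section \<open>Edge sets and ordered edges\<close>

definition nbrs :: "'a set set \<Rightarrow> 'a set \<Rightarrow> 'a set" where
  "nbrs E U = {v. v \<notin> U \<and> (\<exists>u\<in>U. {u, v} \<in> E)}"

text \<open>Edges are counted with an orientation: then \<open>d\<close>-regularity says that \<open>d * card A\<close> of them
  start in \<open>A\<close>, and the counts are additive in both end sets.\<close>

definition arcs :: "'a set set \<Rightarrow> 'a set \<Rightarrow> 'a set \<Rightarrow> ('a \<times> 'a) set" where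
  "arcs E A B = {(u, v). u \<in> A \<and> v \<in> B \<and> {u, v} \<in> E}"

definition spanned :: "'a set set \<Rightarrow> 'a set \<Rightarrow> 'a set set" where
  "spanned E W = {e \<in> E. e \<subseteq> W}"

locale regular_edges =
  fixes V :: "'a set" and d :: nat and E :: "'a set set"
  assumes finite_V: "finite V"
    and edgeD: "e \<in> E \<Longrightarrow> e \<subseteq> V \<and> card e = 2"
    and degree: "v \<in> V \<Longrightarrow> card {w. {v, w} \<in> E} = d"

lemma arcs_iff [simp]: "(u, v) \<in> arcs E A B \<longleftrightarrow> u \<in> A \<and> v \<in> B \<and> {u, v} \<in> E"
  by (simp add: arcs_def)

lemma finite_arcs: "finite A \<Longrightarrow> finite B \<Longrightarrow> finite (arcs E A B)"
  by (rule finite_subset[of _ "A \<times> B"]) (auto simp: arcs_def)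

lemma card_arcs_commute: "card (arcs E A B) = card (arcs E B A)"
proof -
  have "bij_betw prod.swap (arcs E A B) (arcs E B A)"
    by (rule bij_betwI[of _ _ _ prod.swap]) (auto simp: insert_commute)
  then show ?thesis by (rule bij_betw_same_card)
qed

lemma arcs_Un_right: "arcs E A (B \<union> C) = arcs E A B \<union> arcs E A C"
  by auto

lemma card_arcs_Un_right:
  assumes "finite A" "finite B" "finite C" "B \<inter> C = {}"
  shows "card (arcs E A (B \<union> C)) = card (arcs E A B) + card (arcs E A C)"
  unfolding arcs_Un_right using assms
  by (subst card_Un_disjoint) (auto simp: finite_arcs)

lemma card_arcs_Un_left:
  assumes "finite A" "finite B" "finite C" "B \<inter> C = {}"
  shows "card (arcs E (B \<union> C) A) = card (arcs E B A) + card (arcs E C A)"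
  using card_arcs_Un_right[OF assms] by (metis card_arcs_commute)

lemma nbrs_disjoint: "nbrs E U \<inter> U = {}"
  by (auto simp: nbrs_def)

context regular_edges
begin

lemma edge_verts: "{u, v} \<in> E \<Longrightarrow> u \<in> V \<and> v \<in> V \<and> u \<noteq> v"
  using edgeD[of "{u, v}"] by (auto simp: card_insert_if split: if_splits)

lemma finite_E: "finite E"
  by (rule finite_subset[of _ "Pow V"]) (use edgeD finite_V in auto)

lemma nbrs_subset: "nbrs E U \<subseteq> V"
  by (auto simp: nbrs_def dest: edge_verts)

lemma finite_nbrs: "finite (nbrs E U)"
  using nbrs_subset finite_V by (rule finite_subset)

lemma finite_nbr: "finite {w. {v, w} \<in> E}"
  by (rule finite_subset[OF _ finite_V]) (auto dest: edge_verts)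

lemma card_nbr_le: "card {w. {v, w} \<in> E} \<le> d"
proof (cases "v \<in> V")
  case False
  then have "{w. {v, w} \<in> E} = {}" by (auto dest: edge_verts)
  then show ?thesis by simp
qed (simp add: degree)

lemma card_arcs_V:
  assumes "A \<subseteq> V"
  shows "card (arcs E A V) = d * card A"
proof -
  have "arcs E A V = Sigma A (\<lambda>u. {v. {u, v} \<in> E})"
    by (auto dest: edge_verts)
  moreover have "finite A" using assms finite_V finite_subset by blast
  ultimately show ?thesis
    using assms by (simp add: card_SigmaI finite_nbr degree subset_iff)
qed

lemma card_arcs_le:
  assumes "finite A"
  shows "card (arcs E A B) \<le> d * card A"
proof -
  have "arcs E A B \<subseteq> Sigma A (\<lambda>u. {v. {u, v} \<in> E})"
    by auto
  then have "card (arcs E A B) \<le> card (Sigma A (\<lambda>u. {v. {u, v} \<in> E}))"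
    using assms finite_nbr by (intro card_mono finite_SigmaI) auto
  also have "\<dots> = (\<Sum>u\<in>A. card {v. {u, v} \<in> E})"
    using assms finite_nbr by (intro card_SigmaI) auto
  also have "\<dots> \<le> (\<Sum>u\<in>A. d)"
    by (intro sum_mono card_nbr_le)
  finally show ?thesis by (simp add: mult.commute)
qed

lemma arcs_complement: "U \<subseteq> V \<Longrightarrow> arcs E U (V - U) = arcs E U (nbrs E U)"
  by (auto simp: nbrs_def dest: edge_verts)

lemma card_arcs_split:
  assumes "U \<subseteq> V"
  shows "card (arcs E U U) + card (arcs E U (V - U)) = d * card U"
proof -
  have "finite U" "U \<union> (V - U) = V" using assms finite_V finite_subset by auto
  then show ?thesis
    using card_arcs_Un_right[of U U "V - U" E] finite_V card_arcs_V[OF assms] by auto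
qed

lemma card_arcs_self:
  assumes "finite W"
  shows "card (arcs E W W) = 2 * card (spanned E W)"
proof -
  have fin: "finite (spanned E W)"
    using finite_E by (auto simp: spanned_def)
  have "arcs E W W = (\<Union>e\<in>spanned E W. {(u, v). {u, v} = e})"
    by (auto simp: spanned_def)
  also have "card \<dots> = (\<Sum>e\<in>spanned E W. card {(u, v). {u, v} = e})"
  proof (rule card_UN_disjoint[OF fin])
    show "\<forall>e\<in>spanned E W. finite {(u, v). {u, v} = e}"
    proof
      fix e assume "e \<in> spanned E W"
      then have "finite e" using assms by (auto simp: spanned_def intro: finite_subset)
      then have "finite (e \<times> e)" by simp
      then show "finite {(u, v). {u, v} = e}"
        by (rule rev_finite_subset) auto
    qed
  qed auto
  also have "\<dots> = (\<Sum>e\<in>spanned E W. 2)"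
  proof (rule sum.cong[OF refl])
    fix e assume "e \<in> spanned E W"
    then have "card e = 2" using edgeD by (auto simp: spanned_def)
    then obtain x y where e: "e = {x, y}" "x \<noteq> y" by (auto simp: card_2_iff)
    have "{(u, v). {u, v} = e} = {(x, y), (y, x)}"
      unfolding e(1) by (auto simp: doubleton_eq_iff)
    then show "card {(u, v). {u, v} = e} = 2" using e(2) by simp
  qed
  finally show ?thesis by simp
qed

lemma card_nbrs_le_arcs:
  assumes "U \<subseteq> V"
  shows "card (nbrs E U) \<le> card (arcs E U (V - U))"
proof -
  have fin: "finite (arcs E U (V - U))"
    using assms finite_V finite_subset by (blast intro: finite_arcs)
  have "nbrs E U \<subseteq> snd ` arcs E U (V - U)"
  proof
    fix v assume "v \<in> nbrs E U"
    then obtain u where "u \<in> U" "{u, v} \<in> E" "v \<notin> U" by (auto simp: nbrs_def)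
    then have "(u, v) \<in> arcs E U (V - U)" by (auto dest: edge_verts)
    then show "v \<in> snd ` arcs E U (V - U)" by (intro image_eqI[of _ _ "(u, v)"]) simp_all
  qed
  then show ?thesis using fin surj_card_le by blast
qed

lemma card_arcs_le_nbrs:
  assumes "U \<subseteq> V"
  shows "card (arcs E U (V - U)) \<le> d * card (nbrs E U)"
  unfolding arcs_complement[OF assms]
  using card_arcs_le[OF finite_nbrs, of U U] by (metis card_arcs_commute)

text \<open>The closed neighbourhood spans every edge that meets \<open>U\<close>; those number half of the
  ordered edges inside \<open>U\<close>, plus all the edges that leave \<open>U\<close>.\<close>

lemma spanned_closed_nbhd:
  assumes "U \<subseteq> V"
  shows "card (spanned E U) + card (arcs E U (V - U)) \<le> card (spanned E (U \<union> nbrs E U))"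
proof -
  let ?N = "nbrs E U"
  have fin: "finite U" "finite ?N" using assms finite_V finite_subset finite_nbrs by auto
  have "card (arcs E (U \<union> ?N) (U \<union> ?N))
      = card (arcs E U U) + card (arcs E U ?N) + (card (arcs E ?N U) + card (arcs E ?N ?N))"
    using fin nbrs_disjoint[of E U] by (simp add: card_arcs_Un_left card_arcs_Un_right Int_commute)
  then show ?thesis
    using card_arcs_self[OF fin(1)] card_arcs_self[of "U \<union> ?N"] fin arcs_complement[OF assms]
      card_arcs_commute[of E ?N U] by simp
qed

end

section \<open>Switching two edges\<close>

fun switch :: "'a set set \<Rightarrow> 'a \<times> 'a \<times> 'a \<times> 'a \<Rightarrow> 'a set set" where
  "switch E (u, v, x, y) = E - {{u, v}, {x, y}} \<union> {{u, x}, {v, y}}"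

definition switchable :: "'a set set \<Rightarrow> 'a \<times> 'a \<times> 'a \<times> 'a \<Rightarrow> bool" where
  "switchable E = (\<lambda>(u, v, x, y). {u, v} \<in> E \<and> {x, y} \<in> E \<and> {u, x} \<notin> E \<and> {v, y} \<notin> E \<and>
     u \<noteq> x \<and> v \<noteq> y)"

text \<open>Distinctness of the four vertices is automatic: \<open>u = y\<close> or \<open>v = x\<close> would make
  one of the new edges an old one.\<close>

lemma (in regular_edges) switchable_distinct:
  assumes "switchable E (u, v, x, y)"
  shows "u \<noteq> v \<and> u \<noteq> x \<and> u \<noteq> y \<and> v \<noteq> x \<and> v \<noteq> y \<and> x \<noteq> y"
  using assms by (auto simp: switchable_def insert_commute dest: edge_verts)

lemma (in regular_edges) regular_switch:
  assumes "switchable E (u, v, x, y)"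
  shows "regular_edges V d (switch E (u, v, x, y))"
proof
  note dist = switchable_distinct[OF assms]
  have sw: "{u, v} \<in> E" "{x, y} \<in> E" "{u, x} \<notin> E" "{v, y} \<notin> E"
    using assms by (auto simp: switchable_def)
  have inV: "u \<in> V" "v \<in> V" "x \<in> V" "y \<in> V" using sw edge_verts by auto
  show "finite V" by (rule finite_V)
  show "e \<subseteq> V \<and> card e = 2" if "e \<in> switch E (u, v, x, y)" for e
    using that dist inV edgeD by auto
  fix z assume "z \<in> V"
  define N where "N = {w. {z, w} \<in> E}"
  have N: "card N = d" "finite N" using degree[OF \<open>z \<in> V\<close>] finite_nbr by (auto simp: N_def)
  have swap: "card (N - {a} \<union> {b}) = d" if "a \<in> N" "b \<notin> N" for a b
  proof -
    have "card (N - {a}) = d - 1" "d \<ge> 1"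
      using N that by (auto simp: card_gt_0_iff Suc_le_eq)
    then show ?thesis using that N by auto
  qed
  let ?M = "{w. {z, w} \<in> switch E (u, v, x, y)}"
  consider "z = u" | "z = v" | "z = x" | "z = y" | "z \<notin> {u, v, x, y}" by blast
  then show "card ?M = d"
  proof cases
    case 1
    then have "?M = N - {v} \<union> {x}" "v \<in> N" "x \<notin> N"
      using dist sw by (auto simp: N_def doubleton_eq_iff)
    then show ?thesis using swap by simp
  next
    case 2
    then have "?M = N - {u} \<union> {y}" "u \<in> N" "y \<notin> N"
      using dist sw by (auto simp: N_def doubleton_eq_iff insert_commute)
    then show ?thesis using swap by simp
  next
    case 3
    then have "?M = N - {y} \<union> {u}" "y \<in> N" "u \<notin> N"
      using dist sw by (auto simp: N_def doubleton_eq_iff insert_commute)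
    then show ?thesis using swap by simp
  next
    case 4
    then have "?M = N - {x} \<union> {v}" "x \<in> N" "v \<notin> N"
      using dist sw by (auto simp: N_def doubleton_eq_iff insert_commute)
    then show ?thesis using swap by simp
  next
    case 5
    then have "?M = N" by (auto simp: N_def doubleton_eq_iff)
    then show ?thesis using N by simp
  qed
qed

lemma (in regular_edges) switch_undo:
  assumes "switchable E (u, v, x, y)"
  shows "E = switch E (u, v, x, y) - {{u, x}, {v, y}} \<union> {{u, v}, {x, y}}"
  using assms switchable_distinct[OF assms]
  by (auto simp: switchable_def doubleton_eq_iff)

text \<open>Since a switch can be undone, counting the switches that lead from a family \<open>P\<close> of
  edge sets into a family \<open>Q\<close> from both ends compares the sizes of the two families.\<close>

lemma switch_double_count:
  fixes P Q :: "'a set set set" and c D :: real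
  assumes fin: "finite P" "finite Q"
    and reg: "\<And>E. E \<in> P \<Longrightarrow> regular_edges V d E"
    and T: "\<And>E. E \<in> P \<Longrightarrow> finite (T E) \<and> c \<le> real (card (T E))"
    and B: "\<And>E. E \<in> Q \<Longrightarrow> finite (B E) \<and> real (card (B E)) \<le> D"
    and sw: "\<And>E q. E \<in> P \<Longrightarrow> q \<in> T E \<Longrightarrow>
               switchable E q \<and> switch E q \<in> Q \<and> q \<in> B (switch E q)"
  shows "c * real (card P) \<le> D * real (card Q)"
proof -
  have "c * real (card P) = (\<Sum>E\<in>P. c)" by simp
  also have "\<dots> \<le> (\<Sum>E\<in>P. real (card (T E)))" by (intro sum_mono) (use T in auto)
  also have "\<dots> = real (card (Sigma P T))"
    using fin T by (simp add: card_SigmaI)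
  also have "card (Sigma P T) \<le> card (Sigma Q B)"
  proof (rule card_inj_on_le)
    show "inj_on (\<lambda>(E, q). (switch E q, q)) (Sigma P T)"
    proof (rule inj_onI, clarsimp simp del: switch.simps)
      fix E1 E2 and u v x y :: 'a
      assume *: "E1 \<in> P" "E2 \<in> P" "(u, v, x, y) \<in> T E1" "(u, v, x, y) \<in> T E2"
        and eq: "switch E1 (u, v, x, y) = switch E2 (u, v, x, y)"
      from * have "regular_edges V d E1" "regular_edges V d E2"
        "switchable E1 (u, v, x, y)" "switchable E2 (u, v, x, y)"
        using reg sw by auto
      then show "E1 = E2" using eq regular_edges.switch_undo by metis
    qed
    show "(\<lambda>(E, q). (switch E q, q)) ` Sigma P T \<subseteq> Sigma Q B" using sw by auto
    show "finite (Sigma Q B)" using fin B by auto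
  qed
  also have "real (card (Sigma Q B)) = (\<Sum>E\<in>Q. real (card (B E)))"
    using fin B by (simp add: card_SigmaI)
  also have "\<dots> \<le> (\<Sum>E\<in>Q. D)" by (intro sum_mono) (use B in auto)
  finally show ?thesis by (simp add: mult.commute)
qed

section \<open>Prescribed edges of a random regular graph\<close>

definition reg_family :: "nat \<Rightarrow> nat \<Rightarrow> nat set set set" where
  "reg_family n d = {E. regular_edges {..<n} d E}"

definition random_edges :: "nat \<Rightarrow> nat \<Rightarrow> nat set set pmf" where
  "random_edges n d = pmf_of_set (reg_family n d)"

lemma finite_reg_family: "finite (reg_family n d)"
proof (rule finite_subset)
  show "reg_family n d \<subseteq> Pow (Pow {..<n})"
    by (auto simp: reg_family_def dest: regular_edges.edgeD)
qed simp

lemma prob_random_edges: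
  assumes "reg_family n d \<noteq> {}"
  shows "measure_pmf.prob (random_edges n d) {E. P E}
    = real (card {E \<in> reg_family n d. P E}) / real (card (reg_family n d))"
  unfolding random_edges_def
  by (simp add: measure_pmf_of_set[OF assms finite_reg_family] Collect_conj_eq Int_commute)

lemma set_random_edges:
  assumes "reg_family n d \<noteq> {}" "E \<in> set_pmf (random_edges n d)"
  shows "regular_edges {..<n} d E"
  using assms finite_reg_family by (simp add: random_edges_def reg_family_def)

lemma card_arcs_of_edge: "finite {(x, y). {x, y} = f} \<and> card {(x, y). {x, y} = f} \<le> 2"
proof (cases "{(x, y). {x, y} = f} = {}")
  case False
  then obtain a b where f: "f = {a, b}" by blast
  have sub: "{(x, y). {x, y} = f} \<subseteq> {(a, b), (b, a)}"
    unfolding f by (clarsimp simp: doubleton_eq_iff)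
  have "card {(a, b), (b, a)} \<le> 2" using card_length[of "[(a, b), (b, a)]"] by simp
  then show ?thesis using card_mono[OF _ sub] finite_subset[OF sub] by simp
qed simp

text \<open>The edge \<open>e = {u, v}\<close> is switched away together with another edge \<open>{x, y}\<close> that is not
  close to it: there are about \<open>d * n\<close> choices of \<open>(x, y)\<close>, while a reverse switch has to pick
  \<open>x\<close> and \<open>y\<close> among the neighbours of \<open>u\<close> and \<open>v\<close>.\<close>

lemma contain_edge_step:
  assumes "finite F" "e \<notin> F"
  shows "(real d * real n - 2 * (real (card F) + 1) - 2 * real d * (real d + 1))
      * real (card {E \<in> reg_family n d. insert e F \<subseteq> E})
    \<le> real d ^ 2 * real (card {E \<in> reg_family n d. F \<subseteq> E})"
    (is "?c * real (card ?P) \<le> _ * real (card ?Q)")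
proof (cases "?P = {}")
  case True
  then show ?thesis by (simp only: card.empty) simp
next
  case False
  then obtain E0 where E0: "regular_edges {..<n} d E0" "e \<in> E0" by (auto simp: reg_family_def)
  then obtain u v where e: "e = {u, v}"
    using regular_edges.edgeD[OF E0] by (auto simp: card_2_iff)
  define N where "N = (\<lambda>E z. {w. {z, w} \<in> E} :: nat set)"
  define T where "T = (\<lambda>E. (\<lambda>(x, y). (u, v, x, y)) `
    {(x, y). {x, y} \<in> E \<and> {x, y} \<notin> insert e F \<and> x \<notin> insert u (N E u) \<and> y \<notin> insert v (N E v)})"
  define B where "B = (\<lambda>E. (\<lambda>(x, y). (u, v, x, y)) ` (N E u \<times> N E v))"
  show ?thesis
  proof (rule switch_double_count[where T = T and B = B and V = "{..<n}" and d = d])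
    show "finite ?P" "finite ?Q" using finite_reg_family by auto
    fix E
    show "regular_edges {..<n} d E" if "E \<in> ?P" using that by (simp add: reg_family_def)
    show "finite (T E) \<and> ?c \<le> real (card (T E))" if "E \<in> ?P"
    proof -
      interpret regular_edges "{..<n}" d E using that by (simp add: reg_family_def)
      let ?V = "{..<n}"
      let ?G = "{(x, y). {x, y} \<in> E \<and> {x, y} \<notin> insert e F \<and> x \<notin> insert u (N E u) \<and> y \<notin> insert v (N E v)}"
      let ?B1 = "\<Union>f\<in>insert e F. {(x, y). {x, y} = f}"
      let ?B2 = "arcs E (insert u (N E u)) ?V" and ?B3 = "arcs E ?V (insert v (N E v))"
      have cN: "card (insert z (N E z)) \<le> d + 1" "finite (N E z)" for z
        using card_nbr_le[of z] finite_nbr[of z] by (auto simp: N_def card_insert_if)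
      have G_sub: "?G \<subseteq> arcs E ?V ?V" by (auto dest: edge_verts)
      have finG: "finite ?G" by (rule finite_subset[OF G_sub]) (simp add: finite_arcs)
      have "card ?B1 \<le> (\<Sum>f\<in>insert e F. card {(x, y). {x, y} = f})"
        using assms by (intro card_UN_le) auto
      also have "\<dots> \<le> (\<Sum>f\<in>insert e F. 2)"
        by (intro sum_mono) (use card_arcs_of_edge in blast)
      also have "\<dots> \<le> 2 * (card F + 1)"
        using assms by (simp add: card_insert_if)
      finally have B1: "card ?B1 \<le> 2 * (card F + 1)" .
      have "card ?B2 \<le> d * card (insert u (N E u))" by (rule card_arcs_le) (simp add: cN)
      also have "\<dots> \<le> d * (d + 1)" by (intro mult_left_mono cN) simp
      finally have B2: "card ?B2 \<le> d * (d + 1)" .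
      have "card ?B3 = card (arcs E (insert v (N E v)) ?V)" by (rule card_arcs_commute)
      also have "\<dots> \<le> d * card (insert v (N E v))" by (rule card_arcs_le) (simp add: cN)
      also have "\<dots> \<le> d * (d + 1)" by (intro mult_left_mono cN) simp
      finally have B3: "card ?B3 \<le> d * (d + 1)" .
      have finB: "finite ?B1" "finite ?B2" "finite ?B3"
        using assms card_arcs_of_edge cN(2) by (auto intro!: finite_arcs)
      have "arcs E ?V ?V \<subseteq> ?G \<union> (?B1 \<union> (?B2 \<union> ?B3))"
      proof (rule subrelI)
        fix x y assume "(x, y) \<in> arcs E ?V ?V"
        then show "(x, y) \<in> ?G \<union> (?B1 \<union> (?B2 \<union> ?B3))"
          by (simp del: insert_iff Un_insert_left) blast
      qed
      then have "card (arcs E ?V ?V) \<le> card (?G \<union> (?B1 \<union> (?B2 \<union> ?B3)))"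
        using finG finB by (intro card_mono finite_UnI)
      also have "\<dots> \<le> card ?G + (card ?B1 + (card ?B2 + card ?B3))"
        by (intro order_trans[OF card_Un_le] add_left_mono order_refl)
      also have "\<dots> \<le> card ?G + (2 * (card F + 1) + (d * (d + 1) + d * (d + 1)))"
        using B1 B2 B3 by linarith
      finally have "d * n \<le> card ?G + (2 * (card F + 1) + (d * (d + 1) + d * (d + 1)))"
        using card_arcs_V[of ?V] by simp
      then have "real (d * n) \<le> real (card ?G + (2 * (card F + 1) + (d * (d + 1) + d * (d + 1))))"
        by (simp only: of_nat_le_iff)
      moreover have "card (T E) = card ?G"
        unfolding T_def by (rule card_image) (auto simp: inj_on_def)
      moreover have "finite (T E)" using finG by (simp add: T_def)
      ultimately show ?thesis by (simp add: algebra_simps)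
    qed
    show "finite (B E) \<and> real (card (B E)) \<le> real d ^ 2" if "E \<in> ?Q"
    proof -
      interpret regular_edges "{..<n}" d E using that by (simp add: reg_family_def)
      have fin: "finite (N E u \<times> N E v)" using finite_nbr by (simp add: N_def)
      have "card (B E) \<le> card (N E u \<times> N E v)" unfolding B_def using fin by (rule card_image_le)
      also have "\<dots> \<le> d * d"
        unfolding card_cartesian_product by (intro mult_mono) (auto simp: N_def card_nbr_le)
      finally have "real (card (B E)) \<le> real (d * d)" by (simp only: of_nat_le_iff)
      then show ?thesis using fin by (simp add: B_def power2_eq_square)
    qed
    fix q assume E: "E \<in> ?P" and q: "q \<in> T E"
    then obtain x y where q_eq: "q = (u, v, x, y)" and xy: "{x, y} \<in> E" "{x, y} \<notin> insert e F"
      "x \<notin> insert u (N E u)" "y \<notin> insert v (N E v)" by (auto simp: T_def)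
    interpret regular_edges "{..<n}" d E using E by (simp add: reg_family_def)
    have sw: "switchable E q"
      using xy E by (auto simp: q_eq switchable_def e N_def)
    moreover have "switch E q \<in> reg_family n d"
      using regular_switch sw by (simp add: q_eq reg_family_def del: switch.simps)
    moreover have "F \<subseteq> switch E q"
      using E xy assms(2) by (auto simp: q_eq e)
    moreover have "q \<in> B (switch E q)"
      by (auto simp: q_eq B_def N_def)
    ultimately show "switchable E q \<and> switch E q \<in> ?Q \<and> q \<in> B (switch E q)" by simp
  qed
qed

lemma prob_contains_edges:
  assumes ne: "reg_family n d \<noteq> {}" and F: "finite F" and n: "n > 0" "d > 0"
    and small: "2 * real (card F) + 2 * real d * (real d + 1) \<le> real d * real n / 2"
  shows "measure_pmf.prob (random_edges n d) {E. F \<subseteq> E} \<le> (2 * real d / real n) ^ card F"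
  using F small
proof (induction F rule: finite_induct)
  case (insert e F)
  let ?p = "\<lambda>F. measure_pmf.prob (random_edges n d) {E. F \<subseteq> E}"
  let ?c = "real d * real n - 2 * (real (card F) + 1) - 2 * real d * (real d + 1)"
  have c: "?c \<ge> real d * real n / 2" using insert.prems insert.hyps by simp
  have dn: "real d * real n / 2 > 0" using n by simp
  have "?c * ?p (insert e F) \<le> real d ^ 2 * ?p F"
    using contain_edge_step[OF insert.hyps(1,2), of d n]
    unfolding prob_random_edges[OF ne] by (simp add: divide_right_mono del: insert_subset)
  moreover have "real d * real n / 2 * ?p (insert e F) \<le> ?c * ?p (insert e F)"
    using c by (intro mult_right_mono) auto
  ultimately have "real d * (real n / 2 * ?p (insert e F)) \<le> real d * (real d * ?p F)"
    unfolding power2_eq_square by (metis (no_types, lifting) mult.assoc order_trans times_divide_eq_right)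
  then have "real n / 2 * ?p (insert e F) \<le> real d * ?p F"
    using n by (simp del: insert_subset)
  then have "?p (insert e F) \<le> (2 * real d / real n) * ?p F"
    using n by (simp add: field_simps del: insert_subset)
  also have "\<dots> \<le> (2 * real d / real n) * (2 * real d / real n) ^ card F"
    using insert.prems insert.hyps by (intro mult_left_mono insert.IH) auto
  finally show ?case using insert.hyps by simp
qed simp

lemma prob_UN_le:
  fixes M :: "'a pmf"
  assumes "finite I"
  shows "measure_pmf.prob M (\<Union>i\<in>I. A i) \<le> (\<Sum>i\<in>I. measure_pmf.prob M (A i))"
  using assms by (intro measure_pmf.finite_measure_subadditive_finite) auto

text \<open>A union bound over the sets of \<open>m\<close> pairs inside \<open>W\<close>.\<close>

lemma prob_spans_many:
  assumes ne: "reg_family n d \<noteq> {}" and n: "n > 0" "d > 0" and W: "finite W"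
    and small: "2 * real m + 2 * real d * (real d + 1) \<le> real d * real n / 2"
  shows "measure_pmf.prob (random_edges n d) {E. m \<le> card (spanned E W)}
    \<le> real ((card W choose 2) choose m) * (2 * real d / real n) ^ m"
proof -
  let ?P = "measure_pmf.prob (random_edges n d)"
  define pairs where "pairs = {e. e \<subseteq> W \<and> card e = 2}"
  have pairs: "finite pairs" "card pairs = card W choose 2"
    using W n_subsets[of W 2] by (auto simp: pairs_def)
  define I where "I = {F. F \<subseteq> pairs \<and> card F = m}"
  have I: "finite I" "card I = card pairs choose m"
    using pairs n_subsets[of pairs m] by (auto simp: I_def)
  have "?P {E. m \<le> card (spanned E W)} \<le> ?P (\<Union>F\<in>I. {E. F \<subseteq> E})"
  proof (rule measure_pmf.finite_measure_mono_AE)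
    show "AE E in random_edges n d. E \<in> {E. m \<le> card (spanned E W)}
        \<longrightarrow> E \<in> (\<Union>F\<in>I. {E. F \<subseteq> E})"
    proof (rule AE_pmfI, rule impI)
      fix E assume "E \<in> set_pmf (random_edges n d)" and m: "E \<in> {E. m \<le> card (spanned E W)}"
      then interpret regular_edges "{..<n}" d E using set_random_edges[OF ne] by blast
      obtain F where F: "F \<subseteq> spanned E W" "card F = m"
        using m obtain_subset_with_card_n[of m "spanned E W"] by auto
      have "spanned E W \<subseteq> pairs" "spanned E W \<subseteq> E"
        using edgeD by (auto simp: spanned_def pairs_def)
      then have "F \<in> I" "F \<subseteq> E" using F by (auto simp: I_def)
      then show "E \<in> (\<Union>F\<in>I. {E. F \<subseteq> E})" by blast
    qed
  qed auto
  also have "\<dots> \<le> (\<Sum>F\<in>I. ?P {E. F \<subseteq> E})" by (rule prob_UN_le[OF I(1)])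
  also have "\<dots> \<le> (\<Sum>F\<in>I. (2 * real d / real n) ^ m)"
  proof (rule sum_mono)
    fix F assume "F \<in> I"
    then have "card F = m" "finite F" using pairs(1) by (auto simp: I_def intro: finite_subset)
    then show "?P {E. F \<subseteq> E} \<le> (2 * real d / real n) ^ m"
      using prob_contains_edges[OF ne _ n, of F] small by simp
  qed
  finally show ?thesis by (simp add: I pairs)
qed

section \<open>Sparsity of small vertex sets\<close>

lemma power_le_fact: "real m ^ m \<le> 3 ^ m * fact m"
proof -
  have "real m ^ m / fact m \<le> exp (real m)"
  proof -
    have "(\<Sum>k\<in>{m}. real m ^ k /\<^sub>R fact k) \<le> (\<Sum>k. real m ^ k /\<^sub>R fact k)"
      by (intro sum_le_suminf summable_exp_generic) auto
    then show ?thesis by (simp add: exp_def divide_inverse mult.commute)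
  qed
  also have "exp (real m) = exp 1 ^ m" by (simp add: exp_of_nat_mult[symmetric])
  also have "\<dots> \<le> 3 ^ m" by (intro power_mono exp_le) auto
  finally show ?thesis by (simp add: divide_le_eq)
qed

lemma binomial_le_3:
  assumes "m > 0"
  shows "real (N choose m) \<le> (3 * real N / real m) ^ m"
proof -
  have "real (N choose m) * fact m \<le> real N ^ m"
    using binomial_fact_pow[of N m] by (metis of_nat_fact of_nat_le_iff of_nat_mult of_nat_power)
  then have "real (N choose m) \<le> real N ^ m / fact m" by (simp add: field_simps)
  also have "\<dots> \<le> real N ^ m / (real m ^ m / 3 ^ m)"
    using power_le_fact[of m] assms by (intro divide_left_mono) (auto simp: field_simps)
  finally show ?thesis by (simp add: power_divide power_mult_distrib mult.commute)
qed

text \<open>Up to constant factors per vertex, the number of sets contributes \<open>n/w\<close> for each vertex to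
  the union bound, while \<open>5/4\<close> edges per vertex contribute \<open>w/n\<close> to the power \<open>5/4\<close>. What is left
  is \<open>w/n\<close> to the power \<open>1/4\<close>. Any number strictly between \<open>1\<close> and \<open>3/2\<close> could replace \<open>5/4\<close>:
  the union bound needs more than one edge per vertex, and a set with few neighbours in a graph of
  degree at least \<open>3\<close> has nearly \<open>3/2\<close>.\<close>

lemma prob_dense_set:
  assumes ne: "reg_family n d \<noteq> {}" and d: "d \<ge> 3" and w: "w > 0"
    and wn: "real w \<le> real n / (3 * real d * (18 * real d) ^ 4)"
    and n: "real n \<ge> 4 * (real d + 1) ^ 2"
  shows "measure_pmf.prob (random_edges n d)
           {E. \<exists>W\<subseteq>{..<n}. card W = w \<and> 5 * w \<le> 4 * card (spanned E W)}
    \<le> (9 * real d * (3 * real d * (real w / real n)) powr (1/4)) ^ w"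
proof -
  let ?P = "measure_pmf.prob (random_edges n d)"
  define m where "m = (5 * w + 3) div 4"
  define z where "z = 3 * real d * (real w / real n)"
  \<comment> \<open>\<open>m\<close> is \<open>5 * w / 4\<close> rounded up\<close>
  have m: "5 * real w / 4 \<le> real m" "real m \<le> 5 * real w / 4 + 1" "w \<le> m" "m > 0"
    using w unfolding m_def by linarith+
  have n0: "real n > 0" using n d by (smt (verit) of_nat_0_le_iff power2_less_eq_zero_iff)
  have big: "3 * real d * (18 * real d) ^ 4 \<ge> 54"
  proof -
    have "(18 * real d) ^ 4 \<ge> 1 ^ 4" using d by (intro power_mono) auto
    then have "3 * real d * (18 * real d) ^ 4 \<ge> 9 * (18 * real d)^4"
      using d by (intro mult_right_mono) auto
    moreover have "(18 * real d) ^ 4 \<ge> (6::real) ^ 4" using d by (intro power_mono) auto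
    ultimately show ?thesis by simp
  qed
  have "real n / (3 * real d * (18 * real d) ^ 4) \<le> real n / 54"
    using big n0 by (intro divide_left_mono) auto
  then have w54: "real w \<le> real n / 54" using wn by simp
  have z: "0 < z" "z \<le> (1 / (18 * real d)) ^ 4"
    using wn n0 w d by (auto simp: z_def field_simps)
  have z1: "z \<le> 1"
  proof -
    have "(1 / (18 * real d)) ^ 4 \<le> 1 ^ 4" using d by (intro power_mono) auto
    with z show ?thesis by simp
  qed
  have small: "2 * real m + 2 * real d * (real d + 1) \<le> real d * real n / 2"
  proof -
    have "2 * real m \<le> 5 / 2 * (real n / 54) + 2" using m w54 by linarith
    moreover have "3 * real n / 2 \<le> real d * real n / 2" using d by (simp add: mult_right_mono)
    moreover have "2 * real d * (real d + 1) + 2 \<le> 2 * (real d + 1) ^ 2"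
      using d by (simp add: power2_eq_square algebra_simps)
    ultimately show ?thesis using n n0 by linarith
  qed
  define I where "I = {W. W \<subseteq> {..<n} \<and> card W = w}"
  have I: "finite I" "card I = n choose w"
    using n_subsets[of "{..<n}" w] by (auto simp: I_def)
  have "?P {E. \<exists>W\<subseteq>{..<n}. card W = w \<and> 5 * w \<le> 4 * card (spanned E W)}
      \<le> ?P (\<Union>W\<in>I. {E. m \<le> card (spanned E W)})"
    by (intro measure_pmf.finite_measure_mono) (auto simp: I_def m_def)
  also have "\<dots> \<le> (\<Sum>W\<in>I. ?P {E. m \<le> card (spanned E W)})" by (rule prob_UN_le[OF I(1)])
  also have "\<dots> \<le> (\<Sum>W\<in>I. real ((w choose 2) choose m) * (2 * real d / real n) ^ m)"
  proof (rule sum_mono)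
    fix W assume "W \<in> I"
    then have "card W = w" "finite W" by (auto simp: I_def intro: finite_subset)
    then show "?P {E. m \<le> card (spanned E W)} \<le> real ((w choose 2) choose m) * (2 * real d / real n) ^ m"
      using prob_spans_many[OF ne _ _ _ small, of W] n0 d by simp
  qed
  also have "\<dots> = real (n choose w) * (real ((w choose 2) choose m) * (2 * real d / real n) ^ m)"
    by (simp add: I)
  also have "\<dots> \<le> (3 * real n / real w) ^ w * z ^ m"
  proof (rule mult_mono)
    show "real (n choose w) \<le> (3 * real n / real w) ^ w" by (rule binomial_le_3[OF w])
    have "real ((w choose 2) choose m) * (2 * real d / real n) ^ m
        \<le> (3 * real (w choose 2) / real m) ^ m * (2 * real d / real n) ^ m"
      by (intro mult_right_mono binomial_le_3 m) auto
    also have "\<dots> = (3 * real (w choose 2) / real m * (2 * real d / real n)) ^ m"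
      by (simp only: power_mult_distrib)
    also have "\<dots> \<le> z ^ m"
    proof (rule power_mono)
      have "2 * real (w choose 2) \<le> real w * real w"
      proof -
        have "2 * (w choose 2) \<le> w * (w - 1)" by (simp add: choose_two)
        also have "\<dots> \<le> w * w" by (intro mult_left_mono) auto
        finally have "2 * (w choose 2) \<le> w * w" .
        then show ?thesis by (metis of_nat_le_iff of_nat_mult of_nat_numeral)
      qed
      also have "\<dots> \<le> real w * real m" using m by (intro mult_left_mono) auto
      finally have "2 * real (w choose 2) / real m \<le> real w" using m by (simp add: field_simps)
      then have "2 * real (w choose 2) / real m * (3 * real d / real n) \<le> real w * (3 * real d / real n)"
        by (intro mult_right_mono) auto
      then show "3 * real (w choose 2) / real m * (2 * real d / real n) \<le> z"
        by (simp add: z_def mult.commute mult.left_commute)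
    qed auto
    finally show "real ((w choose 2) choose m) * (2 * real d / real n) ^ m \<le> z ^ m" .
  qed auto
  also have "z ^ m \<le> z powr (5 * real w / 4)"
    using z z1 m by (subst powr_realpow[symmetric]) (auto intro!: powr_mono')
  also have "z powr (5 * real w / 4) = (z * z powr (1/4)) ^ w"
  proof -
    have "z powr (5 * real w / 4) = (z powr (5/4)) powr real w" by (simp add: powr_powr)
    also have "z powr (5/4) = z powr 1 * z powr (1/4)" by (subst powr_add[symmetric]) simp
    finally show ?thesis using z by (simp add: powr_realpow)
  qed
  also have "(3 * real n / real w) ^ w * (z * z powr (1/4)) ^ w
      = (3 * real n / real w * z * z powr (1/4)) ^ w"
    by (simp only: power_mult_distrib mult.assoc)
  also have "3 * real n / real w * z = 9 * real d"
    using n0 w by (simp add: z_def)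
  finally show ?thesis by (simp add: z_def mult_left_mono)
qed

text \<open>The bounds for the sizes \<open>w = 1, 2, \<dots>\<close> each tend to \<open>0\<close> and are dominated by a geometric
  series, so Tannery's theorem applies to their sum.\<close>

lemma prob_dense_set_tendsto:
  fixes d :: nat
  defines "\<epsilon> \<equiv> 1 / (3 * real d * (18 * real d) ^ 4)"
  assumes d: "d \<ge> 3"
  obtains err :: "nat \<Rightarrow> real" where "err \<longlonglongrightarrow> 0"
    and "\<forall>\<^sub>F n in sequentially. reg_family n d \<noteq> {} \<longrightarrow>
      measure_pmf.prob (random_edges n d)
        {E. \<exists>W\<subseteq>{..<n}. W \<noteq> {} \<and> real (card W) \<le> \<epsilon> * real n
              \<and> 5 * card W \<le> 4 * card (spanned E W)} \<le> err n"
proof -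
  \<comment> \<open>the series is indexed by \<open>w\<close> and its terms belong to the size \<open>Suc w\<close>\<close>
  define h where "h = (\<lambda>w n. if real (Suc w) \<le> \<epsilon> * real n
    then (9 * real d * (3 * real d * (real (Suc w) / real n)) powr (1/4)) ^ Suc w else 0)"
  have \<epsilon>: "\<epsilon> > 0" using d by (simp add: \<epsilon>_def)
  have bound: "norm (h w n) \<le> (1/2) ^ Suc w" for w n
  proof (cases "real (Suc w) \<le> \<epsilon> * real n")
    case True
    then have n: "real n > 0" by (cases n) auto
    have "3 * real d * (real (Suc w) / real n) \<le> (1 / (18 * real d)) ^ 4"
      using True n d by (simp add: \<epsilon>_def field_simps)
    then have "(3 * real d * (real (Suc w) / real n)) powr (1/4) \<le> ((1 / (18 * real d)) ^ 4) powr (1/4)"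
      by (intro powr_mono2) auto
    also have "\<dots> = 1 / (18 * real d)"
      using d by (subst powr_numeral[symmetric]) (auto simp only: powr_powr, auto)
    finally have "9 * real d * (3 * real d * (real (Suc w) / real n)) powr (1/4)
        \<le> 9 * real d * (1 / (18 * real d))" by (intro mult_left_mono) auto
    also have "\<dots> = 1/2" using d by simp
    finally have "(9 * real d * (3 * real d * (real (Suc w) / real n)) powr (1/4)) ^ Suc w
        \<le> (1/2) ^ Suc w" by (rule power_mono) simp
    then show ?thesis using True by (simp add: h_def abs_mult power_abs)
  qed (simp add: h_def)
  have lim_h: "h w \<longlonglongrightarrow> 0" for w
  proof (rule Lim_null_comparison)
    show "\<forall>\<^sub>F n in sequentially.
        norm (h w n) \<le> (9 * real d * (3 * real d * (real (Suc w) / real n)) powr (1/4)) ^ Suc w"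
      by (auto simp: h_def)
    have c: "real d > 0" "real (Suc w) > 0" using d by auto
    have "(\<lambda>n. 9 * real d * (3 * real d * (real (Suc w) / real n)) powr (1/4)) \<longlonglongrightarrow> 0"
      using c by real_asymp
    then show "(\<lambda>n. (9 * real d * (3 * real d * (real (Suc w) / real n)) powr (1/4)) ^ Suc w)
        \<longlonglongrightarrow> 0" by (rule tendsto_null_power) simp
  qed
  have summ: "summable (\<lambda>w. (1/2 :: real) ^ Suc w)" by (simp add: summable_Suc_iff)
  have "((\<lambda>n. \<Sum>w. h w n) \<longlongrightarrow> (\<Sum>w. 0)) sequentially"
    using tannerys_theorem[OF lim_h always_eventually summ] bound by auto
  then have lim: "(\<lambda>n. \<Sum>w. h w n) \<longlonglongrightarrow> 0" by simp
  have summ_h: "summable (\<lambda>w. h w n)" for n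
    using summ bound by (rule summable_comparison_test'[where N = 0])
  show thesis
  proof (rule that[OF lim])
    have "\<forall>\<^sub>F n in sequentially. real n \<ge> 4 * (real d + 1) ^ 2"
      by real_asymp
    then show "\<forall>\<^sub>F n in sequentially. reg_family n d \<noteq> {} \<longrightarrow>
      measure_pmf.prob (random_edges n d)
        {E. \<exists>W\<subseteq>{..<n}. W \<noteq> {} \<and> real (card W) \<le> \<epsilon> * real n
              \<and> 5 * card W \<le> 4 * card (spanned E W)} \<le> (\<Sum>w. h w n)"
    proof (eventually_elim, intro impI)
      fix n assume n: "real n \<ge> 4 * (real d + 1) ^ 2" and ne: "reg_family n d \<noteq> {}"
      let ?P = "measure_pmf.prob (random_edges n d)"
      define ev where "ev = (\<lambda>w. {E. \<exists>W\<subseteq>{..<n}. card W = w \<and> 5 * w \<le> 4 * card (spanned E W)})"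
      define I where "I = {w. w < n \<and> real (Suc w) \<le> \<epsilon> * real n}"
      have fin: "finite I" by (simp add: I_def)
      have "?P {E. \<exists>W\<subseteq>{..<n}. W \<noteq> {} \<and> real (card W) \<le> \<epsilon> * real n
          \<and> 5 * card W \<le> 4 * card (spanned E W)} \<le> ?P (\<Union>w\<in>I. ev (Suc w))"
      proof (rule measure_pmf.finite_measure_mono, rule subsetI, clarify)
        fix E W assume W: "W \<subseteq> {..<n}" "W \<noteq> {}" "real (card W) \<le> \<epsilon> * real n"
          "5 * card W \<le> 4 * card (spanned E W)"
        have "finite W" "card W \<le> n"
          using W(1) card_mono[of "{..<n}" W] by (auto intro: finite_subset)
        moreover then obtain w where "card W = Suc w"
          using W(2) by (cases "card W") auto
        ultimately show "E \<in> (\<Union>w\<in>I. ev (Suc w))"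
          using W by (auto simp: I_def ev_def intro!: bexI[of _ w])
      qed auto
      also have "\<dots> \<le> (\<Sum>w\<in>I. ?P (ev (Suc w)))" by (rule prob_UN_le[OF fin])
      also have "\<dots> \<le> (\<Sum>w\<in>I. h w n)"
      proof (rule sum_mono)
        fix w assume w: "w \<in> I"
        then show "?P (ev (Suc w)) \<le> h w n"
          using prob_dense_set[OF ne d _ _ n, of "Suc w"] by (simp add: I_def h_def ev_def \<epsilon>_def)
      qed
      also have "\<dots> \<le> (\<Sum>w. h w n)"
        using fin summ_h by (intro sum_le_suminf) (auto simp: h_def)
      finally show "?P {E. \<exists>W\<subseteq>{..<n}. W \<noteq> {} \<and> real (card W) \<le> \<epsilon> * real n
          \<and> 5 * card W \<le> 4 * card (spanned E W)} \<le> (\<Sum>w. h w n)" .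
    qed
  qed
qed

text \<open>There are at most \<open>n\<close> to the power \<open>w\<close> sets of size \<open>w\<close>, and each spans \<open>w\<close>
  edges with probability at most a constant times \<open>n\<close> to the power \<open>-w\<close>.\<close>

lemma expected_cyclic_sets:
  assumes d: "d > 0"
  obtains c where "\<forall>\<^sub>F n in sequentially. reg_family n d \<noteq> {} \<longrightarrow>
    (\<Sum>W | W \<subseteq> {..<n} \<and> card W \<le> w0. measure_pmf.prob (random_edges n d)
       {E. card W \<le> card (spanned E W)}) \<le> c"
proof -
  define c where "c = (\<Sum>w\<le>w0. real ((w choose 2) choose w) * (2 * real d) ^ w)"
  have "\<forall>\<^sub>F n in sequentially. n > 0 \<and> 2 * real w0 + 2 * real d * (real d + 1) \<le> real d * real n / 2"
    using d by (intro eventually_conj; real_asymp)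
  then have "\<forall>\<^sub>F n in sequentially. reg_family n d \<noteq> {} \<longrightarrow>
    (\<Sum>W | W \<subseteq> {..<n} \<and> card W \<le> w0. measure_pmf.prob (random_edges n d)
       {E. card W \<le> card (spanned E W)}) \<le> c"
  proof (eventually_elim, intro impI)
    fix n assume n: "n > 0 \<and> 2 * real w0 + 2 * real d * (real d + 1) \<le> real d * real n / 2"
      and ne: "reg_family n d \<noteq> {}"
    let ?p = "\<lambda>W. measure_pmf.prob (random_edges n d) {E. card W \<le> card (spanned E W)}"
    have fin: "finite {W. W \<subseteq> {..<n} \<and> Q W}" for Q by simp
    have "(\<Sum>W | W \<subseteq> {..<n} \<and> card W \<le> w0. ?p W)
        = (\<Sum>w\<le>w0. \<Sum>W | W \<subseteq> {..<n} \<and> card W = w. ?p W)"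
      by (subst sum.group[OF fin, of "{..w0}" card, symmetric])
        (auto intro!: sum.cong)
    also have "\<dots> \<le> c" unfolding c_def
    proof (rule sum_mono)
      fix w assume w: "w \<in> {..w0}"
      have "(\<Sum>W | W \<subseteq> {..<n} \<and> card W = w. ?p W)
          \<le> (\<Sum>W | W \<subseteq> {..<n} \<and> card W = w. real ((w choose 2) choose w) * (2 * real d / real n) ^ w)"
      proof (rule sum_mono)
        fix W assume "W \<in> {W. W \<subseteq> {..<n} \<and> card W = w}"
        then show "?p W \<le> real ((w choose 2) choose w) * (2 * real d / real n) ^ w"
          using prob_spans_many[OF ne _ d, of W w] n w finite_subset[of W "{..<n}"] by auto
      qed
      also have "\<dots> = real (n choose w) * (real ((w choose 2) choose w) * (2 * real d / real n) ^ w)"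
        using n_subsets[of "{..<n}" w] by simp
      also have "\<dots> \<le> real n ^ w * (real ((w choose 2) choose w) * (2 * real d / real n) ^ w)"
      proof (rule mult_right_mono)
        have "(n choose w) * 1 \<le> (n choose w) * fact w" by (intro mult_left_mono) auto
        also have "\<dots> \<le> n ^ w" by (rule binomial_fact_pow)
        finally show "real (n choose w) \<le> real n ^ w" by (metis mult_1_right of_nat_le_iff of_nat_power)
      qed auto
      also have "\<dots> = real ((w choose 2) choose w) * (2 * real d) ^ w"
        using n by (simp add: power_divide)
      finally show "(\<Sum>W | W \<subseteq> {..<n} \<and> card W = w. ?p W)
          \<le> real ((w choose 2) choose w) * (2 * real d) ^ w" .
    qed
    finally show "(\<Sum>W | W \<subseteq> {..<n} \<and> card W \<le> w0. ?p W) \<le> c" .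
  qed
  then show thesis by (rule that)
qed

section \<open>Cuts of linear size\<close>

definition cut :: "nat \<Rightarrow> nat set set \<Rightarrow> nat set \<Rightarrow> nat" where
  "cut n E U = card (arcs E U ({..<n} - U))"

text \<open>Switching an edge inside \<open>U\<close> with an edge outside \<open>U\<close> turns both into edges of the cut, and
  a reverse switch picks an ordered pair of distinct edges of the cut. The subtracted term counts the
  choices for which one of the new edges is already present.\<close>

lemma cut_switch:
  assumes U: "U \<subseteq> {..<n}"
  shows "((real d * real (card U) - real j) * (real d * (real n - real (card U)) - real j)
        - 2 * real j * real d ^ 2) * real (card {E \<in> reg_family n d. cut n E U = j})
    \<le> (real j + 1) * (real j + 2) * real (card {E \<in> reg_family n d. cut n E U = j + 2})"
    (is "?c * real (card ?P) \<le> ?D * real (card ?Q)")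
proof -
  define C where "C = {..<n} - U"
  define quad :: "(nat \<times> nat) \<times> (nat \<times> nat) \<Rightarrow> nat \<times> nat \<times> nat \<times> nat"
    where "quad = (\<lambda>((u, v), (x, y)). (u, v, x, y))"
  define flip :: "(nat \<times> nat) \<times> (nat \<times> nat) \<Rightarrow> (nat \<times> nat) \<times> (nat \<times> nat)"
    where "flip = (\<lambda>((u, v), (x, y)). ((u, x), (v, y)))"
  define flip' :: "(nat \<times> nat) \<times> (nat \<times> nat) \<Rightarrow> (nat \<times> nat) \<times> (nat \<times> nat)"
    where "flip' = (\<lambda>((v, y), (u, x)). ((u, v), (x, y)))"
  define G where "G = (\<lambda>E. {((u, v), (x, y)). (u, v) \<in> arcs E U U \<and> (x, y) \<in> arcs E C C \<and>
    {u, x} \<notin> E \<and> {v, y} \<notin> E})"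
  define B where "B = (\<lambda>E. Sigma (arcs E U C) (\<lambda>a. arcs E U C - {a}))"
  have finU: "finite U" "finite C" using U finite_subset by (auto simp: C_def)
  have cC: "card C = n - card U" "card U \<le> n"
    using U card_mono[of "{..<n}" U] card_Diff_subset[of U "{..<n}"] finU by (auto simp: C_def)
  have inj: "inj_on quad A" "inj_on flip A" for A by (auto simp: inj_on_def quad_def flip_def)
  show ?thesis
  proof (rule switch_double_count[where V = "{..<n}" and d = d
        and T = "\<lambda>E. quad ` G E" and B = "\<lambda>E. quad ` flip ` B E"])
    show "finite ?P" "finite ?Q" using finite_reg_family by auto
    fix E
    show "regular_edges {..<n} d E" if "E \<in> ?P" using that by (simp add: reg_family_def)
    show "finite (quad ` G E) \<and> ?c \<le> real (card (quad ` G E))" if "E \<in> ?P"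
    proof -
      interpret regular_edges "{..<n}" d E using that by (simp add: reg_family_def)
      define N where "N = (\<lambda>z. {w. {z, w} \<in> E})"
      have N: "finite (N z)" "card (N z) \<le> d" for z using finite_nbr card_nbr_le by (auto simp: N_def)
      have j: "card (arcs E U C) = j" using that by (simp add: cut_def C_def)
      have UU: "card (arcs E U U) + j = d * card U"
        using card_arcs_split[OF U] j by (simp add: C_def)
      have "{..<n} - C = U" using U by (auto simp: C_def)
      then have CC: "card (arcs E C C) + j = d * card C"
        using card_arcs_split[of C] j card_arcs_commute[of E C U] by (auto simp: C_def)
      let ?all = "arcs E U U \<times> arcs E C C"
      \<comment> \<open>\<open>flip\<close> and \<open>flip'\<close> map \<open>X\<close> onto supersets of the choices that fail because
        \<open>{u, x}\<close>, or \<open>{v, y}\<close>, is already an edge\<close>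
      define X where "X = Sigma (arcs E U C) (\<lambda>(u, x). N u \<times> N x)"
      have finX: "finite X" using finU N by (auto simp: X_def intro!: finite_arcs)
      have "card X = (\<Sum>a\<in>arcs E U C. card ((\<lambda>(u, x). N u \<times> N x) a))"
        unfolding X_def using finU N by (intro card_SigmaI) (auto intro!: finite_arcs)
      also have "\<dots> \<le> (\<Sum>a\<in>arcs E U C. d * d)"
      proof (rule sum_mono)
        fix a assume "a \<in> arcs E U C"
        show "card ((\<lambda>(u, x). N u \<times> N x) a) \<le> d * d"
          by (cases a) (simp add: card_cartesian_product mult_mono N)
      qed
      finally have cX: "card X \<le> j * (d * d)" by (simp add: j)
      have cover: "?all \<subseteq> G E \<union> (flip ` X \<union> flip' ` X)"
      proof (rule subsetI, rule ccontr)
        fix q assume q: "q \<in> ?all" and nq: "q \<notin> G E \<union> (flip ` X \<union> flip' ` X)"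
        obtain u v x y where q_eq: "q = ((u, v), (x, y))" by (metis surj_pair)
        have a: "(u, v) \<in> arcs E U U" "(x, y) \<in> arcs E C C" using q unfolding q_eq by blast+
        have nG: "((u, v), (x, y)) \<notin> flip' ` X" and nX: "((u, v), (x, y)) \<notin> flip ` X"
          using nq unfolding q_eq by blast+
        have "{u, x} \<notin> E"
        proof
          assume "{u, x} \<in> E"
          then have "((u, x), (v, y)) \<in> X" using a by (auto simp: X_def N_def)
          then have "flip ((u, x), (v, y)) \<in> flip ` X" by (rule imageI)
          then show False using nX by (simp add: flip_def)
        qed
        moreover have "{v, y} \<notin> E"
        proof
          assume "{v, y} \<in> E"
          then have "((v, y), (u, x)) \<in> X" using a by (auto simp: X_def N_def insert_commute)
          then have "flip' ((v, y), (u, x))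
            \<in> flip' ` X" by (rule imageI)
          then show False using nG by (simp add: flip'_def)
        qed
        ultimately show False using a nq by (auto simp: G_def q_eq)
      qed
      have finall: "finite ?all" using finU by (auto intro!: finite_arcs)
      have "G E \<subseteq> ?all" by (auto simp: G_def)
      then have finG: "finite (G E)" using finall by (rule finite_subset)
      have "card ?all \<le> card (G E \<union> (flip ` X \<union> flip' ` X))"
        using finG finX by (intro card_mono[OF _ cover]) auto
      also have "\<dots> \<le> card (G E) + (card (flip ` X) + card (flip' ` X))"
        by (intro order_trans[OF card_Un_le] add_left_mono order_refl)
      also have "\<dots> \<le> card (G E) + (j * (d * d) + j * (d * d))"
        using card_image_le[OF finX, of flip] card_image_le[OF finX, of flip'] cX by linarith
      finally have "real (card (arcs E U U) * card (arcs E C C)) \<le> real (card (G E) + (j * (d * d) + j * (d * d)))"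
        by (simp only: of_nat_le_iff card_cartesian_product)
      moreover have "real (card (arcs E U U)) = real d * real (card U) - real j"
        using UU by (simp flip: of_nat_mult add: eq_diff_eq of_nat_add[symmetric] del: of_nat_add)
      moreover have "real (card (arcs E C C)) = real d * (real n - real (card U)) - real j"
      proof -
        have "real (card (arcs E C C)) + real j = real d * real (card C)"
          by (simp only: CC of_nat_add[symmetric] of_nat_mult[symmetric])
        then show ?thesis using cC by (simp add: of_nat_diff)
      qed
      ultimately show ?thesis using finG
        by (simp add: card_image[OF inj(1)] power2_eq_square algebra_simps)
    qed
    show "finite (quad ` flip ` B E) \<and> real (card (quad ` flip ` B E)) \<le> ?D" if "E \<in> ?Q"
    proof -
      let ?A = "arcs E U C"
      have fin: "finite ?A" using finU by (intro finite_arcs)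
      have cA: "card ?A = j + 2" using that by (simp add: cut_def C_def)
      have "card (B E) = (\<Sum>a\<in>?A. card (?A - {a}))"
        unfolding B_def using fin by (intro card_SigmaI) auto
      also have "\<dots> = (\<Sum>a\<in>?A. j + 1)" using cA fin by (intro sum.cong) auto
      also have "\<dots> = (j + 2) * (j + 1)" by (simp add: cA)
      finally have "card (quad ` flip ` B E) = (j + 2) * (j + 1)"
        by (simp only: card_image[OF inj(1)] card_image[OF inj(2)])
      moreover have "finite (B E)" unfolding B_def using fin by auto
      ultimately show ?thesis by (simp add: algebra_simps)
    qed
    fix q assume E: "E \<in> ?P" and q: "q \<in> quad ` G E"
    then obtain u v x y where q_eq: "q = (u, v, x, y)"
      and uv: "u \<in> U" "v \<in> U" "{u, v} \<in> E" and xy: "x \<in> C" "y \<in> C" "{x, y} \<in> E"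
      and no: "{u, x} \<notin> E" "{v, y} \<notin> E" by (auto simp: G_def quad_def)
    interpret regular_edges "{..<n}" d E using E by (simp add: reg_family_def)
    have dis: "U \<inter> C = {}" by (auto simp: C_def)
    have sw: "switchable E (u, v, x, y)"
      using uv xy no dis by (auto simp: switchable_def)
    have uv_ne: "u \<noteq> v" using switchable_distinct[OF sw] by simp
    have "(a, b) \<in> arcs (switch E q) U C \<longleftrightarrow> (a, b) \<in> insert (u, x) (insert (v, y) (arcs E U C))" for a b
      using uv(1,2) xy(1,2) dis by (auto simp: q_eq doubleton_eq_iff)
    then have arcs_sw: "arcs (switch E q) U C = insert (u, x) (insert (v, y) (arcs E U C))"
      by (intro set_eqI) (simp only: split_paired_all)
    have "card (arcs (switch E q) U C) = card (arcs E U C) + 2"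
      unfolding arcs_sw using uv_ne no finU by (simp add: finite_arcs)
    then have "cut n (switch E q) U = j + 2" using E by (simp add: cut_def C_def)
    moreover have "switch E q \<in> reg_family n d"
      using regular_switch[OF sw] by (simp add: q_eq reg_family_def)
    moreover have "q \<in> quad ` flip ` B (switch E q)"
    proof -
      have "((u, x), (v, y)) \<in> B (switch E q)" unfolding B_def arcs_sw using uv_ne by auto
      then have "quad (flip ((u, x), (v, y))) \<in> quad ` flip ` B (switch E q)" by (intro imageI)
      then show ?thesis by (simp add: quad_def flip_def q_eq)
    qed
    ultimately show "switchable E q \<and> switch E q \<in> ?Q \<and> q \<in> quad ` flip ` B (switch E q)"
      using sw by (simp add: q_eq)
  qed
qed

lemma cut_parity:
  assumes E: "E \<in> reg_family n d" and U: "U \<subseteq> {..<n}"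
  shows "cut n E U mod 2 = (d * card U) mod 2"
proof -
  interpret regular_edges "{..<n}" d E using E by (simp add: reg_family_def)
  have "finite U" using U finite_subset by blast
  then have "2 * card (spanned E U) + cut n E U = d * card U"
    using card_arcs_split[OF U] card_arcs_self[of U] by (simp add: cut_def)
  then show ?thesis by (metis mod_mult_self4)
qed

text \<open>The subtracted error term is absorbed by lowering one of the two factors by \<open>2q\<close>, where
  \<open>q\<close> is of order \<open>sqrt n\<close>. The cut has the parity \<open>r\<close>, and halving all quantities leaves the ratio
  of consecutive terms \<open>(a choose t) * (b choose t) / (t + 1)\<close>.\<close>

lemma cut_ratio:
  fixes n d q :: nat and U :: "nat set"
  defines "r \<equiv> d * card U mod 2" and "a \<equiv> d * card U div 2 - q"
    and "b \<equiv> d * (n - card U) div 2"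
  assumes U: "U \<subseteq> {..<n}" "2 * card U \<le> n" and even: "even (d * n)"
    and q: "d ^ 3 * card U \<le> 2 * q ^ 2"
  shows "real (card {E \<in> reg_family n d. cut n E U = 2 * t + r}) * (real (a - t) * real (b - t))
    \<le> real (card {E \<in> reg_family n d. cut n E U = 2 * Suc t + r}) * ((real t + 1) * (real t + 2))"
proof (cases "t < a")
  case True
  let ?N = "\<lambda>t. real (card {E \<in> reg_family n d. cut n E U = 2 * t + r})"
  define k where "k = card U"
  define A where "A = d * k div 2"
  have kn: "k \<le> n" using U(2) by (simp add: k_def)
  have dk: "d * k = 2 * A + r" by (simp add: A_def r_def k_def)
  have "d * (n - k) mod 2 = r"
  proof -
    have "d * n = d * k + d * (n - k)" using kn by (metis add_mult_distrib2 le_add_diff_inverse)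
    then show ?thesis using even unfolding r_def k_def[symmetric]
      by (metis even_add mod2_eq_if)
  qed
  then have dnk: "d * (n - k) = 2 * b + r"
    unfolding b_def k_def[symmetric] by (metis mult_div_mod_eq)
  have AB: "A \<le> b"
    unfolding A_def b_def k_def[symmetric] using U(2) by (intro div_le_mono mult_left_mono) (auto simp: k_def)
  have tA: "t + q < A" using True by (simp add: a_def A_def k_def)
  have tb: "t < b" using tA AB by simp
  have rdk: "real d * real k = 2 * real A + real r"
    using dk by (metis of_nat_add of_nat_mult of_nat_numeral)
  have rdnk: "real d * (real n - real k) = 2 * real b + real r"
    using dnk kn by (metis of_nat_add of_nat_diff of_nat_mult of_nat_numeral)
  have r1: "r \<le> 1" by (simp add: r_def)
  have "(2 * (real A - real t)) * (2 * (real b - real t)) - 2 * real (2 * t + r) * real d ^ 2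
      \<ge> 4 * (real (a - t) * real (b - t))"
  proof -
    have "real q \<le> real b - real t" using tA AB by linarith
    then have 1: "real q * real q \<le> real q * (real b - real t)" by (intro mult_left_mono) auto
    have "real (2 * t + r) * real d ^ 2 \<le> real (d * k) * real d ^ 2"
      using tA by (intro mult_right_mono) (auto simp: dk)
    also have "\<dots> = real (d ^ 3 * k)" by (simp add: power2_eq_square power3_eq_cube)
    also have "\<dots> \<le> real (2 * q ^ 2)" using q unfolding k_def[symmetric] by (simp only: of_nat_le_iff)
    finally have 2: "real (2 * t + r) * real d ^ 2 \<le> 2 * (real q * real q)"
      by (simp add: power2_eq_square)
    have 3: "real (a - t) = real A - real t - real q" "real (b - t) = real b - real t"
      using tA tb by (auto simp: a_def A_def k_def)
    show ?thesis unfolding 3 using 1 2 by (simp add: algebra_simps)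
  qed
  then have "?N t * (4 * (real (a - t) * real (b - t)))
      \<le> ?N t * ((2 * (real A - real t)) * (2 * (real b - real t)) - 2 * real (2 * t + r) * real d ^ 2)"
    by (intro mult_left_mono) auto
  also have "\<dots> \<le> (real (2 * t + r) + 1) * (real (2 * t + r) + 2) * ?N (Suc t)"
  proof -
    have "real d * real k - real (2 * t + r) = 2 * (real A - real t)"
      "real d * (real n - real k) - real (2 * t + r) = 2 * (real b - real t)"
      "2 * t + r + 2 = 2 * Suc t + r" by (simp_all add: rdk rdnk)
    then show ?thesis
      using cut_switch[OF U(1), of d "2 * t + r"] unfolding k_def[symmetric]
      by (simp only: mult.commute)
  qed
  also have "\<dots> \<le> (4 * ((real t + 1) * (real t + 2))) * ?N (Suc t)"
  proof (rule mult_right_mono)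
    have "(real (2 * t + r) + 1) * (real (2 * t + r) + 2) \<le> (2 * real t + 2) * (2 * real t + 3)"
      using r1 by (intro mult_mono) auto
    also have "\<dots> \<le> 4 * ((real t + 1) * (real t + 2))" by (simp add: algebra_simps)
    finally show "(real (2 * t + r) + 1) * (real (2 * t + r) + 2) \<le> 4 * ((real t + 1) * (real t + 2))" .
  qed auto
  finally show ?thesis by (simp add: mult.commute)
qed simp

lemma binomial_Suc_ratio: "real (a choose Suc s) * real (Suc s) = real (a choose s) * real (a - s)"
  by (metis binomial_absorb_comp binomial_absorption mult.commute of_nat_mult)

text \<open>The sequence \<open>N t * (t + 1) / ((a choose t) * (b choose t))\<close> is nondecreasing, so a small
  \<open>t\<close> can be compared with the \<open>s\<close> at which the denominator is largest; by Vandermonde's identity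
  that denominator is at least the average of \<open>(a + b) choose a\<close> over \<open>a + 1\<close> terms.\<close>

lemma binomial_ratio_bound:
  fixes N :: "nat \<Rightarrow> real" and a b :: nat and R D :: real
  assumes step: "\<And>t. N t * (real (a - t) * real (b - t)) \<le> N (Suc t) * ((real t + 1) * (real t + 2))"
    and N: "\<And>t. 0 \<le> N t" "\<And>t. N t \<le> R"
    and D: "\<And>t. t \<le> T \<Longrightarrow> real (a choose t) * real (b choose t) \<le> D"
    and t: "t \<le> T"
  shows "N t * real ((a + b) choose a) \<le> R * D * (real a + 1) ^ 2"
proof -
  define c where "c = (\<lambda>s. real (a choose s) * real (b choose s))"
  have c0: "c s \<ge> 0" for s by (simp add: c_def)
  have R: "R \<ge> 0" using N[of 0] by linarith
  have D0: "D \<ge> 0" using D[OF t] by (smt (verit) mult_nonneg_nonneg of_nat_0_le_iff)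
  have mono: "N t * c s * (real t + 1) \<le> N s * c t * (real s + 1)" if "t \<le> s" for s
    using that
  proof (induction s rule: dec_induct)
    case (step s)
    have c_Suc: "c (Suc s) * (real s + 1) ^ 2 = c s * (real (a - s) * real (b - s))"
    proof -
      have "c (Suc s) * (real s + 1) ^ 2
          = (real (a choose Suc s) * real (Suc s)) * (real (b choose Suc s) * real (Suc s))"
        by (simp add: c_def power2_eq_square add.commute)
      also have "\<dots> = c s * (real (a - s) * real (b - s))"
        by (simp only: binomial_Suc_ratio) (simp add: c_def)
      finally show ?thesis .
    qed
    have "(N t * c (Suc s) * (real t + 1)) * (real s + 1) ^ 2
        = (N t * c s * (real t + 1)) * (real (a - s) * real (b - s))"
      using c_Suc by (metis (no_types, lifting) mult.assoc mult.commute)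
    also have "\<dots> \<le> (N s * c t * (real s + 1)) * (real (a - s) * real (b - s))"
      by (intro mult_right_mono step.IH) auto
    also have "\<dots> = (c t * (real s + 1)) * (N s * (real (a - s) * real (b - s)))" by simp
    also have "\<dots> \<le> (c t * (real s + 1)) * (N (Suc s) * ((real s + 1) * (real s + 2)))"
      by (intro mult_left_mono assms(1)) (simp add: c0)
    also have "\<dots> = (N (Suc s) * c t * (real (Suc s) + 1)) * (real s + 1) ^ 2"
      by (simp add: power2_eq_square)
    finally show ?case by (rule mult_right_le_imp_le) simp
  qed simp
  have "\<exists>s\<le>a. real ((a + b) choose a) \<le> c s * (real a + 1)"
  proof (rule ccontr)
    assume "\<not> ?thesis"
    then have less: "c s * (real a + 1) < real ((a + b) choose a)" if "s \<le> a" for s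
      using that by force
    have "real ((a + b) choose a) = (\<Sum>i\<le>a. real (a choose i) * real (b choose (a - i)))"
      unfolding vandermonde[of a b a, symmetric] by simp
    also have "\<dots> = (\<Sum>i\<le>a. c (a - i))"
    proof (rule sum.cong[OF refl])
      fix i assume "i \<in> {..a}"
      then have "a choose i = a choose (a - i)" by (intro binomial_symmetric) simp
      then show "real (a choose i) * real (b choose (a - i)) = c (a - i)" by (simp only: c_def)
    qed
    finally have "real ((a + b) choose a) * (real a + 1) = (\<Sum>i\<le>a. c (a - i) * (real a + 1))"
      by (simp add: sum_distrib_right)
    also have "\<dots> < (\<Sum>i\<le>a. real ((a + b) choose a))"
      by (rule sum_strict_mono) (use less in auto)
    finally show False by (simp add: algebra_simps)
  qed
  then obtain s where s: "s \<le> a" "real ((a + b) choose a) \<le> c s * (real a + 1)" by blast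
  have "N t * c s \<le> R * D * (real a + 1)"
  proof (cases "t \<le> s")
    case True
    have "N t * c s * 1 \<le> N t * c s * (real t + 1)" using N c0 by (intro mult_left_mono) auto
    also have "\<dots> \<le> N s * c t * (real s + 1)" by (rule mono[OF True])
    also have "\<dots> \<le> R * D * (real a + 1)"
      using N c0 D[OF t] D0 R s by (intro mult_mono) (auto simp: c_def)
    finally show ?thesis by simp
  next
    case False
    then have "N t * c s \<le> R * D" using N c0 D[of s] t R by (intro mult_mono) (auto simp: c_def)
    also have "\<dots> * 1 \<le> R * D * (real a + 1)" using R D0 by (intro mult_left_mono) auto
    finally show ?thesis by simp
  qed
  then have "N t * c s * (real a + 1) \<le> R * D * (real a + 1) * (real a + 1)"
    by (intro mult_right_mono) auto
  moreover have "N t * real ((a + b) choose a) \<le> N t * (c s * (real a + 1))"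
    using s N by (intro mult_left_mono) auto
  ultimately show ?thesis unfolding power2_eq_square mult.assoc by linarith
qed

text \<open>With \<open>a\<close> and \<open>b\<close> close to \<open>d * k / 2\<close> and \<open>d * (n - k) / 2\<close>, this is where degree at least
  \<open>3\<close> enters: there are more edges than vertices, so the number of ways to split the edges beats the
  number of ways to split the vertices. By Vandermonde's identity, splitting \<open>n\<close> of the \<open>a + b\<close>
  objects into \<open>k\<close> and \<open>n - k\<close> leaves a factor that is exponential in \<open>a - k\<close>.\<close>

lemma binomial_split:
  assumes "k \<le> a" "k \<le> n" "n - k + (a - k) \<le> b"
  shows "real (n choose k) * 2 ^ (a - k) \<le> real ((a + b) choose a)"
proof -
  define l m where "l = a - k" and "m = b - (n - k)"
  have lm: "l \<le> m" "a + b = n + (l + m)" "a - k = l" using assms by (auto simp: l_def m_def)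
  have "(2 :: real) ^ l \<le> real ((l + m) choose l)"
  proof (cases "l = 0")
    case False
    then have "(2 :: real) ^ l \<le> (real (l + m) / real l) ^ l"
      using lm by (intro power_mono) (auto simp: field_simps)
    also have "\<dots> \<le> real ((l + m) choose l)" by (rule binomial_ge_n_over_k_pow_k) simp
    finally show ?thesis .
  qed simp
  then have "real (n choose k) * 2 ^ (a - k) \<le> real (n choose k) * real ((l + m) choose (a - k))"
    unfolding lm by (intro mult_left_mono) auto
  also have "\<dots> \<le> real (\<Sum>i\<le>a. (n choose i) * ((l + m) choose (a - i)))"
    unfolding of_nat_mult[symmetric] of_nat_le_iff using assms
    by (intro member_le_sum[where f = "\<lambda>i. (n choose i) * ((l + m) choose (a - i))"]) auto
  also have "\<dots> = real ((a + b) choose a)" by (simp add: vandermonde lm)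
  finally show ?thesis .
qed

text \<open>If \<open>T\<close> is at most a small fraction of \<open>M\<close>, a suitable small \<open>z\<close> makes the right-hand side
  exponential in \<open>M\<close> with an arbitrarily small rate.\<close>

lemma binomial_le_exp:
  fixes z :: real
  assumes z: "0 < z" "z \<le> 1" and "t \<le> T" "a \<le> M"
  shows "real (a choose t) \<le> (1 + z) ^ M / z ^ T"
proof -
  have "real (a choose t) * z ^ T \<le> real (a choose t) * z ^ t"
    using assms by (intro mult_left_mono power_decreasing) auto
  also have "\<dots> \<le> (1 + z) ^ a"
  proof (cases "t \<le> a")
    case True
    have "real (a choose t) * z ^ t \<le> (\<Sum>i\<le>a. real (a choose i) * z ^ i)"
      using True z by (intro member_le_sum[where f = "\<lambda>i. real (a choose i) * z ^ i"]) auto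
    also have "\<dots> = (1 + z) ^ a" using binomial_ring[of z 1 a] by (simp add: add.commute)
    finally show ?thesis .
  qed (use z in \<open>simp add: binomial_eq_0\<close>)
  also have "\<dots> \<le> (1 + z) ^ M" using assms by (intro power_increasing) auto
  finally show ?thesis using z by (simp add: field_simps)
qed

lemma prob_small_cut:
  fixes z :: real
  assumes ne: "reg_family n d \<noteq> {}" and d: "d \<ge> 3" and U: "U \<subseteq> {..<n}" "2 * card U \<le> n"
    and even: "even (d * n)" and q: "d ^ 3 * card U \<le> 2 * q ^ 2" "2 * q + 1 \<le> card U"
    and z: "0 < z" "z \<le> 1"
  shows "measure_pmf.prob (random_edges n d) {E. cut n E U \<le> T}
    \<le> (real T + 1) * (((1 + z) ^ (d * n) / z ^ T) ^ 2 * (real d * real n + 1) ^ 2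
        / (2 ^ (d * card U div 2 - q - card U) * real (n choose card U)))"
proof -
  let ?P = "measure_pmf.prob (random_edges n d)"
  define k r a b where "k = card U" and "r = d * k mod 2" and "a = d * k div 2 - q"
    and "b = d * (n - k) div 2"
  define D where "D = ((1 + z) ^ (d * n) / z ^ T) ^ 2"
  define N where "N = (\<lambda>t. real (card {E \<in> reg_family n d. cut n E U = 2 * t + r}))"
  define R where "R = real (card (reg_family n d))"
  have kn: "k \<le> n" "2 * k \<le> n" using U(2) by (auto simp: k_def)
  have R: "R > 0" using ne finite_reg_family by (simp add: R_def card_gt_0_iff)
  have d3: "3 * k \<le> d * k" "3 * (n - k) \<le> d * (n - k)" using d by auto
  have ka: "k \<le> a"
  proof -
    have "3 * k div 2 \<le> d * k div 2" using d3(1) by (rule div_le_mono)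
    moreover have "k + q \<le> 3 * k div 2" using q(2) by (simp add: k_def)
    ultimately show ?thesis by (simp add: a_def)
  qed
  have ba: "n - k + (a - k) \<le> b"
  proof -
    define m where "m = n - k"
    have "d * k + 2 * m \<le> d * m + 2 * k"
    proof -
      obtain d' where d': "d = d' + 2" using d by (metis add.commute le_Suc_ex numeral_3_eq_3 add_2_eq_Suc' le_add_diff_inverse2 Suc_leD eval_nat_numeral(3))
      have "d' * k \<le> d' * m" using kn by (intro mult_left_mono) (auto simp: m_def)
      then show ?thesis by (simp add: d' algebra_simps)
    qed
    then have "d * k div 2 + m \<le> d * m div 2 + k" by linarith
    then show ?thesis using ka unfolding a_def b_def m_def by linarith
  qed
  have le_dn: "a \<le> d * n" "b \<le> d * n"
  proof -
    have "d * k \<le> d * n" "d * (n - k) \<le> d * n" using kn by auto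
    then show "a \<le> d * n" "b \<le> d * n" unfolding a_def b_def by linarith+
  qed
  have D: "real (a choose t) * real (b choose t) \<le> D" if "t \<le> T" for t
    unfolding D_def power2_eq_square using z that le_dn
    by (intro mult_mono binomial_le_exp) auto
  have D0: "D \<ge> 0" by (simp add: D_def)
  have Nt: "N t / R \<le> D * (real d * real n + 1) ^ 2 / (2 ^ (a - k) * real (n choose k))"
    if t: "t \<le> T" for t
  proof -
    have "N t * real ((a + b) choose a) \<le> R * D * (real a + 1) ^ 2"
    proof (rule binomial_ratio_bound[OF _ _ _ D t])
      show "N t * (real (a - t) * real (b - t)) \<le> N (Suc t) * ((real t + 1) * (real t + 2))" for t
        unfolding N_def r_def a_def b_def k_def by (rule cut_ratio[OF U even q(1)])
      show "N t \<le> R" for t unfolding N_def R_def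
        by (intro of_nat_mono card_mono finite_reg_family) auto
    qed (auto simp: N_def)
    moreover have "N t * (real (n choose k) * 2 ^ (a - k)) \<le> N t * real ((a + b) choose a)"
      by (intro mult_left_mono binomial_split ka kn ba) (simp add: N_def)
    moreover have "R * D * (real a + 1) ^ 2 \<le> R * D * (real d * real n + 1) ^ 2"
      using R D0 le_dn(1) by (intro mult_left_mono power_mono) (auto simp flip: of_nat_mult)
    ultimately have "N t * (real (n choose k) * 2 ^ (a - k)) \<le> R * D * (real d * real n + 1) ^ 2"
      by linarith
    then show ?thesis using R kn by (simp add: field_simps)
  qed
  have "?P {E. cut n E U \<le> T} = real (card {E \<in> reg_family n d. cut n E U \<le> T}) / R"
    by (simp add: prob_random_edges[OF ne] R_def)
  also have "\<dots> \<le> (\<Sum>t\<le>T. N t) / R"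
  proof (rule divide_right_mono)
    have "{E \<in> reg_family n d. cut n E U \<le> T}
        \<subseteq> (\<Union>t\<le>T. {E \<in> reg_family n d. cut n E U = 2 * t + r})"
    proof clarify
      fix E assume E: "E \<in> reg_family n d" "cut n E U \<le> T"
      have "cut n E U = 2 * (cut n E U div 2) + r"
        unfolding r_def k_def cut_parity[OF E(1) U(1), symmetric] by simp
      then show "E \<in> (\<Union>t\<le>T. {E \<in> reg_family n d. cut n E U = 2 * t + r})"
        using E by (intro UN_I[of "cut n E U div 2"]) auto
    qed
    then have "card {E \<in> reg_family n d. cut n E U \<le> T}
        \<le> card (\<Union>t\<le>T. {E \<in> reg_family n d. cut n E U = 2 * t + r})"
      using finite_reg_family by (intro card_mono) auto
    also have "\<dots> \<le> (\<Sum>t\<le>T. card {E \<in> reg_family n d. cut n E U = 2 * t + r})"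
      by (rule card_UN_le) simp
    finally show "real (card {E \<in> reg_family n d. cut n E U \<le> T}) \<le> (\<Sum>t\<le>T. N t)"
      unfolding N_def by (simp flip: of_nat_sum)
  qed (use R in simp)
  also have "\<dots> = (\<Sum>t\<le>T. N t / R)" by (simp add: sum_divide_distrib)
  also have "\<dots> \<le> (\<Sum>t\<le>T. D * (real d * real n + 1) ^ 2 / (2 ^ (a - k) * real (n choose k)))"
    by (intro sum_mono Nt) auto
  finally show ?thesis by (simp add: D_def a_def k_def algebra_simps)
qed

text \<open>The number \<open>n choose k\<close> of sets of size \<open>k\<close> cancels against the denominator in the bound
  for a single set. What remains is an exponential gain with rate proportional to \<open>\<epsilon>\<close> against
  polynomial factors, a factor exponential in \<open>sqrt n\<close>, and the bound for the binomial coefficients,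
  whose rate is made smaller than the gain by the choice of \<open>z\<close> and \<open>\<tau>\<close>.\<close>

lemma prob_small_cut_tendsto:
  fixes \<epsilon> :: real
  assumes d: "d \<ge> 3" and \<epsilon>: "0 < \<epsilon>" "\<epsilon> \<le> 1"
  obtains \<tau> :: real and err :: "nat \<Rightarrow> real" where "\<tau> > 0" "err \<longlonglongrightarrow> 0"
    and "\<forall>\<^sub>F n in sequentially. even (d * n) \<longrightarrow> reg_family n d \<noteq> {} \<longrightarrow>
      measure_pmf.prob (random_edges n d)
        {E. \<exists>U\<subseteq>{..<n}. \<epsilon> * real n \<le> real (card U) \<and> 2 * card U \<le> n
              \<and> real (cut n E U) \<le> \<tau> * real n} \<le> err n"
proof -
  \<comment> \<open>\<open>z\<close> and \<open>\<tau>\<close> are such that \<open>(1 + z) ^ (d * n)\<close> and \<open>1 / z ^ (\<tau> * n)\<close> are each at most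
    \<open>exp (\<epsilon> * n / 32)\<close>\<close>
  define z where "z = \<epsilon> / (32 * real d)"
  have z: "0 < z" "z \<le> 1" "z \<noteq> 1" using d \<epsilon> by (auto simp: z_def field_simps)
  define \<tau> where "\<tau> = \<epsilon> / (32 * ln (1 / z))"
  have lnz: "ln (1 / z) > 0" using z by (intro ln_gt_zero) auto
  have \<tau>: "\<tau> > 0" using \<epsilon> lnz by (simp add: \<tau>_def)
  define err where "err = (\<lambda>n::nat. (real n + 1) * ((\<tau> * real n + 1) * (exp (\<epsilon> * real n / 8)
    * (real d * real n + 1) ^ 2 / (exp (\<epsilon> * real n / 4) / (2 * exp (sqrt (real d ^ 3 * real n) + 1))))))"
  have c: "real d > 0" "real d ^ 3 > 0" using d by auto
  have lim: "err \<longlonglongrightarrow> 0" unfolding err_def using c \<epsilon> \<tau> by real_asymp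
  have ev: "\<forall>\<^sub>F n in sequentially. 2 * (sqrt (real d ^ 3 * real n) + 1) + 1 \<le> \<epsilon> * real n"
    using c \<epsilon> by real_asymp
  show thesis
  proof (rule that[OF \<tau> lim])
    show "\<forall>\<^sub>F n in sequentially. even (d * n) \<longrightarrow> reg_family n d \<noteq> {} \<longrightarrow>
      measure_pmf.prob (random_edges n d)
        {E. \<exists>U\<subseteq>{..<n}. \<epsilon> * real n \<le> real (card U) \<and> 2 * card U \<le> n
              \<and> real (cut n E U) \<le> \<tau> * real n} \<le> err n"
      using ev
    proof (eventually_elim, intro impI)
      fix n assume n: "2 * (sqrt (real d ^ 3 * real n) + 1) + 1 \<le> \<epsilon> * real n"
        and even: "even (d * n)" and ne: "reg_family n d \<noteq> {}"
      let ?P = "measure_pmf.prob (random_edges n d)"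
      define q where "q = nat \<lceil>sqrt (real d ^ 3 * real n)\<rceil>"
      define T where "T = nat \<lfloor>\<tau> * real n\<rfloor>"
      define L where "L = exp (\<epsilon> * real n / 4) / (2 * exp (sqrt (real d ^ 3 * real n) + 1))"
      have q: "sqrt (real d ^ 3 * real n) \<le> real q" "real q \<le> sqrt (real d ^ 3 * real n) + 1"
        by (auto simp: q_def)
      have T: "real T \<le> \<tau> * real n" using \<tau> by (auto simp: T_def)
      have q2: "d ^ 3 * k \<le> 2 * q ^ 2" if "k \<le> n" for k
      proof -
        have "real d ^ 3 * real n = sqrt (real d ^ 3 * real n) ^ 2" by simp
        also have "\<dots> \<le> real q ^ 2" using q by (intro power_mono) auto
        finally have "real (d ^ 3 * n) \<le> real (q ^ 2)" by simp
        then have "d ^ 3 * n \<le> q ^ 2" by (simp only: of_nat_le_iff)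
        moreover have "d ^ 3 * k \<le> d ^ 3 * n" using that by simp
        ultimately show ?thesis by linarith
      qed
      have D: "((1 + z) ^ (d * n) / z ^ T) ^ 2 \<le> exp (\<epsilon> * real n / 8)"
      proof -
        have "(1 + z) ^ (d * n) \<le> exp z ^ (d * n)"
          using z exp_ge_add_one_self[of z] by (intro power_mono) auto
        also have "\<dots> = exp (\<epsilon> * real n / 32)"
          using d by (simp add: z_def exp_of_nat_mult[symmetric])
        finally have 1: "(1 + z) ^ (d * n) \<le> exp (\<epsilon> * real n / 32)" .
        have "1 / z ^ T = exp (real T * ln (1 / z))"
          using z by (simp add: exp_of_nat_mult power_one_over)
        also have "\<dots> \<le> exp (\<tau> * real n * ln (1 / z))"
          using T lnz by (simp add: mult_right_mono del: ln_div)
        also have "\<dots> = exp (\<epsilon> * real n / 32)" unfolding \<tau>_def using lnz by simp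
        finally have 2: "1 / z ^ T \<le> exp (\<epsilon> * real n / 32)" .
        have "(1 + z) ^ (d * n) * (1 / z ^ T) \<le> exp (\<epsilon> * real n / 32) * exp (\<epsilon> * real n / 32)"
          using 1 2 z by (intro mult_mono) auto
        then have "((1 + z) ^ (d * n) / z ^ T) ^ 2 \<le> (exp (\<epsilon> * real n / 32) * exp (\<epsilon> * real n / 32)) ^ 2"
          using z by (intro power_mono) auto
        also have "\<dots> = exp (\<epsilon> * real n / 8)"
          by (simp add: power2_eq_square exp_add[symmetric])
        finally show ?thesis .
      qed
      have L0: "L > 0" by (simp add: L_def)
      have Lk: "L \<le> 2 ^ (d * k div 2 - q - k)" if k: "\<epsilon> * real n \<le> real k" for k
      proof -
        define e where "e = d * k div 2 - q - k"
        have "3 * k \<le> d * k" using d by simp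
        then have "3 * k div 2 \<le> d * k div 2" by (rule div_le_mono)
        then have e: "\<epsilon> * real n / 2 - 1 - real q \<le> real e"
          unfolding e_def using k by linarith
        have "exp (\<epsilon> * real n / 4) = exp (\<epsilon> * real n / 2 * (1/2))" by simp
        also have "\<dots> \<le> exp (\<epsilon> * real n / 2 * ln 2)"
          using ln2_ge_two_thirds \<epsilon> by (simp add: mult_left_mono del: times_divide_eq_right)
        also have "\<dots> \<le> exp ((real e + 1 + real q) * ln 2)"
          using e by simp
        also have "\<dots> = 2 ^ e * 2 * 2 ^ q"
          by (simp add: distrib_right exp_add exp_of_nat_mult)
        also have "(2::real) ^ q \<le> exp 1 ^ q"
          using exp_ge_add_one_self[of 1] by (intro power_mono) auto
        also have "exp 1 ^ q = exp (real q)" by (simp add: exp_of_nat_mult[symmetric])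
        also have "\<dots> \<le> exp (sqrt (real d ^ 3 * real n) + 1)" using q by simp
        finally show ?thesis unfolding L_def e_def by (simp add: field_simps)
      qed
      define I where "I = {U. U \<subseteq> {..<n} \<and> \<epsilon> * real n \<le> real (card U) \<and> 2 * card U \<le> n}"
      define X where "X = (\<tau> * real n + 1) * (exp (\<epsilon> * real n / 8) * (real d * real n + 1) ^ 2 / L)"
      have X0: "X \<ge> 0" using \<tau> L0 by (auto simp: X_def)
      have fin: "finite I" by (simp add: I_def)
      have "?P {E. \<exists>U\<subseteq>{..<n}. \<epsilon> * real n \<le> real (card U) \<and> 2 * card U \<le> n \<and> real (cut n E U) \<le> \<tau> * real n}
          \<le> ?P (\<Union>U\<in>I. {E. cut n E U \<le> T})"
        by (intro measure_pmf.finite_measure_mono) (auto simp: I_def T_def le_nat_floor)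
      also have "\<dots> \<le> (\<Sum>U\<in>I. ?P {E. cut n E U \<le> T})" by (rule prob_UN_le[OF fin])
      also have "\<dots> \<le> (\<Sum>U\<in>I. X / real (n choose card U))"
      proof (rule sum_mono)
        fix U assume U: "U \<in> I"
        then have kn: "card U \<le> n" "real (n choose card U) > 0" by (auto simp: I_def)
        have k: "\<epsilon> * real n \<le> real (card U)" using U by (simp add: I_def)
        have "2 * real q \<le> 2 * (sqrt (real d ^ 3 * real n) + 1)" using q(2) by (rule mult_left_mono) simp
        then have "2 * real q + 1 \<le> 2 * (sqrt (real d ^ 3 * real n) + 1) + 1" by (rule add_right_mono)
        also note n
        also note k
        finally have qk: "2 * q + 1 \<le> card U" by simp
        have "?P {E. cut n E U \<le> T} \<le> (real T + 1) * (((1 + z) ^ (d * n) / z ^ T) ^ 2 * (real d * real n + 1) ^ 2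
        / (2 ^ (d * card U div 2 - q - card U) * real (n choose card U)))"
          using U by (intro prob_small_cut ne d even q2 qk z kn) (auto simp: I_def)
        also have "\<dots> \<le> (\<tau> * real n + 1) * (exp (\<epsilon> * real n / 8) * (real d * real n + 1) ^ 2 / (L * real (n choose card U)))"
          using T D Lk[OF k] L0 kn \<tau> by (intro mult_mono frac_le) auto
        finally show "?P {E. cut n E U \<le> T} \<le> X / real (n choose card U)" by (simp add: X_def)
      qed
      also have "\<dots> \<le> (\<Sum>U\<in>Pow {..<n}. X / real (n choose card U))"
        using X0 by (intro sum_mono2) (auto simp: I_def)
      also have "\<dots> = (\<Sum>k\<le>n. \<Sum>U | U \<in> Pow {..<n} \<and> card U = k. X / real (n choose card U))"
        by (rule sum.group[symmetric]) (auto intro: order_trans[OF card_mono[of "{..<n}"]])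
      also have "\<dots> = (\<Sum>k\<le>n. X)"
      proof (rule sum.cong[OF refl])
        fix k assume "k \<in> {..n}"
        then have "(n choose k) > 0" by simp
        then show "(\<Sum>U | U \<in> Pow {..<n} \<and> card U = k. X / real (n choose card U)) = X"
          using n_subsets[of "{..<n}" k] by simp
      qed
      also have "\<dots> = err n" by (simp add: err_def X_def L_def algebra_simps)
      finally show "?P {E. \<exists>U\<subseteq>{..<n}. \<epsilon> * real n \<le> real (card U) \<and> 2 * card U \<le> n
              \<and> real (cut n E U) \<le> \<tau> * real n} \<le> err n" .
    qed
  qed
qed

section \<open>Regular graphs exist\<close>

text \<open>A circulant graph: join \<open>u\<close> and \<open>v\<close> when their difference modulo \<open>n\<close> lies in a symmetric
  set of \<open>d\<close> nonzero residues.\<close>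

lemma reg_family_nonempty:
  assumes even: "even (d * n)" and n: "n > d + 1"
  shows "reg_family n d \<noteq> {}"
proof -
  define h where "h = d div 2"
  define S where "S = {x \<in> {..<n}. (1 \<le> x \<and> x \<le> h) \<or> (n - h \<le> x \<and> x < n) \<or> (odd d \<and> 2 * x = n)}"
  have S_sym: "n - x \<in> S" if "x \<in> S" for x using that n unfolding S_def h_def by auto
  have S_pos: "0 < x \<and> x < n" if "x \<in> S" for x using that n unfolding S_def h_def by auto
  have card_S: "card S = d"
  proof (cases "even d")
    case True
    then have d: "d = 2 * h" by (simp add: h_def)
    have "S = {1..h} \<union> {n - h..<n}" unfolding S_def using n d by auto
    moreover have "{1..h} \<inter> {n - h..<n} = {}" using n d by auto
    ultimately show ?thesis using n d by (simp add: card_Un_disjoint)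
  next
    case False
    then have d: "d = 2 * h + 1" by (simp add: h_def)
    have "even n" using even False by simp
    then obtain m where m: "n = 2 * m" by (elim evenE)
    have "S = insert m ({1..h} \<union> {n - h..<n})" unfolding S_def using n d False m by auto
    moreover have "{1..h} \<inter> {n - h..<n} = {}" "m \<notin> {1..h} \<union> {n - h..<n}" using n d m by auto
    ultimately show ?thesis using n d by (simp add: card_Un_disjoint)
  qed
  define dif where "dif = (\<lambda>u v. (v + n - u) mod n)"
  have dif: "dif u v = (if u \<le> v then v - u else v + n - u)" if "u < n" "v < n" for u v
    using that by (auto simp: dif_def mod_if)
  define E where "E = {{u, v} | u v. u < n \<and> v < n \<and> dif u v \<in> S}"
  have dif_sym: "dif v u \<in> S" if "u < n" "v < n" "dif u v \<in> S" for u v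
  proof -
    have "dif v u = n - dif u v" using S_pos[OF that(3)] that(1,2) by (auto simp: dif split: if_splits)
    then show ?thesis using S_sym that(3) by simp
  qed
  have E_iff: "{u, v} \<in> E \<longleftrightarrow> u < n \<and> v < n \<and> dif u v \<in> S" for u v
    unfolding E_def using dif_sym by (auto simp: doubleton_eq_iff)
  have "regular_edges {..<n} d E"
  proof
    fix e assume "e \<in> E"
    then obtain u v where e: "e = {u, v}" "u < n" "v < n" "dif u v \<in> S" by (auto simp: E_def)
    then have "u \<noteq> v" using S_pos[of "dif u u"] by (auto simp: dif)
    then show "e \<subseteq> {..<n} \<and> card e = 2" using e by simp
  next
    fix u assume u: "u \<in> {..<n}"
    have "bij_betw (dif u) {v. v < n \<and> dif u v \<in> S} S"
    proof (rule bij_betwI[where g = "\<lambda>x. (u + x) mod n"])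
      show "(\<lambda>x. (u + x) mod n) \<in> S \<rightarrow> {v. v < n \<and> dif u v \<in> S}"
      proof
        fix x assume x: "x \<in> S"
        have "dif u ((u + x) mod n) = x"
          using S_pos[OF x] u n by (auto simp: dif mod_if)
        then show "(u + x) mod n \<in> {v. v < n \<and> dif u v \<in> S}" using x n by simp
      qed
      show "dif u ((u + x) mod n) = x" if "x \<in> S" for x
        using S_pos[OF that] u n by (auto simp: dif mod_if)
      show "(u + dif u v) mod n = v" if "v \<in> {v. v < n \<and> dif u v \<in> S}" for v
        using that u by (auto simp: dif mod_if)
    qed auto
    then have "card {v. v < n \<and> dif u v \<in> S} = d" using card_S bij_betw_same_card by metis
    then show "card {w. {u, w} \<in> E} = d" using u by (simp add: E_iff)
  qed simp
  then show ?thesis by (auto simp: reg_family_def)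
qed

section \<open>Typical properties of a random regular graph\<close>

definition expanding :: "nat \<Rightarrow> real \<Rightarrow> nat set set \<Rightarrow> bool" where
  "expanding n \<gamma> E \<longleftrightarrow> (\<forall>U\<subseteq>{..<n}. 2 * card U \<le> n \<longrightarrow> \<gamma> * real (card U) \<le> real (card (nbrs E U)))"

text \<open>A nonempty set that spans at least as many edges as it has vertices contains a cycle. The
  empty set belongs to the family as well, which changes the counts by one.\<close>

definition cyclic_sets :: "nat \<Rightarrow> nat \<Rightarrow> nat set set \<Rightarrow> nat set set" where
  "cyclic_sets n w0 E = {W. W \<subseteq> {..<n} \<and> card W \<le> w0 \<and> card W \<le> card (spanned E W)}"

text \<open>A set \<open>U\<close> of linear size has many neighbours because many edges leave it and each
  neighbour receives at most \<open>d\<close> of them. For a smaller set with fewer than \<open>card U / 10\<close>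
  neighbours, the closed neighbourhood would have at most \<open>11/10 * card U\<close> vertices but at
  least \<open>3/2 * card U\<close> edges, which is more than \<open>5/4\<close> edges per vertex.\<close>

lemma expandingI:
  assumes E: "regular_edges {..<n} d E" and d: "d \<ge> 3"
    and sparse: "\<And>W. W \<subseteq> {..<n} \<Longrightarrow> W \<noteq> {} \<Longrightarrow> real (card W) \<le> \<epsilon> * real n \<Longrightarrow>
      4 * card (spanned E W) < 5 * card W"
    and cuts: "\<And>U. U \<subseteq> {..<n} \<Longrightarrow> \<epsilon> / 2 * real n \<le> real (card U) \<Longrightarrow> 2 * card U \<le> n \<Longrightarrow>
      \<tau> * real n < real (cut n E U)"
    and \<tau>: "\<tau> > 0"
  shows "expanding n (min (1/10) (2 * \<tau> / real d)) E"
  unfolding expanding_def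
proof (intro allI impI)
  interpret regular_edges "{..<n}" d E by fact
  fix U assume U: "U \<subseteq> {..<n}" "2 * card U \<le> n"
  let ?N = "nbrs E U"
  have fin: "finite U" "finite ?N" using U finite_subset finite_nbrs by auto
  show "min (1/10) (2 * \<tau> / real d) * real (card U) \<le> real (card ?N)"
  proof (cases "\<epsilon> / 2 * real n \<le> real (card U)")
    case True
    have "\<tau> * (2 * real (card U)) \<le> \<tau> * real n" using U \<tau> by (intro mult_left_mono) auto
    also have "\<dots> \<le> real (cut n E U)" using cuts[OF U(1) True U(2)] by simp
    also have "\<dots> \<le> real (d * card ?N)"
      using card_arcs_le_nbrs[OF U(1)] by (simp only: cut_def of_nat_le_iff)
    finally have "2 * \<tau> / real d * real (card U) \<le> real (card ?N)"
      using d by (simp add: field_simps)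
    moreover have "min (1/10) (2 * \<tau> / real d) * real (card U) \<le> 2 * \<tau> / real d * real (card U)"
      by (intro mult_right_mono) auto
    ultimately show ?thesis by linarith
  next
    case False
    have "1/10 * real (card U) \<le> real (card ?N)"
    proof (rule ccontr)
      assume small: "\<not> ?thesis"
      let ?W = "U \<union> ?N"
      have cW: "card ?W = card U + card ?N"
        using fin nbrs_disjoint[of E U] by (subst card_Un_disjoint) auto
      have "?W \<noteq> {}" using small by auto
      moreover have "?W \<subseteq> {..<n}" using U nbrs_subset by auto
      moreover have "real (card ?W) \<le> \<epsilon> * real n" using False small cW by simp
      ultimately have less: "4 * card (spanned E ?W) < 5 * card ?W" using sparse by blast
      have "3 * card U \<le> d * card U" using d by simp
      then show False
        using less small cW spanned_closed_nbhd[OF U(1)] card_arcs_split[OF U(1)] card_arcs_self[OF fin(1)]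
        by linarith
    qed
    moreover have "min (1/10) (2 * \<tau> / real d) * real (card U) \<le> 1/10 * real (card U)"
      by (intro mult_right_mono) auto
    ultimately show ?thesis by linarith
  qed
qed

lemma prob_not_expanding:
  assumes d: "d \<ge> 3"
  obtains \<gamma> :: real and err :: "nat \<Rightarrow> real" where "\<gamma> > 0" "err \<longlonglongrightarrow> 0"
    "\<forall>\<^sub>F n in sequentially. even (d * n) \<longrightarrow>
      measure_pmf.prob (random_edges n d) {E. \<not> expanding n \<gamma> E} \<le> err n"
proof -
  define \<epsilon> where "\<epsilon> = 1 / (3 * real d * (18 * real d) ^ 4)"
  have \<epsilon>: "0 < \<epsilon> / 2" "\<epsilon> / 2 \<le> 1"
  proof -
    have "1 * 1 \<le> 3 * real d * (18 * real d) ^ 4"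
      using d by (intro mult_mono one_le_power) auto
    then show "\<epsilon> / 2 \<le> 1" by (simp add: \<epsilon>_def field_simps)
    show "0 < \<epsilon> / 2" using d by (simp add: \<epsilon>_def)
  qed
  obtain err1 where err1: "err1 \<longlonglongrightarrow> 0" "\<forall>\<^sub>F n in sequentially. reg_family n d \<noteq> {} \<longrightarrow>
      measure_pmf.prob (random_edges n d)
        {E. \<exists>W\<subseteq>{..<n}. W \<noteq> {} \<and> real (card W) \<le> \<epsilon> * real n
              \<and> 5 * card W \<le> 4 * card (spanned E W)} \<le> err1 n"
    using prob_dense_set_tendsto[OF d] unfolding \<epsilon>_def by blast
  obtain \<tau> err2 where \<tau>: "\<tau> > 0" and err2: "err2 \<longlonglongrightarrow> 0"
    "\<forall>\<^sub>F n in sequentially. even (d * n) \<longrightarrow> reg_family n d \<noteq> {} \<longrightarrow>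
      measure_pmf.prob (random_edges n d)
        {E. \<exists>U\<subseteq>{..<n}. \<epsilon> / 2 * real n \<le> real (card U) \<and> 2 * card U \<le> n
              \<and> real (cut n E U) \<le> \<tau> * real n} \<le> err2 n"
    using prob_small_cut_tendsto[OF d \<epsilon>] by blast
  define \<gamma> where "\<gamma> = min (1/10) (2 * \<tau> / real d)"
  show thesis
  proof (rule that[of \<gamma> "\<lambda>n. err1 n + err2 n"])
    show "\<gamma> > 0" using \<tau> d by (simp add: \<gamma>_def)
    show "(\<lambda>n. err1 n + err2 n) \<longlonglongrightarrow> 0" using tendsto_add[OF err1(1) err2(1)] by simp
    show "\<forall>\<^sub>F n in sequentially. even (d * n) \<longrightarrow>
      measure_pmf.prob (random_edges n d) {E. \<not> expanding n \<gamma> E} \<le> err1 n + err2 n"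
      using err1(2) err2(2) eventually_gt_at_top[of "d + 1"]
    proof (eventually_elim, intro impI)
      fix n :: nat
      let ?P = "measure_pmf.prob (random_edges n d)"
      let ?A = "{E. \<exists>W\<subseteq>{..<n}. W \<noteq> {} \<and> real (card W) \<le> \<epsilon> * real n
              \<and> 5 * card W \<le> 4 * card (spanned E W)}"
      let ?B = "{E. \<exists>U\<subseteq>{..<n}. \<epsilon> / 2 * real n \<le> real (card U) \<and> 2 * card U \<le> n
              \<and> real (cut n E U) \<le> \<tau> * real n}"
      assume A: "reg_family n d \<noteq> {} \<longrightarrow> ?P ?A \<le> err1 n"
        and B: "even (d * n) \<longrightarrow> reg_family n d \<noteq> {} \<longrightarrow> ?P ?B \<le> err2 n"
        and n: "d + 1 < n" and even: "even (d * n)"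
      have ne: "reg_family n d \<noteq> {}" by (rule reg_family_nonempty[OF even n])
      have "?P {E. \<not> expanding n \<gamma> E} \<le> ?P (?A \<union> ?B)"
      proof (rule measure_pmf.finite_measure_mono_AE)
        show "AE E in random_edges n d. E \<in> {E. \<not> expanding n \<gamma> E} \<longrightarrow> E \<in> ?A \<union> ?B"
        proof (rule AE_pmfI, rule impI, rule ccontr)
          fix E assume E: "E \<in> set_pmf (random_edges n d)" "E \<in> {E. \<not> expanding n \<gamma> E}" "E \<notin> ?A \<union> ?B"
          have "expanding n \<gamma> E" unfolding \<gamma>_def
          proof (rule expandingI[OF set_random_edges[OF ne E(1)] d, of \<epsilon>])
            show "4 * card (spanned E W) < 5 * card W"
              if "W \<subseteq> {..<n}" "W \<noteq> {}" "real (card W) \<le> \<epsilon> * real n" for W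
            proof (rule ccontr)
              assume "\<not> 4 * card (spanned E W) < 5 * card W"
              then have "E \<in> ?A" using that by (intro CollectI exI[of _ W]) simp
              then show False using E(3) by blast
            qed
            show "\<tau> * real n < real (cut n E U)"
              if "U \<subseteq> {..<n}" "\<epsilon> / 2 * real n \<le> real (card U)" "2 * card U \<le> n" for U
            proof (rule ccontr)
              assume "\<not> \<tau> * real n < real (cut n E U)"
              then have "E \<in> ?B" using that by (intro CollectI exI[of _ U]) simp
              then show False using E(3) by blast
            qed
          qed fact
          then show False using E(2) by simp
        qed
      qed auto
      also have "\<dots> \<le> ?P ?A + ?P ?B" by (rule measure_Un_le) auto
      also have "\<dots> \<le> err1 n + err2 n" using A B ne even by (intro add_mono) auto
      finally show "?P {E. \<not> expanding n \<gamma> E} \<le> err1 n + err2 n" .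
    qed
  qed
qed

text \<open>Markov's inequality for the number of events that occur.\<close>

lemma prob_many_events_le:
  fixes M :: "'a pmf" and A :: "'i \<Rightarrow> 'a set" and t :: real
  assumes I: "finite I" and t: "t > 0"
  shows "measure_pmf.prob M {\<omega>. t \<le> real (card {i \<in> I. \<omega> \<in> A i})}
    \<le> (\<Sum>i\<in>I. measure_pmf.prob M (A i)) / t"
proof -
  define X where "X = (\<lambda>\<omega>. \<Sum>i\<in>I. indicat_real (A i) \<omega>)"
  have X: "X \<omega> = real (card {i \<in> I. \<omega> \<in> A i})" for \<omega>
    using I by (simp add: X_def indicator_def sum.If_cases Int_def)
  have int: "integrable M (indicat_real (A i))" for i
    by (rule measure_pmf.integrable_const_bound[where B = 1]) auto
  have "measure_pmf.prob M {\<omega> \<in> space M. t \<le> X \<omega>} \<le> measure_pmf.expectation M X / t"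
    using int t by (intro integral_Markov_inequality_measure[where A = "{}"])
      (auto simp: X_def intro!: sum_nonneg)
  also have "measure_pmf.expectation M X = (\<Sum>i\<in>I. measure_pmf.prob M (A i))"
    unfolding X_def using int by (subst Bochner_Integration.integral_sum) auto
  finally show ?thesis by (simp add: X)
qed

lemma prob_many_cyclic_sets:
  assumes d: "d > 0" and \<delta>: "\<delta> > 0"
  obtains err :: "nat \<Rightarrow> real" where "err \<longlonglongrightarrow> 0"
    "\<forall>\<^sub>F n in sequentially. even (d * n) \<longrightarrow>
      measure_pmf.prob (random_edges n d) {E. real n powr \<delta> \<le> real (card (cyclic_sets n w0 E))} \<le> err n"
proof -
  obtain c where c: "\<forall>\<^sub>F n in sequentially. reg_family n d \<noteq> {} \<longrightarrow>
    (\<Sum>W | W \<subseteq> {..<n} \<and> card W \<le> w0. measure_pmf.prob (random_edges n d)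
       {E. card W \<le> card (spanned E W)}) \<le> c"
    using expected_cyclic_sets[OF d] by blast
  show thesis
  proof (rule that[of "\<lambda>n. c / real n powr \<delta>"])
    show "(\<lambda>n. c / real n powr \<delta>) \<longlonglongrightarrow> 0" using \<delta> by real_asymp
    show "\<forall>\<^sub>F n in sequentially. even (d * n) \<longrightarrow>
      measure_pmf.prob (random_edges n d) {E. real n powr \<delta> \<le> real (card (cyclic_sets n w0 E))}
        \<le> c / real n powr \<delta>"
      using c eventually_gt_at_top[of "d + 1"]
    proof (eventually_elim, intro impI)
      fix n :: nat
      let ?P = "measure_pmf.prob (random_edges n d)"
      define I where "I = {W. W \<subseteq> {..<n} \<and> card W \<le> w0}"
      assume c: "reg_family n d \<noteq> {} \<longrightarrow> (\<Sum>W | W \<subseteq> {..<n} \<and> card W \<le> w0.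
          ?P {E. card W \<le> card (spanned E W)}) \<le> c"
        and n: "d + 1 < n" and even: "even (d * n)"
      have fin: "finite I" by (simp add: I_def)
      have eq: "cyclic_sets n w0 E = {W \<in> I. E \<in> {E. card W \<le> card (spanned E W)}}" for E
        by (auto simp: cyclic_sets_def I_def)
      have n0: "real n powr \<delta> > 0" using n by simp
      have "?P {E. real n powr \<delta> \<le> real (card (cyclic_sets n w0 E))}
          \<le> (\<Sum>W\<in>I. ?P {E. card W \<le> card (spanned E W)}) / real n powr \<delta>"
        unfolding eq by (rule prob_many_events_le[OF fin n0])
      also have "\<dots> \<le> c / real n powr \<delta>"
        using c reg_family_nonempty[OF even n] unfolding I_def by (intro divide_right_mono) auto
      finally show "?P {E. real n powr \<delta> \<le> real (card (cyclic_sets n w0 E))} \<le> c / real n powr \<delta>" .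
    qed
  qed
qed

lemma random_regular_graph_eq:
  assumes "reg_family n d \<noteq> {}"
  shows "random_regular_graph n d = map_pmf (Pair {..<n}) (random_edges n d)"
proof -
  have "regular_edges V d E \<longleftrightarrow> simple_graph (V, E) \<and> regular_graph d (V, E)" if "finite V"
    for V :: "nat set" and E
  proof -
    have card_eq: "card {e \<in> E. v \<in> e} = card {w. {v, w} \<in> E}"
      if "\<And>e. e \<in> E \<Longrightarrow> card e = 2" for v
    proof -
      have "bij_betw (\<lambda>w. {v, w}) {w. {v, w} \<in> E} {e \<in> E. v \<in> e}"
        unfolding bij_betw_def
      proof
        show "inj_on (\<lambda>w. {v, w}) {w. {v, w} \<in> E}" by (auto simp: inj_on_def doubleton_eq_iff)
        show "(\<lambda>w. {v, w}) ` {w. {v, w} \<in> E} = {e \<in> E. v \<in> e}"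
        proof (intro equalityI subsetI)
          fix e assume e: "e \<in> {e \<in> E. v \<in> e}"
          then have "card e = 2" using that by simp
          then obtain x y where xy: "e = {x, y}" "x \<noteq> y" by (auto simp: card_2_iff)
          define w where "w = (if v = x then y else x)"
          have "e = {v, w}" using xy e by (auto simp: w_def)
          then show "e \<in> (\<lambda>w. {v, w}) ` {w. {v, w} \<in> E}" using e by blast
        qed auto
      qed
      from bij_betw_same_card[OF this] show ?thesis by (rule sym)
    qed
    show ?thesis
    proof
      assume "regular_edges V d E"
      then interpret regular_edges V d E .
      show "simple_graph (V, E) \<and> regular_graph d (V, E)"
      proof
        show "simple_graph (V, E)" using edgeD by (auto simp: simple_graph_def)
        have "card {e \<in> E. v \<in> e} = d" if "v \<in> V" for v
          using card_eq[of v] edgeD degree[OF that] by metis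
        then show "regular_graph d (V, E)" by (simp add: regular_graph_def)
      qed
    next
      assume *: "simple_graph (V, E) \<and> regular_graph d (V, E)"
      then have e: "e \<subseteq> V \<and> card e = 2" if "e \<in> E" for e
        using that by (auto simp: simple_graph_def)
      show "regular_edges V d E"
      proof
        show "card {w. {v, w} \<in> E} = d" if "v \<in> V" for v
          using * card_eq[of v] e that by (simp add: regular_graph_def)
      qed (use e \<open>finite V\<close> in blast)+
    qed
  qed
  then have "regular_graphs n d = Pair {..<n} ` reg_family n d"
    by (auto simp: regular_graphs_def reg_family_def image_iff)
  then show ?thesis
    unfolding random_regular_graph_def random_edges_def using assms finite_reg_family
    by (subst map_pmf_of_set_inj) (auto simp: inj_on_def)
qed

section \<open>Connected vertex sets\<close>

text \<open>Connectivity is expressed by cuts, which is the form in which a connected set can be grown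
  vertex by vertex.\<close>

definition connected_in :: "'a set set \<Rightarrow> 'a set \<Rightarrow> bool" where
  "connected_in E U \<longleftrightarrow> U \<noteq> {} \<and> (\<forall>W\<subset>U. W \<noteq> {} \<longrightarrow> (\<exists>w\<in>W. \<exists>x\<in>U - W. {w, x} \<in> E))"

lemma connected_in_nonempty: "connected_in E U \<Longrightarrow> U \<noteq> {}"
  by (simp add: connected_in_def)

lemma connected_in_induct [consumes 2, case_names single insert]:
  assumes "connected_in E U" "finite U"
    and single: "\<And>v. v \<in> U \<Longrightarrow> P {v}"
    and insert: "\<And>W w x. W \<subseteq> U \<Longrightarrow> P W \<Longrightarrow> w \<in> W \<Longrightarrow> x \<in> U - W \<Longrightarrow> {w, x} \<in> E \<Longrightarrow> P (insert x W)"
  shows "P U"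
proof -
  have "\<exists>W\<subseteq>U. W \<noteq> {} \<and> card W = Suc j \<and> P W" if "Suc j \<le> card U" for j
    using that
  proof (induction j)
    case 0
    obtain v where "v \<in> U" using assms(1) by (auto simp: connected_in_def)
    then show ?case using single by (intro exI[of _ "{v}"]) auto
  next
    case (Suc j)
    then obtain W where W: "W \<subseteq> U" "W \<noteq> {}" "card W = Suc j" "P W" using Suc_leD by blast
    have "W \<subset> U" using W Suc.prems by auto
    then have "\<exists>w\<in>W. \<exists>x\<in>U - W. {w, x} \<in> E"
      using assms(1) W(2) by (simp add: connected_in_def)
    then obtain w x where wx: "w \<in> W" "x \<in> U - W" "{w, x} \<in> E" by blast
    have "finite W" using W(1) assms(2) by (rule finite_subset)
    then show ?case using W wx insert[OF W(1,4) wx] by (intro exI[of _ "insert x W"]) auto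
  qed
  moreover have "card U > 0" using assms by (auto simp: connected_in_def card_gt_0_iff)
  ultimately obtain W where "W \<subseteq> U" "card W = card U" "P W"
    by (metis Suc_le_eq Suc_pred le_refl)
  then show ?thesis using assms(2) by (metis card_subset_eq)
qed

text \<open>Going around a spanning tree covers a connected set by a walk. A new vertex \<open>x\<close> adjacent
  to a visited vertex \<open>w\<close> is added by the detour from \<open>w\<close> to \<open>x\<close> and back.\<close>

lemma connected_in_walk:
  assumes "connected_in E U" "finite U"
  shows "\<exists>xs. set xs = U \<and> length xs + 1 = 2 * card U \<and> successively (\<lambda>u v. {u, v} \<in> E) xs"
proof -
  have "finite U \<longrightarrow> (\<exists>xs. set xs = U \<and> length xs + 1 = 2 * card U \<and> successively (\<lambda>u v. {u, v} \<in> E) xs)"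
    using assms
  proof (induction rule: connected_in_induct)
    case (single v)
    show ?case by (intro impI exI[of _ "[v]"]) simp
  next
    case (insert W w x)
    have "finite W" using insert.hyps(1) assms(2) by (rule finite_subset)
    with insert.IH obtain xs where xs: "set xs = W" "length xs + 1 = 2 * card W"
      "successively (\<lambda>u v. {u, v} \<in> E) xs" by blast
    obtain ys zs where yz: "xs = ys @ w # zs" using insert.hyps(2) xs(1) by (metis split_list)
    have "successively (\<lambda>u v. {u, v} \<in> E) (ys @ w # x # w # zs)"
      using xs(3) insert.hyps(4) unfolding yz
      by (auto simp: successively_append_iff insert_commute)
    moreover have "set (ys @ w # x # w # zs) = insert x W" using xs(1) by (auto simp: yz)
    moreover have "length (ys @ w # x # w # zs) + 1 = 2 * card (insert x W)"
      using xs(2) insert.hyps(3) \<open>finite W\<close> by (simp add: yz)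
    ultimately show ?case by blast
  qed
  then show ?thesis using assms(2) by blast
qed

context regular_edges
begin

lemma card_walks_le:
  "finite {xs. length xs = Suc L \<and> set xs \<subseteq> V \<and> successively (\<lambda>u v. {u, v} \<in> E) xs} \<and>
   card {xs. length xs = Suc L \<and> set xs \<subseteq> V \<and> successively (\<lambda>u v. {u, v} \<in> E) xs} \<le> card V * d ^ L"
  (is "finite (?W L) \<and> card (?W L) \<le> _")
proof (induction L)
  case 0
  have "?W 0 = (\<lambda>v. [v]) ` V" by (auto simp: length_Suc_conv)
  then show ?case using finite_V by (auto intro: card_image_le)
next
  case (Suc L)
  have sub: "?W (Suc L) \<subseteq> (\<Union>xs\<in>?W L. (\<lambda>x. x # xs) ` {w. {hd xs, w} \<in> E})"
  proof
    fix xs assume xs: "xs \<in> ?W (Suc L)"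
    then obtain x ys where ys: "xs = x # ys" "length ys = Suc L" by (auto simp: length_Suc_conv)
    then obtain y zs where zs: "ys = y # zs" by (cases ys) auto
    show "xs \<in> (\<Union>xs\<in>?W L. (\<lambda>x. x # xs) ` {w. {hd xs, w} \<in> E})"
      using xs ys zs by (intro UN_I[of ys]) (auto simp: insert_commute)
  qed
  have "card (\<Union>xs\<in>?W L. (\<lambda>x. x # xs) ` {w. {hd xs, w} \<in> E})
      \<le> (\<Sum>xs\<in>?W L. card ((\<lambda>x. x # xs) ` {w. {hd xs, w} \<in> E}))"
    using Suc by (intro card_UN_le) auto
  also have "\<dots> \<le> (\<Sum>xs\<in>?W L. d)"
    by (intro sum_mono order_trans[OF card_image_le[OF finite_nbr]] card_nbr_le)
  also have "\<dots> \<le> card V * d ^ Suc L" using Suc by (simp add: mult_ac)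
  finally have "card (\<Union>xs\<in>?W L. (\<lambda>x. x # xs) ` {w. {hd xs, w} \<in> E}) \<le> card V * d ^ Suc L" .
  moreover have "finite (\<Union>xs\<in>?W L. (\<lambda>x. x # xs) ` {w. {hd xs, w} \<in> E})"
    using Suc finite_nbr by auto
  ultimately show ?case using sub by (meson card_mono finite_subset order_trans)
qed

lemma card_connected_sets_le:
  assumes "d > 0"
  shows "card {U. U \<subseteq> V \<and> connected_in E U \<and> card U = k} \<le> card V * d ^ (2 * k)"
proof (cases k)
  case 0
  have empty: "{U. U \<subseteq> V \<and> connected_in E U \<and> card U = k} = {}"
    using 0 finite_subset[OF _ finite_V] connected_in_nonempty[of E] by (auto simp: card_gt_0_iff)
  show ?thesis unfolding empty by simp
next
  case (Suc m)
  let ?W = "{xs. length xs = Suc (2 * m) \<and> set xs \<subseteq> V \<and> successively (\<lambda>u v. {u, v} \<in> E) xs}"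
  have "{U. U \<subseteq> V \<and> connected_in E U \<and> card U = k} \<subseteq> set ` ?W"
  proof clarify
    fix U assume U: "U \<subseteq> V" "connected_in E U" "k = card U"
    then have "finite U" using finite_V finite_subset by blast
    then obtain xs where "set xs = U" "length xs + 1 = 2 * card U"
      "successively (\<lambda>u v. {u, v} \<in> E) xs" using connected_in_walk[OF U(2)] by auto
    then show "U \<in> set ` ?W" using U Suc by (intro image_eqI[of _ _ xs]) auto
  qed
  then have "card {U. U \<subseteq> V \<and> connected_in E U \<and> card U = k} \<le> card ?W"
    using card_walks_le[of "2 * m"] by (meson card_image_le card_mono finite_imageI order_trans)
  also have "\<dots> \<le> card V * d ^ (2 * m)" using card_walks_le by blast
  also have "\<dots> \<le> card V * d ^ (2 * k)"
    using assms Suc by (intro mult_left_mono power_increasing) auto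
  finally show ?thesis .
qed

text \<open>Growing \<open>U\<close> vertex by vertex reaches every new vertex along a new edge.\<close>

lemma card_spanned_connected:
  assumes "connected_in E U" "U \<subseteq> V"
  shows "card U \<le> card (spanned E U) + 1"
proof -
  have fin: "finite U" using assms finite_V finite_subset by blast
  show ?thesis using assms(1) fin
  proof (induction rule: connected_in_induct)
    case (insert W w x)
    have fW: "finite W" using insert.hyps(1) fin by (rule finite_subset)
    have fs: "finite (spanned E (insert x W))" using finite_E by (simp add: spanned_def)
    have "insert {w, x} (spanned E W) \<subseteq> spanned E (insert x W)" "{w, x} \<notin> spanned E W"
      using insert.hyps by (auto simp: spanned_def)
    then have "card (spanned E W) + 1 \<le> card (spanned E (insert x W))"
      using card_mono[OF fs, of "insert {w, x} (spanned E W)"] finite_E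
      by (simp add: spanned_def)
    then show ?case using insert.IH insert.hyps fW by simp
  qed simp
qed

text \<open>A connected set of \<open>k\<close> vertices whose neighbourhood is a tree has \<open>(d - 2) * k + 2\<close>
  neighbours; with fewer neighbours its closed neighbourhood contains a cycle.\<close>

lemma few_nbrs_imp_cyclic:
  assumes "connected_in E U" "U \<subseteq> V" "d \<ge> 2"
    and few: "card (nbrs E U) < (d - 2) * card U + 2"
  shows "card (U \<union> nbrs E U) \<le> card (spanned E (U \<union> nbrs E U))"
proof -
  have fin: "finite U" using assms finite_V finite_subset by blast
  have W: "card (U \<union> nbrs E U) = card U + card (nbrs E U)"
    using fin finite_nbrs nbrs_disjoint[of E U] by (subst card_Un_disjoint) auto
  have s: "2 * card (spanned E U) + card (arcs E U (V - U)) = d * card U"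
    using card_arcs_split[OF assms(2)] card_arcs_self[OF fin] by simp
  have le: "card (spanned E U) + card (arcs E U (V - U)) \<le> card (spanned E (U \<union> nbrs E U))"
    by (rule spanned_closed_nbhd[OF assms(2)])
  show ?thesis
  proof (cases "card U \<le> card (spanned E U)")
    case True
    then show ?thesis using W le card_nbrs_le_arcs[OF assms(2)] by linarith
  next
    case False
    have "(d - 2) * card U + 2 * card U = d * card U"
      using assms(3) by (metis add_mult_distrib le_add_diff_inverse2)
    then have "(d - 2) * card U + 2 \<le> card (arcs E U (V - U))" using False s by linarith
    then show ?thesis using few W le card_spanned_connected[OF assms(1,2)] by linarith
  qed
qed

end

section \<open>Connected components\<close>

lemma sym_adjacency_rtrancl: "(u, v) \<in> (adjacency H)\<^sup>* \<Longrightarrow> (v, u) \<in> (adjacency H)\<^sup>*"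
proof -
  have "sym (adjacency H)" by (auto simp: sym_def adjacency_def insert_commute)
  then show "(u, v) \<in> (adjacency H)\<^sup>* \<Longrightarrow> (v, u) \<in> (adjacency H)\<^sup>*"
    by (metis sym_rtrancl symD)
qed

lemma component_eq:
  assumes "C \<in> conn_components H" "u \<in> C"
  shows "C = {v \<in> verts H. (u, v) \<in> (adjacency H)\<^sup>*}"
proof -
  obtain z where z: "C = {v \<in> verts H. (z, v) \<in> (adjacency H)\<^sup>*}" "(z, u) \<in> (adjacency H)\<^sup>*"
    using assms by (auto simp: conn_components_def)
  then show ?thesis
    by (auto intro: rtrancl_trans dest: sym_adjacency_rtrancl)
qed

lemma component_exists:
  assumes "u \<in> verts H"
  shows "\<exists>C\<in>conn_components H. u \<in> C"
  using assms by (auto simp: conn_components_def)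

lemma component_subset: "C \<in> conn_components H \<Longrightarrow> C \<subseteq> verts H \<and> C \<noteq> {}"
  by (auto simp: conn_components_def)

lemma component_disjoint:
  assumes "C \<in> conn_components H" "C' \<in> conn_components H" "u \<in> C" "u \<in> C'"
  shows "C = C'"
  using component_eq[OF assms(1,3)] component_eq[OF assms(2,4)] by simp

lemma component_closed:
  assumes "C \<in> conn_components H" "u \<in> C" "v \<in> verts H" "{u, v} \<in> edges H"
  shows "v \<in> C"
  using assms(3,4) by (subst component_eq[OF assms(1,2)]) (auto simp: adjacency_def)

lemma component_connected:
  assumes C: "C \<in> conn_components H" and closed: "\<And>u v. {u, v} \<in> edges H \<Longrightarrow> v \<in> verts H"
  shows "connected_in (edges H) C"
  unfolding connected_in_def
proof (intro conjI allI impI)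
  show "C \<noteq> {}" using component_subset[OF C] by simp
  fix W assume W: "W \<subset> C" "W \<noteq> {}"
  then obtain w x where wx: "w \<in> W" "x \<in> C" "x \<notin> W" by auto
  show "\<exists>w\<in>W. \<exists>x\<in>C - W. {w, x} \<in> edges H"
  proof (rule ccontr)
    assume no: "\<not> ?thesis"
    have "(w, x) \<in> (adjacency H)\<^sup>*" using component_eq[OF C, of w] wx W by auto
    then have "x \<in> W"
    proof (induction rule: rtrancl_induct)
      case (step y z)
      then have yz: "{y, z} \<in> edges H" by (simp add: adjacency_def)
      then have "z \<in> C" using component_closed[OF C, of y z] closed step.IH W by auto
      then show ?case using no yz step.IH by auto
    qed (use wx in simp)
    then show False using wx by simp
  qed
qed

section \<open>The giant component after deletions\<close>

lemma verts_induced: "verts (induced_subgraph (V, E) S) = V \<inter> S"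
  by (simp add: induced_subgraph_def)

lemma edges_induced: "edges (induced_subgraph (V, E) S) = {e \<in> E. e \<subseteq> S}"
  by (simp add: induced_subgraph_def)

lemma connected_in_mono: "connected_in E' U \<Longrightarrow> E' \<subseteq> E \<Longrightarrow> connected_in E U"
  unfolding connected_in_def by (meson subsetD)

context regular_edges
begin

lemma component_of_induced:
  assumes C: "C \<in> conn_components (induced_subgraph (V, E) S)"
  shows "C \<subseteq> V \<inter> S" "C \<noteq> {}" "connected_in E C" "nbrs E C \<inter> S = {}"
proof -
  let ?H = "induced_subgraph (V, E) S"
  show sub: "C \<subseteq> V \<inter> S" "C \<noteq> {}" using component_subset[OF C] by (auto simp: verts_induced)
  have "connected_in (edges ?H) C"
    by (rule component_connected[OF C]) (auto simp: verts_induced edges_induced dest: edge_verts)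
  then show "connected_in E C" by (rule connected_in_mono) (auto simp: edges_induced)
  show "nbrs E C \<inter> S = {}"
  proof (rule ccontr)
    assume "nbrs E C \<inter> S \<noteq> {}"
    then obtain u v where uv: "u \<in> C" "v \<notin> C" "{u, v} \<in> E" "v \<in> S" by (auto simp: nbrs_def)
    then have "v \<in> verts ?H" "{u, v} \<in> edges ?H"
      using sub edge_verts by (auto simp: verts_induced edges_induced)
    then show False using component_closed[OF C uv(1)] uv(2) by blast
  qed
qed

text \<open>The edge boundary is additive over parts without edges between them, so it is enough to
  bound it from below on connected sets.\<close>

lemma edge_boundary_induct:
  fixes \<beta> :: real
  assumes C: "finite C" and U: "U \<subseteq> C" "2 * card U \<le> card C"
    and conn: "\<And>U. U \<subseteq> C \<Longrightarrow> 2 * card U \<le> card C \<Longrightarrow> connected_in E U \<Longrightarrow>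
      \<beta> * real (card U) \<le> real (card (arcs E U (C - U)))"
  shows "\<beta> * real (card U) \<le> real (card (arcs E U (C - U)))"
  using U
proof (induction "card U" arbitrary: U rule: less_induct)
  case (less U)
  have fU: "finite U" using less.prems C finite_subset by blast
  show ?case
  proof (cases "U = {} \<or> connected_in E U")
    case True
    then show ?thesis using conn less.prems by auto
  next
    case False
    then obtain W where W: "W \<subset> U" "W \<noteq> {}" and no: "\<forall>w\<in>W. \<forall>x\<in>U - W. {w, x} \<notin> E"
      unfolding connected_in_def by blast
    define X where "X = U - W"
    have WX: "U = W \<union> X" "W \<inter> X = {}" "X \<subset> U" using W by (auto simp: X_def)
    have fin: "finite W" "finite X" using fU WX(1) by auto
    have cU: "card U = card W + card X" using WX fin by (simp add: card_Un_disjoint)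
    have lt: "card W < card U" "card X < card U"
      using psubset_card_mono[OF fU] W(1) WX(3) by auto
    have IH: "\<beta> * real (card W) \<le> real (card (arcs E W (C - W)))"
      "\<beta> * real (card X) \<le> real (card (arcs E X (C - X)))"
      using less.hyps[OF lt(1)] less.hyps[OF lt(2)] less.prems WX cU by auto
    have "arcs E W (C - W) \<subseteq> arcs E W (C - U)"
      using no by (auto simp: X_def)
    moreover have "arcs E X (C - X) \<subseteq> arcs E X (C - U)"
    proof (rule subrelI)
      fix x y assume "(x, y) \<in> arcs E X (C - X)"
      then show "(x, y) \<in> arcs E X (C - U)"
        using no by (auto simp: X_def insert_commute[of x y])
    qed
    ultimately have "card (arcs E W (C - W)) \<le> card (arcs E W (C - U))"
      "card (arcs E X (C - X)) \<le> card (arcs E X (C - U))"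
      using C fin by (auto intro!: card_mono finite_arcs)
    moreover have "card (arcs E U (C - U)) = card (arcs E W (C - U)) + card (arcs E X (C - U))"
      using card_arcs_Un_left[of "C - U" W X E] C fin WX by auto
    ultimately show ?thesis using IH by (simp add: cU algebra_simps)
  qed
qed

text \<open>Small connected sets have a neighbour inside the component simply because the component is
  connected; larger ones keep, by assumption, a positive proportion of their neighbours.\<close>

lemma expander_component:
  fixes \<gamma> :: real
  assumes C: "C \<in> conn_components (induced_subgraph (V, E) S)"
    and \<gamma>: "\<gamma> > 0" and K: "K > 0" and d: "d > 0"
    and surv: "\<And>U. U \<subseteq> V \<Longrightarrow> connected_in E U \<Longrightarrow> K \<le> card U \<Longrightarrow> 2 * card U \<le> card V \<Longrightarrow>
      \<gamma> * real (card U) \<le> real (card (nbrs E U \<inter> S))"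
  shows "expander (min \<gamma> (1 / real K) / real d) (induced_subgraph (induced_subgraph (V, E) S) C)"
proof -
  let ?H = "induced_subgraph (induced_subgraph (V, E) S) C"
  note C_props = component_of_induced[OF C]
  define \<beta> where "\<beta> = min \<gamma> (1 / real K)"
  have vH: "verts ?H = C" using C_props(1) by (auto simp: induced_subgraph_def)
  have eH: "edges ?H = {e \<in> E. e \<subseteq> C}" using C_props(1) by (auto simp: induced_subgraph_def)
  have fC: "finite C" using C_props(1) finite_V finite_subset by blast
  have cC: "card C \<le> card V" using C_props(1) finite_V by (intro card_mono) auto
  have bound: "\<beta> * real (card U) \<le> real (card (arcs E U (C - U)))"
    if U: "U \<subseteq> C" "2 * card U \<le> card C" and conn: "connected_in E U" for U
  proof (cases "card U < K")
    case True
    have ne: "U \<noteq> {}" using connected_in_nonempty[OF conn] .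
    have "card C > 0" using C_props(2) fC by (simp add: card_gt_0_iff)
    then have "U \<subset> C" using U by auto
    then obtain u x where "u \<in> U" "x \<in> C - U" "{u, x} \<in> E"
      using C_props(3) ne unfolding connected_in_def by blast
    then have "(u, x) \<in> arcs E U (C - U)" by simp
    moreover have "finite (arcs E U (C - U))" using U fC finite_subset by (blast intro: finite_arcs)
    ultimately have "1 \<le> card (arcs E U (C - U))" by (metis One_nat_def Suc_leI card_gt_0_iff empty_iff)
    moreover have "\<beta> * real (card U) \<le> 1"
    proof -
      have "\<beta> * real (card U) \<le> (1 / real K) * real K"
        using True by (intro mult_mono) (auto simp: \<beta>_def)
      then show ?thesis using K by simp
    qed
    ultimately show ?thesis by linarith
  next
    case False
    have "nbrs E U \<inter> S \<subseteq> snd ` arcs E U (C - U)"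
    proof
      fix v assume v: "v \<in> nbrs E U \<inter> S"
      then obtain u where u: "u \<in> U" "{u, v} \<in> E" "v \<notin> U" by (auto simp: nbrs_def)
      have "v \<in> C"
      proof (rule ccontr)
        assume "v \<notin> C"
        then have "v \<in> nbrs E C \<inter> S" using u v U by (auto simp: nbrs_def)
        then show False using C_props(4) by simp
      qed
      then have "(u, v) \<in> arcs E U (C - U)" using u by simp
      then show "v \<in> snd ` arcs E U (C - U)" by (metis image_eqI snd_conv)
    qed
    then have "card (nbrs E U \<inter> S) \<le> card (arcs E U (C - U))"
      using U fC finite_subset by (intro surj_card_le finite_arcs) auto
    moreover have "\<gamma> * real (card U) \<le> real (card (nbrs E U \<inter> S))"
      using U C_props(1) cC False by (intro surv conn) auto
    moreover have "\<beta> * real (card U) \<le> \<gamma> * real (card U)"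
      by (intro mult_right_mono) (auto simp: \<beta>_def)
    ultimately show ?thesis by linarith
  qed
  show ?thesis unfolding expander_def vH \<beta>_def[symmetric]
  proof (intro allI impI)
    fix U assume U: "U \<subseteq> C" "real (card U) \<le> real (card C) / 2"
    let ?N = "neighborhood ?H U"
    have fin: "finite U" "finite ?N" using U fC finite_subset by (auto simp: neighborhood_def vH)
    have "\<beta> * real (card U) \<le> real (card (arcs E U (C - U)))"
      using U by (intro edge_boundary_induct[OF fC _ _ bound]) auto
    also have "card (arcs E U (C - U)) = card (arcs E U ?N)"
    proof -
      have "arcs E U (C - U) = arcs E U ?N"
        using U(1) by (fastforce simp: neighborhood_def adjacency_def vH eH)
      then show ?thesis by simp
    qed
    also have "\<dots> = card (arcs E ?N U)" by (rule card_arcs_commute)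
    also have "real \<dots> \<le> real (d * card ?N)"
      using card_arcs_le[OF fin(2)] by (simp only: of_nat_le_iff)
    finally show "\<beta> / real d * real (card U) \<le> real (card ?N)"
      using d by (simp add: field_simps)
  qed
qed

text \<open>Every component with fewer than \<open>K\<close> vertices contains a neighbour of a deleted vertex, so
  these components cover at most \<open>d * K\<close> vertices for each deleted one.\<close>

lemma giant_component:
  assumes nonempty: "\<And>U. U \<subseteq> V \<Longrightarrow> U \<noteq> {} \<Longrightarrow> 2 * card U \<le> card V \<Longrightarrow> nbrs E U \<noteq> {}"
    and surv: "\<And>U. U \<subseteq> V \<Longrightarrow> connected_in E U \<Longrightarrow> K \<le> card U \<Longrightarrow> 2 * card U \<le> card V \<Longrightarrow>
      nbrs E U \<inter> S \<noteq> {}"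
    and few: "(1 + d * K) * card (V - S) < card V" and K: "2 * K \<le> card V"
  obtains C where "C \<in> conn_components (induced_subgraph (V, E) S)"
    "card V \<le> card C + (1 + d * K) * card (V - S)"
    "\<And>C'. C' \<in> conn_components (induced_subgraph (V, E) S) - {C} \<Longrightarrow> card C' < K"
proof -
  let ?H = "induced_subgraph (V, E) S"
  have dichotomy: "card C < K \<or> card V < 2 * card C" if C: "C \<in> conn_components ?H" for C
    using surv[of C] component_of_induced[OF C] by force
  define comp where "comp = (\<lambda>z. {v \<in> verts ?H. (z, v) \<in> (adjacency ?H)\<^sup>*})"
  define cz where "cz = (\<lambda>z. if card (comp z) < K then comp z else {})"
  define X where "X = (\<Union>y\<in>V - S. \<Union>z\<in>{z. {y, z} \<in> E}. cz z)"
  have fin_comp: "finite (cz z)" for z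
    using finite_V by (auto simp: cz_def comp_def verts_induced)
  have finX: "finite X" unfolding X_def using finite_V finite_nbr fin_comp by blast
  have "card X \<le> (\<Sum>y\<in>V - S. card (\<Union>z\<in>{z. {y, z} \<in> E}. cz z))"
    unfolding X_def using finite_V by (intro card_UN_le) auto
  also have "\<dots> \<le> (\<Sum>y\<in>V - S. d * K)"
  proof (rule sum_mono)
    fix y assume "y \<in> V - S"
    have "card (\<Union>z\<in>{z. {y, z} \<in> E}. cz z) \<le> (\<Sum>z\<in>{z. {y, z} \<in> E}. card (cz z))"
      by (rule card_UN_le[OF finite_nbr])
    also have "\<dots> \<le> (\<Sum>z\<in>{z. {y, z} \<in> E}. K)" by (intro sum_mono) (simp add: cz_def)
    also have "\<dots> \<le> d * K" using card_nbr_le[of y] by simp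
    finally show "card (\<Union>z\<in>{z. {y, z} \<in> E}. cz z) \<le> d * K" .
  qed
  finally have cX: "card X \<le> d * K * card (V - S)" by (simp add: mult.commute)
  have small: "C \<subseteq> X" if C: "C \<in> conn_components ?H" "card C < K" for C
  proof -
    note p = component_of_induced[OF C(1)]
    have "nbrs E C \<noteq> {}" using p(1,2) C(2) K by (intro nonempty) auto
    then obtain z y where zy: "z \<in> C" "{z, y} \<in> E" "y \<in> nbrs E C" by (auto simp: nbrs_def)
    then have "y \<in> V - S" using p(4) nbrs_subset by blast
    moreover have "C = cz z" using component_eq[OF C(1) zy(1)] C(2) by (simp add: cz_def comp_def)
    ultimately show "C \<subseteq> X" using zy(2) by (auto simp: X_def insert_commute)
  qed
  have "card (V \<inter> S) + card (V - S) = card V"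
    using finite_V by (metis Int_Diff_Un card_Un_disjoint finite_Diff finite_Int Int_Diff_disjoint)
  then have VS: "card V \<le> card (V \<inter> S) + card (V - S)" by simp
  have "\<not> V \<inter> S \<subseteq> X"
  proof
    assume "V \<inter> S \<subseteq> X"
    then have "card (V \<inter> S) \<le> card X" using finX by (rule card_mono[rotated])
    then show False using VS cX few by simp
  qed
  then obtain v where "v \<in> V \<inter> S" and v: "v \<notin> X" by blast
  then have "v \<in> verts ?H" by (simp only: verts_induced)
  from component_exists[OF this] obtain C where C: "C \<in> conn_components ?H" "v \<in> C" by blast
  have "\<not> card C < K" using small[OF C(1)] C(2) v by blast
  then have big: "card V < 2 * card C" using dichotomy[OF C(1)] by simp
  have others: "card C' < K" if C': "C' \<in> conn_components ?H - {C}" for C'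
  proof -
    have dis: "C \<inter> C' = {}" using component_disjoint[of C' ?H C] C(1) C' by auto
    have sub: "C \<subseteq> V" "C' \<subseteq> V" using component_of_induced(1) C(1) C' by blast+
    then have f: "finite C" "finite C'" using finite_V finite_subset by auto
    have "card C + card C' = card (C \<union> C')" using dis f by (simp add: card_Un_disjoint)
    also have "\<dots> \<le> card V" using sub finite_V by (intro card_mono) auto
    finally show ?thesis using big dichotomy[of C'] C' by auto
  qed
  have "V \<inter> S \<subseteq> C \<union> X"
  proof
    fix u assume "u \<in> V \<inter> S"
    then obtain C' where C': "C' \<in> conn_components ?H" "u \<in> C'"
      using component_exists[of u ?H] by (auto simp: verts_induced)
    then show "u \<in> C \<union> X" using others[of C'] small[of C'] by (cases "C' = C") auto
  qed
  moreover have "finite C" using component_of_induced(1)[OF C(1)] finite_V finite_subset by blast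
  ultimately have "card (V \<inter> S) \<le> card (C \<union> X)" using finX by (intro card_mono) auto
  then have "card (V \<inter> S) \<le> card C + card X" using card_Un_le le_trans by blast
  then have "card V \<le> card C + (1 + d * K) * card (V - S)" using VS cX by simp
  then show thesis using that[OF C(1) _ others] by blast
qed

end

section \<open>Random deletions\<close>

definition deletions :: "nat \<Rightarrow> real \<Rightarrow> (nat \<Rightarrow> bool) pmf" where
  "deletions n p = Pi_pmf {..<n} False (\<lambda>_. bernoulli_pmf p)"

lemma prob_all_deleted:
  assumes "T \<subseteq> {..<n}" "0 \<le> p" "p \<le> 1"
  shows "measure_pmf.prob (deletions n p) {D. \<forall>v\<in>T. D v} = p ^ card T"
proof -
  define B where "B = (\<lambda>v. if v \<in> T then {True} else UNIV)"
  have "{D. \<forall>v\<in>T. D v} = Pi {..<n} B"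
    using assms(1) by (auto simp: B_def Pi_def)
  then have "measure_pmf.prob (deletions n p) {D. \<forall>v\<in>T. D v}
      = (\<Prod>v\<in>{..<n}. measure_pmf.prob (bernoulli_pmf p) (B v))"
    by (simp add: deletions_def measure_Pi_pmf_Pi)
  also have "\<dots> = (\<Prod>v\<in>{..<n}. if v \<in> T then p else 1)"
    using assms by (intro prod.cong) (auto simp: B_def measure_pmf_single)
  also have "\<dots> = p ^ card T"
    using assms(1) by (simp add: prod.If_cases Int_absorb1)
  finally show ?thesis .
qed

lemma sum_geometric_le:
  fixes x :: real
  assumes "0 \<le> x" "x \<le> 1/2"
  shows "(\<Sum>k=K..n. x ^ k) \<le> 2 * x ^ K"
proof -
  have "(\<Sum>k\<in>{K..<K + m}. x ^ k) \<le> 2 * x ^ K - 2 * x ^ (K + m)" for m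
  proof (induction m)
    case (Suc m)
    have "2 * x * x ^ (K + m) \<le> 1 * x ^ (K + m)" using assms by (intro mult_right_mono) auto
    then show ?case using Suc by simp
  qed simp
  from this[of "Suc n - K"] have *: "(\<Sum>k\<in>{K..<K + (Suc n - K)}. x ^ k) \<le> 2 * x ^ K"
    using assms by (smt (verit) zero_le_power)
  show ?thesis
  proof (cases "K \<le> Suc n")
    case True
    then have "{K..<K + (Suc n - K)} = {K..n}" by auto
    then show ?thesis using * by simp
  qed (use assms in simp)
qed

text \<open>A union bound over the connected sets: there are at most \<open>n * d ^ (2k)\<close> of size
  \<open>k\<close>, each has at most \<open>2 ^ (d * k)\<close> sets of neighbours, and one of linear size is deleted
  with probability at most \<open>p\<close> to a power proportional to \<open>k\<close>.\<close>

lemma prob_few_survivors: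
  fixes \<gamma> p :: real and d :: nat
  defines "x \<equiv> real d ^ 2 * 2 ^ d * p powr (\<gamma> / 2)"
  assumes reg: "regular_edges {..<n} d E" and ex: "expanding n \<gamma> E" and d: "d > 0"
    and p: "0 < p" "p \<le> 1" and x: "x \<le> 1/2"
  shows "measure_pmf.prob (deletions n p)
    {D. \<exists>U\<subseteq>{..<n}. connected_in E U \<and> K \<le> card U \<and> 2 * card U \<le> n \<and>
          real (card (nbrs E U \<inter> {v. \<not> D v})) < \<gamma> / 2 * real (card U)} \<le> 2 * real n * x ^ K"
proof -
  interpret regular_edges "{..<n}" d E by fact
  let ?P = "measure_pmf.prob (deletions n p)"
  define I where "I = {U. U \<subseteq> {..<n} \<and> connected_in E U \<and> K \<le> card U \<and> 2 * card U \<le> n}"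
  define J where "J = (\<lambda>U. {T. T \<subseteq> nbrs E U \<and> \<gamma> / 2 * real (card U) \<le> real (card T)})"
  define y where "y = 2 ^ d * p powr (\<gamma> / 2)"
  have y: "y \<ge> 0" by (simp add: y_def)
  have finI: "finite I" by (simp add: I_def)
  have finJ: "finite (J U)" for U using finite_nbrs by (simp add: J_def)
  have "?P {D. \<exists>U\<subseteq>{..<n}. connected_in E U \<and> K \<le> card U \<and> 2 * card U \<le> n \<and>
          real (card (nbrs E U \<inter> {v. \<not> D v})) < \<gamma> / 2 * real (card U)}
      \<le> ?P (\<Union>U\<in>I. \<Union>T\<in>J U. {D. \<forall>v\<in>T. D v})"
  proof (intro measure_pmf.finite_measure_mono subsetI)
    fix D assume "D \<in> {D. \<exists>U\<subseteq>{..<n}. connected_in E U \<and> K \<le> card U \<and> 2 * card U \<le> n \<and>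
          real (card (nbrs E U \<inter> {v. \<not> D v})) < \<gamma> / 2 * real (card U)}"
    then obtain U where U: "U \<in> I" and few: "real (card (nbrs E U \<inter> {v. \<not> D v})) < \<gamma> / 2 * real (card U)"
      by (auto simp: I_def)
    define T where "T = nbrs E U \<inter> {v. D v}"
    have "nbrs E U = T \<union> (nbrs E U \<inter> {v. \<not> D v})" by (auto simp: T_def)
    then have "card (nbrs E U) \<le> card T + card (nbrs E U \<inter> {v. \<not> D v})"
      using card_Un_le by metis
    moreover have "\<gamma> * real (card U) \<le> real (card (nbrs E U))"
      using ex U by (auto simp: expanding_def I_def)
    ultimately have "T \<in> J U" using few by (simp add: J_def T_def)
    moreover have "\<forall>v\<in>T. D v" by (simp add: T_def)
    ultimately show "D \<in> (\<Union>U\<in>I. \<Union>T\<in>J U. {D. \<forall>v\<in>T. D v})" using U by blast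
  qed simp
  also have "\<dots> \<le> (\<Sum>U\<in>I. ?P (\<Union>T\<in>J U. {D. \<forall>v\<in>T. D v}))" by (rule prob_UN_le[OF finI])
  also have "\<dots> \<le> (\<Sum>U\<in>I. y ^ card U)"
  proof (rule sum_mono)
    fix U assume U: "U \<in> I"
    then have sub: "U \<subseteq> {..<n}" by (simp add: I_def)
    then have fU: "finite U" using finite_subset by blast
    have "?P (\<Union>T\<in>J U. {D. \<forall>v\<in>T. D v}) \<le> (\<Sum>T\<in>J U. ?P {D. \<forall>v\<in>T. D v})"
      by (rule prob_UN_le[OF finJ])
    also have "\<dots> \<le> (\<Sum>T\<in>J U. p powr (\<gamma> / 2 * real (card U)))"
    proof (rule sum_mono)
      fix T assume T: "T \<in> J U"
      then have "T \<subseteq> {..<n}" using nbrs_subset by (auto simp: J_def)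
      then have "?P {D. \<forall>v\<in>T. D v} = p powr real (card T)"
        using p by (simp add: prob_all_deleted powr_realpow)
      also have "\<dots> \<le> p powr (\<gamma> / 2 * real (card U))"
        using p T by (intro powr_mono') (auto simp: J_def)
      finally show "?P {D. \<forall>v\<in>T. D v} \<le> p powr (\<gamma> / 2 * real (card U))" .
    qed
    also have "\<dots> = real (card (J U)) * p powr (\<gamma> / 2 * real (card U))" by simp
    also have "\<dots> \<le> real (2 ^ (d * card U)) * p powr (\<gamma> / 2 * real (card U))"
    proof (intro mult_right_mono of_nat_mono)
      have "card (J U) \<le> card (Pow (nbrs E U))"
        using finite_nbrs by (intro card_mono) (auto simp: J_def)
      also have "\<dots> = 2 ^ card (nbrs E U)" by (rule card_Pow[OF finite_nbrs])
      also have "\<dots> \<le> 2 ^ (d * card U)"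
        using card_nbrs_le_arcs[OF sub] card_arcs_le[OF fU, of "{..<n} - U"]
        by (intro power_increasing) auto
      finally show "card (J U) \<le> 2 ^ (d * card U)" .
    qed simp
    also have "\<dots> = y ^ card U"
      using p by (simp add: y_def power_mult power_mult_distrib powr_powr flip: powr_realpow)
    finally show "?P (\<Union>T\<in>J U. {D. \<forall>v\<in>T. D v}) \<le> y ^ card U" .
  qed
  also have "\<dots> = (\<Sum>k\<in>{K..n}. \<Sum>U | U \<in> I \<and> card U = k. y ^ card U)"
    by (rule sum.group[symmetric, OF finI]) (auto simp: I_def)
  also have "\<dots> \<le> (\<Sum>k\<in>{K..n}. real n * x ^ k)"
  proof (rule sum_mono)
    fix k assume "k \<in> {K..n}"
    have "(\<Sum>U | U \<in> I \<and> card U = k. y ^ card U) = real (card {U. U \<in> I \<and> card U = k}) * y ^ k"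
      by simp
    also have "\<dots> \<le> real (n * d ^ (2 * k)) * y ^ k"
    proof (intro mult_right_mono of_nat_mono)
      have "card {U. U \<in> I \<and> card U = k} \<le> card {U. U \<subseteq> {..<n} \<and> connected_in E U \<and> card U = k}"
        by (rule card_mono) (auto simp: I_def)
      then show "card {U. U \<in> I \<and> card U = k} \<le> n * d ^ (2 * k)"
        using card_connected_sets_le[OF d, of k] by simp
    qed (use y in simp)
    also have "\<dots> = real n * x ^ k"
      by (simp add: x_def y_def power_mult power_mult_distrib)
    finally show "(\<Sum>U | U \<in> I \<and> card U = k. y ^ card U) \<le> real n * x ^ k" .
  qed
  also have "\<dots> \<le> real n * (2 * x ^ K)"
    unfolding sum_distrib_left[symmetric]
    using x by (intro mult_left_mono sum_geometric_le) (auto simp: x_def)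
  finally show ?thesis by (simp add: mult_ac)
qed

text \<open>There are at most linearly many connected sets of bounded size \<open>k\<close>, and those with a
  tree-like neighbourhood have at least \<open>(d - 2) * k + 2\<close> neighbours. The others have at least one
  neighbour, because \<open>E\<close> is expanding, and they are few because each lies in one of the few cyclic
  sets. The closed neighbourhood of a set of fewer than \<open>K\<close> vertices has at most \<open>K * (d + 1)\<close>
  vertices.\<close>

lemma prob_small_isolated:
  fixes p \<alpha> M :: real and d K :: nat
  defines "Q \<equiv> {k. k < K \<and> \<alpha> * (real ((d - 2) * k) + 2) > 1}"
  assumes reg: "regular_edges {..<n} d E" and ex: "expanding n \<gamma> E" and \<gamma>: "\<gamma> > 0"
    and d: "d \<ge> 2" and p: "0 \<le> p" "p \<le> 1" and K: "2 * K \<le> n"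
    and M: "real (card (cyclic_sets n (K * (d + 1)) E)) \<le> M"
  shows "measure_pmf.prob (deletions n p)
    {D. \<exists>U\<subseteq>{..<n}. connected_in E U \<and> card U \<in> Q \<and> nbrs E U \<inter> {v. \<not> D v} = {}}
    \<le> (\<Sum>k\<in>Q. real n * real d ^ (2 * k) * p ^ ((d - 2) * k + 2)) + M * 2 ^ (K * (d + 1)) * p"
proof -
  interpret regular_edges "{..<n}" d E by fact
  let ?P = "measure_pmf.prob (deletions n p)"
  define I where "I = {U. U \<subseteq> {..<n} \<and> connected_in E U \<and> card U \<in> Q}"
  define A where "A = {U \<in> I. (d - 2) * card U + 2 \<le> card (nbrs E U)}"
  define B where "B = {U \<in> I. card (nbrs E U) < (d - 2) * card U + 2}"
  let ?ev = "\<lambda>U. {D. \<forall>v\<in>nbrs E U. D v}"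
  have fin: "finite I" "finite A" "finite B" "finite Q" by (auto simp: I_def A_def B_def Q_def)
  have ev: "?P (?ev U) = p ^ card (nbrs E U)" for U
    using nbrs_subset p by (intro prob_all_deleted) auto
  have sumA: "(\<Sum>U\<in>A. p ^ card (nbrs E U)) \<le> (\<Sum>k\<in>Q. real n * real d ^ (2 * k) * p ^ ((d - 2) * k + 2))"
  proof -
    have "(\<Sum>U\<in>A. p ^ card (nbrs E U)) \<le> (\<Sum>U\<in>A. p ^ ((d - 2) * card U + 2))"
      using p by (intro sum_mono power_decreasing) (auto simp: A_def)
    also have "\<dots> = (\<Sum>k\<in>Q. \<Sum>U | U \<in> A \<and> card U = k. p ^ ((d - 2) * card U + 2))"
      by (rule sum.group[symmetric, OF fin(2,4)]) (auto simp: A_def I_def)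
    also have "\<dots> \<le> (\<Sum>k\<in>Q. real n * real d ^ (2 * k) * p ^ ((d - 2) * k + 2))"
    proof (rule sum_mono)
      fix k
      have "(\<Sum>U | U \<in> A \<and> card U = k. p ^ ((d - 2) * card U + 2))
          = real (card {U. U \<in> A \<and> card U = k}) * p ^ ((d - 2) * k + 2)" by simp
      also have "\<dots> \<le> real (n * d ^ (2 * k)) * p ^ ((d - 2) * k + 2)"
      proof (intro mult_right_mono of_nat_mono)
        have "card {U. U \<in> A \<and> card U = k} \<le> card {U. U \<subseteq> {..<n} \<and> connected_in E U \<and> card U = k}"
          by (rule card_mono) (auto simp: A_def I_def)
        then show "card {U. U \<in> A \<and> card U = k} \<le> n * d ^ (2 * k)"
          using card_connected_sets_le[of k] d by simp
      qed (use p in simp)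
      finally show "(\<Sum>U | U \<in> A \<and> card U = k. p ^ ((d - 2) * card U + 2))
          \<le> real n * real d ^ (2 * k) * p ^ ((d - 2) * k + 2)" by simp
    qed
    finally show ?thesis .
  qed
  have sumB: "(\<Sum>U\<in>B. p ^ card (nbrs E U)) \<le> M * 2 ^ (K * (d + 1)) * p"
  proof -
    let ?cyc = "cyclic_sets n (K * (d + 1)) E"
    have fin_cyc: "finite ?cyc" by (simp add: cyclic_sets_def)
    have "(\<Sum>U\<in>B. p ^ card (nbrs E U)) \<le> (\<Sum>U\<in>B. p)"
    proof (rule sum_mono)
      fix U assume U: "U \<in> B"
      then have sub: "U \<subseteq> {..<n}" "card U < K" "U \<noteq> {}"
        using connected_in_nonempty by (auto simp: B_def I_def Q_def)
      then have "card U > 0" using finite_subset by (auto simp: card_gt_0_iff)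
      then have "0 < \<gamma> * real (card U)" using \<gamma> by simp
      also have "\<dots> \<le> real (card (nbrs E U))" using ex sub K by (auto simp: expanding_def)
      finally have "card (nbrs E U) \<ge> 1" by simp
      then have "p ^ card (nbrs E U) \<le> p ^ 1" using p by (intro power_decreasing) auto
      then show "p ^ card (nbrs E U) \<le> p" by simp
    qed
    also have "\<dots> = real (card B) * p" by simp
    also have "\<dots> \<le> (M * 2 ^ (K * (d + 1))) * p"
    proof (rule mult_right_mono)
      have "B \<subseteq> (\<Union>W\<in>?cyc. Pow W)"
      proof
        fix U assume U: "U \<in> B"
        then have sub: "U \<subseteq> {..<n}" "connected_in E U" "card U < K"
          "card (nbrs E U) < (d - 2) * card U + 2" by (auto simp: B_def I_def Q_def)
        then have fU: "finite U" using finite_subset by blast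
        let ?W = "U \<union> nbrs E U"
        have "card ?W \<le> card U + card (nbrs E U)" by (rule card_Un_le)
        also have "\<dots> \<le> card U + d * card U"
          using card_nbrs_le_arcs[OF sub(1)] card_arcs_le[OF fU, of "{..<n} - U"] by simp
        also have "\<dots> = card U * (d + 1)" by simp
        also have "\<dots> \<le> K * (d + 1)" using sub(3) by (intro mult_right_mono) auto
        finally have "?W \<in> ?cyc"
          using few_nbrs_imp_cyclic[OF sub(2,1) d sub(4)] sub(1) nbrs_subset
          by (auto simp: cyclic_sets_def)
        then show "U \<in> (\<Union>W\<in>?cyc. Pow W)" by blast
      qed
      then have "card B \<le> card (\<Union>W\<in>?cyc. Pow W)"
        using fin_cyc finite_subset by (intro card_mono) (auto simp: cyclic_sets_def)
      also have "\<dots> \<le> (\<Sum>W\<in>?cyc. card (Pow W))" by (rule card_UN_le[OF fin_cyc])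
      also have "\<dots> \<le> (\<Sum>W\<in>?cyc. 2 ^ (K * (d + 1)))"
      proof (rule sum_mono)
        fix W assume W: "W \<in> ?cyc"
        then have "finite W" using finite_subset by (auto simp: cyclic_sets_def)
        then show "card (Pow W) \<le> 2 ^ (K * (d + 1))"
          using W by (simp add: card_Pow cyclic_sets_def power_increasing)
      qed
      finally have "card B \<le> card ?cyc * 2 ^ (K * (d + 1))" by simp
      then have "real (card B) \<le> real (card ?cyc * 2 ^ (K * (d + 1)))" by (simp only: of_nat_le_iff)
      also have "\<dots> \<le> M * 2 ^ (K * (d + 1))" using M by simp
      finally show "real (card B) \<le> M * 2 ^ (K * (d + 1))" .
    qed (rule p)
    finally show ?thesis .
  qed
  have "?P {D. \<exists>U\<subseteq>{..<n}. connected_in E U \<and> card U \<in> Q \<and> nbrs E U \<inter> {v. \<not> D v} = {}}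
      \<le> ?P (\<Union>U\<in>I. ?ev U)"
    by (intro measure_pmf.finite_measure_mono) (auto simp: I_def)
  also have "\<dots> \<le> (\<Sum>U\<in>I. ?P (?ev U))" by (rule prob_UN_le[OF fin(1)])
  also have "\<dots> = (\<Sum>U\<in>A \<union> B. p ^ card (nbrs E U))"
    unfolding ev by (rule sum.cong) (auto simp: A_def B_def)
  also have "\<dots> = (\<Sum>U\<in>A. p ^ card (nbrs E U)) + (\<Sum>U\<in>B. p ^ card (nbrs E U))"
    by (rule sum.union_disjoint[OF fin(2,3)]) (auto simp: A_def B_def)
  finally show ?thesis using sumA sumB by linarith
qed

lemma prob_many_deleted:
  assumes "0 \<le> p" "p \<le> 1" "t > 0"
  shows "measure_pmf.prob (deletions n p) {D. t \<le> real (card ({..<n} - {v. \<not> D v}))} \<le> real n * p / t"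
proof -
  have "measure_pmf.prob (deletions n p) {D. D v} = p" if "v < n" for v
    using prob_all_deleted[of "{v}" n p] that assms by simp
  then have "(\<Sum>v<n. measure_pmf.prob (deletions n p) {D. D v}) = real n * p" by simp
  moreover have "{..<n} - {v. \<not> D v} = {v \<in> {..<n}. D \<in> {D. D v}}" for D by auto
  ultimately show ?thesis
    using prob_many_events_le[of "{..<n}" t "deletions n p" "\<lambda>v. {D. D v}"] assms by simp
qed

section \<open>The structure of the surviving graph\<close>

text \<open>The inequality for the small components says that \<open>n\<close> times the probability to delete
  \<open>(d - 2) * k + 2\<close> given vertices does not tend to \<open>0\<close>, where \<open>k\<close> is the size of the component. All
  claims about small components follow from it. Finiteness of the vertex set makes the
  cardinality of a component positive.\<close>

definition giant_structure :: "nat \<Rightarrow> real \<Rightarrow> (nat \<Rightarrow> real) \<Rightarrow> real \<Rightarrow> nat \<Rightarrow> nat graph \<Rightarrow> bool" where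
  "giant_structure d \<alpha> f \<beta> n H \<longleftrightarrow> finite (verts H) \<and> (\<exists>C \<in> conn_components H.
     real (card C) \<ge> real n - f n \<and> expander \<beta> (induced_subgraph H C) \<and>
     (\<forall>C' \<in> conn_components H - {C}. \<alpha> * ((real d - 2) * real (card C') + 2) \<le> 1))"

text \<open>Three events are excluded: too many deletions, a larger connected set that loses half of its
  guaranteed neighbours, and a connected set with size in \<open>Q\<close> that loses all of its neighbours.\<close>

lemma giant_structureI:
  fixes \<alpha> \<gamma> t :: real and f :: "nat \<Rightarrow> real" and d K :: nat
  defines "Q \<equiv> {k. k < K \<and> \<alpha> * (real ((d - 2) * k) + 2) > 1}"
  assumes reg: "regular_edges {..<n} d E" and ex: "expanding n \<gamma> E" and \<gamma>: "\<gamma> > 0"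
    and d: "d \<ge> 2" and K: "K > 0" "2 * K \<le> n"
    and t: "real (1 + d * K) * t \<le> f n" "f n < real n"
    and few: "real (card ({..<n} - S)) < t"
    and surv: "\<And>U. U \<subseteq> {..<n} \<Longrightarrow> connected_in E U \<Longrightarrow> K \<le> card U \<Longrightarrow> 2 * card U \<le> n \<Longrightarrow>
      \<gamma> / 2 * real (card U) \<le> real (card (nbrs E U \<inter> S))"
    and small: "\<And>U. U \<subseteq> {..<n} \<Longrightarrow> connected_in E U \<Longrightarrow> card U \<in> Q \<Longrightarrow> nbrs E U \<inter> S \<noteq> {}"
  shows "giant_structure d \<alpha> f (min (\<gamma> / 2) (1 / real K) / real d) n (induced_subgraph ({..<n}, E) S)"
proof -
  interpret regular_edges "{..<n}" d E by fact
  let ?H = "induced_subgraph ({..<n}, E) S"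
  have del: "real ((1 + d * K) * card ({..<n} - S)) < f n"
  proof -
    have "real ((1 + d * K) * card ({..<n} - S)) = real (1 + d * K) * real (card ({..<n} - S))"
      by (rule of_nat_mult)
    also have "\<dots> < real (1 + d * K) * t" by (rule mult_strict_left_mono[OF few]) (metis of_nat_0_less_iff zero_less_Suc plus_1_eq_Suc)
    finally show ?thesis using t(1) by simp
  qed
  obtain C where C: "C \<in> conn_components ?H" "card {..<n} \<le> card C + (1 + d * K) * card ({..<n} - S)"
    "\<And>C'. C' \<in> conn_components ?H - {C} \<Longrightarrow> card C' < K"
  proof (rule giant_component[of K S])
    show "nbrs E U \<noteq> {}" if "U \<subseteq> {..<n}" "U \<noteq> {}" "2 * card U \<le> card {..<n}" for U
    proof -
      have "finite U" using that(1) finite_subset by blast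
      then have "0 < \<gamma> * real (card U)" using that(2) \<gamma> by (simp add: card_gt_0_iff)
      also have "\<dots> \<le> real (card (nbrs E U))" using ex that by (auto simp: expanding_def)
      finally show ?thesis by auto
    qed
    show "nbrs E U \<inter> S \<noteq> {}"
      if "U \<subseteq> {..<n}" "connected_in E U" "K \<le> card U" "2 * card U \<le> card {..<n}" for U
    proof -
      have "0 < \<gamma> / 2 * real (card U)" using that K \<gamma> by simp
      also have "\<dots> \<le> real (card (nbrs E U \<inter> S))" using surv that by simp
      finally show ?thesis by auto
    qed
    show "(1 + d * K) * card ({..<n} - S) < card {..<n}"
    proof -
      have "real ((1 + d * K) * card ({..<n} - S)) < real n" using del t(2) by linarith
      then show ?thesis by (simp only: of_nat_less_iff card_lessThan)
    qed
    show "2 * K \<le> card {..<n}" using K by simp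
  qed blast
  have "real n - f n \<le> real (card C)"
  proof -
    have "real n \<le> real (card C + (1 + d * K) * card ({..<n} - S))"
      using C(2) by (simp only: of_nat_le_iff card_lessThan)
    then show ?thesis using del by linarith
  qed
  moreover have "expander (min (\<gamma> / 2) (1 / real K) / real d) (induced_subgraph ?H C)"
    using surv \<gamma> K d by (intro expander_component[OF C(1)]) auto
  moreover have "\<alpha> * ((real d - 2) * real (card C') + 2) \<le> 1" if C': "C' \<in> conn_components ?H - {C}" for C'
  proof -
    have c: "C' \<in> conn_components ?H" using C' by simp
    have "card C' \<notin> Q"
      using small[of C'] component_of_induced[OF c] by auto
    then have "\<alpha> * (real ((d - 2) * card C') + 2) \<le> 1" using C(3)[OF C'] by (simp add: Q_def)
    then show ?thesis using d by (simp add: of_nat_diff)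
  qed
  moreover have "finite (verts ?H)" by (simp add: verts_induced)
  ultimately show ?thesis using C(1) unfolding giant_structure_def by blast
qed

text \<open>The graph is sampled first: a bound that holds for every typical graph holds on average, up
  to the probability of an atypical graph.\<close>

lemma measure_bind_pmf_le:
  fixes e :: real
  assumes e: "e \<ge> 0" and N: "\<And>x. x \<in> set_pmf M \<Longrightarrow> G x \<Longrightarrow> measure_pmf.prob (N x) X \<le> e"
  shows "measure_pmf.prob (bind_pmf M N) X \<le> measure_pmf.prob M {x. \<not> G x} + e"
proof -
  have "emeasure (bind_pmf M N) X = (\<integral>\<^sup>+x. emeasure (N x) X \<partial>M)" by simp
  also have "\<dots> \<le> (\<integral>\<^sup>+x. indicator {x. \<not> G x} x + ennreal e \<partial>M)"
  proof (rule nn_integral_mono_AE, rule AE_pmfI)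
    fix x assume x: "x \<in> set_pmf M"
    show "emeasure (N x) X \<le> indicator {x. \<not> G x} x + ennreal e"
    proof (cases "G x")
      case True
      then show ?thesis using N[OF x] by (simp add: measure_pmf.emeasure_eq_measure ennreal_leI)
    next
      case False
      have "emeasure (N x) X \<le> 1" by (simp add: measure_pmf.emeasure_le_1)
      also have "\<dots> \<le> 1 + ennreal e" by simp
      finally show ?thesis using False by simp
    qed
  qed
  also have "\<dots> = emeasure M {x. \<not> G x} + ennreal e"
    by (subst nn_integral_add) auto
  finally have "ennreal (measure_pmf.prob (bind_pmf M N) X)
      \<le> ennreal (measure_pmf.prob M {x. \<not> G x} + e)"
    using e by (simp add: measure_pmf.emeasure_eq_measure)
  then show ?thesis using e by (subst (asm) ennreal_le_iff) auto
qed

lemma prob_not_giant_structure: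
  fixes \<alpha> :: real
  assumes \<alpha>: "\<alpha> > 0" and d: "d \<ge> 3"
  obtains \<beta> :: real and f err :: "nat \<Rightarrow> real" where "\<beta> > 0" "f \<in> o(\<lambda>n. real n)" "err \<longlonglongrightarrow> 0"
    "\<forall>\<^sub>F n in sequentially. even (d * n) \<longrightarrow>
       measure_pmf.prob (deleted_regular_graph d \<alpha> n) {H. \<not> giant_structure d \<alpha> f \<beta> n H} \<le> err n"
proof -
  obtain \<gamma> err1 where \<gamma>: "\<gamma> > 0" and err1: "err1 \<longlonglongrightarrow> 0"
    "\<forall>\<^sub>F n in sequentially. even (d * n) \<longrightarrow>
      measure_pmf.prob (random_edges n d) {E. \<not> expanding n \<gamma> E} \<le> err1 n"
    using prob_not_expanding[OF d] by blast
  \<comment> \<open>\<open>K\<close> makes the bound \<open>2 * n * x ^ K\<close> for connected sets of at least \<open>K\<close> vertices vanish,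
    where \<open>x\<close> is of order \<open>n powr (- \<alpha> * \<gamma> / 2)\<close>\<close>
  define K where "K = nat \<lceil>2 / (\<alpha> * \<gamma>)\<rceil> + 1"
  have K: "K > 0" "\<alpha> * \<gamma> / 2 * real K > 1"
  proof -
    show "K > 0" by (simp add: K_def)
    have "2 / (\<alpha> * \<gamma>) < real K" unfolding K_def by linarith
    then show "\<alpha> * \<gamma> / 2 * real K > 1" using \<alpha> \<gamma> by (simp add: field_simps)
  qed
  have d0: "d > 0" "\<alpha> / 2 > 0" using d \<alpha> by auto
  obtain err2 where err2: "err2 \<longlonglongrightarrow> 0"
    "\<forall>\<^sub>F n in sequentially. even (d * n) \<longrightarrow>
      measure_pmf.prob (random_edges n d)
        {E. real n powr (\<alpha> / 2) \<le> real (card (cyclic_sets n (K * (d + 1)) E))} \<le> err2 n"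
    using prob_many_cyclic_sets[OF d0, of "K * (d + 1)"] by blast
  define \<beta> where "\<beta> = min (\<gamma> / 2) (1 / real K) / real d"
  \<comment> \<open>the expected number of deleted vertices is \<open>n powr (1 - \<alpha>)\<close>, so \<open>t n\<close> is rarely exceeded\<close>
  define t where "t = (\<lambda>n::nat. real n powr (1 - \<alpha> / 2))"
  define f where "f = (\<lambda>n. real (1 + d * K) * t n)"
  define p where "p = (\<lambda>n::nat. real n powr (- \<alpha>))"
  define x where "x = (\<lambda>n. real d ^ 2 * 2 ^ d * p n powr (\<gamma> / 2))"
  define Q where "Q = {k. k < K \<and> \<alpha> * (real ((d - 2) * k) + 2) > 1}"
  define e1 where "e1 = (\<lambda>n::nat. 2 * real n * x n ^ K)"
  define e2 where "e2 = (\<lambda>n::nat. (\<Sum>k\<in>Q. real n * real d ^ (2 * k) * p n ^ ((d - 2) * k + 2))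
    + real n powr (\<alpha> / 2) * 2 ^ (K * (d + 1)) * p n)"
  define e3 where "e3 = (\<lambda>n::nat. real n * p n / t n)"
  have finQ: "finite Q" by (simp add: Q_def)
  have f_small: "f \<in> o(\<lambda>n. real n)"
  proof -
    have "t \<in> o(\<lambda>n. real n)" unfolding t_def using \<alpha> by real_asymp
    then show ?thesis unfolding f_def by simp
  qed
  have d0': "real d > 0" using d by simp
  have p_pos: "0 < p n \<and> p n \<le> 1" if "n > 0" for n
    using that \<alpha> powr_mono[of "-\<alpha>" 0 "real n"] by (simp add: p_def)
  have x_eq: "x n = real d ^ 2 * 2 ^ d * real n powr (- (\<alpha> * \<gamma> / 2))" for n
    by (simp add: x_def p_def powr_powr)
  have lim1: "e1 \<longlonglongrightarrow> 0"
  proof -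
    have "(\<lambda>n. 2 * (real d ^ 2 * 2 ^ d) ^ K * real n powr (1 - \<alpha> * \<gamma> / 2 * real K)) \<longlonglongrightarrow> 0"
    proof -
      have "(\<lambda>n. real n powr (1 - \<alpha> * \<gamma> / 2 * real K)) \<longlonglongrightarrow> 0"
        using K(2) by (intro tendsto_neg_powr filterlim_real_sequentially) simp
      then show ?thesis by (rule tendsto_mult_right_zero)
    qed
    moreover have "\<forall>\<^sub>F n in sequentially.
        2 * (real d ^ 2 * 2 ^ d) ^ K * real n powr (1 - \<alpha> * \<gamma> / 2 * real K) = e1 n"
      using eventually_gt_at_top[of 0]
    proof eventually_elim
      case (elim n)
      have "(real n powr (- (\<alpha> * \<gamma> / 2))) ^ K = real n powr (- (\<alpha> * \<gamma> / 2) * real K)"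
        using elim by (simp add: powr_powr flip: powr_realpow)
      then have "e1 n = 2 * (real d ^ 2 * 2 ^ d) ^ K * (real n powr 1 * real n powr (- (\<alpha> * \<gamma> / 2) * real K))"
        using elim by (simp add: e1_def x_eq power_mult_distrib)
      also have "real n powr 1 * real n powr (- (\<alpha> * \<gamma> / 2) * real K) = real n powr (1 - \<alpha> * \<gamma> / 2 * real K)"
        by (subst powr_add[symmetric]) simp
      finally show ?case by simp
    qed
    ultimately show ?thesis by (rule Lim_transform_eventually)
  qed
  have lim2: "e2 \<longlonglongrightarrow> 0"
  proof -
    have vanish: "(\<lambda>n. real n * real d ^ (2 * k) * p n ^ ((d - 2) * k + 2)) \<longlonglongrightarrow> 0" if k: "k \<in> Q" for k
    proof -
      define m where "m = (d - 2) * k + 2"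
      have m: "\<alpha> * real m > 1" using k by (simp add: Q_def m_def add.commute)
      have "(\<lambda>n. real n powr (1 - \<alpha> * real m)) \<longlonglongrightarrow> 0"
        using m by (intro tendsto_neg_powr filterlim_real_sequentially) simp
      then have "(\<lambda>n. real d ^ (2 * k) * real n powr (1 - \<alpha> * real m)) \<longlonglongrightarrow> 0"
        by (rule tendsto_mult_right_zero)
      moreover have "\<forall>\<^sub>F n in sequentially. real d ^ (2 * k) * real n powr (1 - \<alpha> * real m)
          = real n * real d ^ (2 * k) * p n ^ m"
        using eventually_gt_at_top[of 0]
      proof eventually_elim
        case (elim n)
        have "p n ^ m = real n powr (- \<alpha> * real m)"
          using elim by (simp add: p_def powr_powr flip: powr_realpow)
        then have "real n * p n ^ m = real n powr 1 * real n powr (- \<alpha> * real m)" using elim by simp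
        also have "\<dots> = real n powr (1 - \<alpha> * real m)" by (subst powr_add[symmetric]) simp
        finally show ?case by (simp add: mult_ac)
      qed
      ultimately show ?thesis unfolding m_def by (rule Lim_transform_eventually)
    qed
    have "(\<lambda>n. \<Sum>k\<in>Q. real n * real d ^ (2 * k) * p n ^ ((d - 2) * k + 2)) \<longlonglongrightarrow> 0"
      using vanish by (rule tendsto_null_sum)
    moreover have "(\<lambda>n. real n powr (\<alpha> / 2) * 2 ^ (K * (d + 1)) * p n) \<longlonglongrightarrow> 0"
      unfolding p_def using \<alpha> by real_asymp
    ultimately show ?thesis unfolding e2_def by (rule tendsto_add_zero)
  qed
  have lim3: "e3 \<longlonglongrightarrow> 0" unfolding e3_def t_def p_def using \<alpha> by real_asymp
  have ev_x: "\<forall>\<^sub>F n in sequentially. x n \<le> 1/2"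
  proof -
    have "(\<lambda>n. real n powr (- (\<alpha> * \<gamma> / 2))) \<longlonglongrightarrow> 0"
      using \<alpha> \<gamma> by (intro tendsto_neg_powr filterlim_real_sequentially) simp
    then have "x \<longlonglongrightarrow> 0" unfolding x_eq by (rule tendsto_mult_right_zero)
    then have "\<forall>\<^sub>F n in sequentially. x n < 1/2" by (rule order_tendstoD(2)) simp
    then show ?thesis by eventually_elim simp
  qed
  have ev_f: "\<forall>\<^sub>F n in sequentially. f n < real n"
  proof -
    have "\<forall>\<^sub>F n in sequentially. norm (f n) \<le> 1/2 * norm (real n)"
      using f_small by (rule landau_o.smallD) simp
    then show ?thesis using eventually_gt_at_top[of 0] by eventually_elim auto
  qed
  show thesis
  proof (rule that[of \<beta> f "\<lambda>n. err1 n + err2 n + (e1 n + e2 n + e3 n)"])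
    show "\<beta> > 0" using \<gamma> K d by (simp add: \<beta>_def)
    show "f \<in> o(\<lambda>n. real n)" by fact
    show "(\<lambda>n. err1 n + err2 n + (e1 n + e2 n + e3 n)) \<longlonglongrightarrow> 0"
      by (intro tendsto_add_zero err1 err2 lim1 lim2 lim3)
    show "\<forall>\<^sub>F n in sequentially. even (d * n) \<longrightarrow>
       measure_pmf.prob (deleted_regular_graph d \<alpha> n) {H. \<not> giant_structure d \<alpha> f \<beta> n H}
         \<le> err1 n + err2 n + (e1 n + e2 n + e3 n)"
      using err1(2) err2(2) ev_x ev_f eventually_gt_at_top[of "d + 1"] eventually_ge_at_top[of "2 * K"]
    proof (eventually_elim, intro impI)
      fix n :: nat
      let ?R = "measure_pmf.prob (random_edges n d)" and ?P = "measure_pmf.prob (deletions n (p n))"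
      define G where "G = (\<lambda>E. expanding n \<gamma> E \<and> real (card (cyclic_sets n (K * (d + 1)) E)) < real n powr (\<alpha> / 2))"
      assume ex: "even (d * n) \<longrightarrow> ?R {E. \<not> expanding n \<gamma> E} \<le> err1 n"
        and cyc: "even (d * n) \<longrightarrow> ?R {E. real n powr (\<alpha> / 2) \<le> real (card (cyclic_sets n (K * (d + 1)) E))} \<le> err2 n"
        and xn: "x n \<le> 1/2" and fn: "f n < real n" and n: "d + 1 < n" "2 * K \<le> n" and even: "even (d * n)"
      have ne: "reg_family n d \<noteq> {}" by (rule reg_family_nonempty[OF even n(1)])
      have n0: "n > 0" using n by simp
      have pn: "0 < p n" "p n \<le> 1" using p_pos[OF n0] by auto
      have tn: "t n > 0" using n0 by (simp add: t_def)
      have e_nonneg: "0 \<le> e1 n + e2 n + e3 n"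
        using pn tn unfolding e1_def e2_def e3_def x_def
        by (intro add_nonneg_nonneg sum_nonneg mult_nonneg_nonneg divide_nonneg_nonneg zero_le_power) auto
      have del: "measure_pmf.prob (delete_vertices (p n) ({..<n}, E)) {H. \<not> giant_structure d \<alpha> f \<beta> n H}
          \<le> e1 n + e2 n + e3 n" if E: "E \<in> set_pmf (random_edges n d)" "G E" for E
      proof -
        have reg: "regular_edges {..<n} d E" by (rule set_random_edges[OF ne E(1)])
        have exE: "expanding n \<gamma> E" and cycE: "real (card (cyclic_sets n (K * (d + 1)) E)) \<le> real n powr (\<alpha> / 2)"
          using E(2) by (auto simp: G_def)
        let ?S = "\<lambda>D. {v. \<not> D v}"
        define X1 where "X1 = {D. \<exists>U\<subseteq>{..<n}. connected_in E U \<and> K \<le> card U \<and> 2 * card U \<le> n \<and>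
          real (card (nbrs E U \<inter> ?S D)) < \<gamma> / 2 * real (card U)}"
        define X2 where "X2 = {D. \<exists>U\<subseteq>{..<n}. connected_in E U \<and> card U \<in> Q \<and> nbrs E U \<inter> ?S D = {}}"
        define X3 where "X3 = {D. t n \<le> real (card ({..<n} - ?S D))}"
        have "measure_pmf.prob (delete_vertices (p n) ({..<n}, E)) {H. \<not> giant_structure d \<alpha> f \<beta> n H}
            = ?P {D. \<not> giant_structure d \<alpha> f \<beta> n (induced_subgraph ({..<n}, E) (?S D))}"
          by (simp add: delete_vertices_def deletions_def)
        also have "\<dots> \<le> ?P (X1 \<union> X2 \<union> X3)"
        proof (intro measure_pmf.finite_measure_mono subsetI, rule ccontr)
          fix D assume D: "D \<in> {D. \<not> giant_structure d \<alpha> f \<beta> n (induced_subgraph ({..<n}, E) (?S D))}"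
            "D \<notin> X1 \<union> X2 \<union> X3"
          have "giant_structure d \<alpha> f (min (\<gamma> / 2) (1 / real K) / real d) n (induced_subgraph ({..<n}, E) (?S D))"
          proof (rule giant_structureI[where f = f and n = n, OF reg exE \<gamma> _ K(1) n(2) _ fn, of "t n"])
            show "2 \<le> d" using d by simp
            show "real (1 + d * K) * t n \<le> f n" by (simp add: f_def)
            show "real (card ({..<n} - ?S D)) < t n" using D(2) unfolding X3_def by simp
            show "\<gamma> / 2 * real (card U) \<le> real (card (nbrs E U \<inter> ?S D))" (is ?thesis)
              if "U \<subseteq> {..<n}" "connected_in E U" "K \<le> card U" "2 * card U \<le> n" for U
            proof (rule ccontr)
              assume "\<not> ?thesis"
              then have "D \<in> X1" using that unfolding X1_def by (intro CollectI exI[of _ U]) simp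
              then show False using D(2) by simp
            qed
            show "nbrs E U \<inter> ?S D \<noteq> {}" if "U \<subseteq> {..<n}" "connected_in E U"
              "card U \<in> {k. k < K \<and> 1 < \<alpha> * (real ((d - 2) * k) + 2)}" for U
            proof
              assume "nbrs E U \<inter> ?S D = {}"
              then have "D \<in> X2" using that unfolding X2_def Q_def by (intro CollectI exI[of _ U]) simp
              then show False using D(2) by simp
            qed
          qed
          then show False using D(1) by (simp add: \<beta>_def)
        qed simp
        also have "\<dots> \<le> ?P X1 + ?P X2 + ?P X3"
          by (intro order_trans[OF measure_Un_le] add_right_mono measure_Un_le) auto
        also have "\<dots> \<le> e1 n + e2 n + e3 n"
        proof (intro add_mono)
          show "?P X1 \<le> e1 n" unfolding X1_def e1_def x_def
            using xn unfolding x_def by (intro prob_few_survivors reg exE pn d0(1))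
          show "?P X2 \<le> e2 n" unfolding X2_def e2_def Q_def
            using d pn by (intro prob_small_isolated[OF reg exE \<gamma> _ _ _ n(2) cycE]) auto
          show "?P X3 \<le> e3 n" unfolding X3_def e3_def
            using pn tn by (intro prob_many_deleted) auto
        qed
        finally show ?thesis .
      qed
      have "deleted_regular_graph d \<alpha> n
          = bind_pmf (random_edges n d) (\<lambda>E. delete_vertices (p n) ({..<n}, E))"
        by (simp add: deleted_regular_graph_def random_regular_graph_eq[OF ne] bind_map_pmf p_def)
      then have "measure_pmf.prob (deleted_regular_graph d \<alpha> n) {H. \<not> giant_structure d \<alpha> f \<beta> n H}
          \<le> ?R {E. \<not> G E} + (e1 n + e2 n + e3 n)"
        by (simp only:) (rule measure_bind_pmf_le[where G = G, OF e_nonneg del])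
      also have "?R {E. \<not> G E} \<le> ?R ({E. \<not> expanding n \<gamma> E}
          \<union> {E. real n powr (\<alpha> / 2) \<le> real (card (cyclic_sets n (K * (d + 1)) E))})"
        by (intro measure_pmf.finite_measure_mono) (auto simp: G_def)
      also have "\<dots> \<le> err1 n + err2 n"
        using ex cyc even by (intro order_trans[OF measure_Un_le] add_mono) auto
      finally show "measure_pmf.prob (deleted_regular_graph d \<alpha> n) {H. \<not> giant_structure d \<alpha> f \<beta> n H}
         \<le> err1 n + err2 n + (e1 n + e2 n + e3 n)" by simp
    qed
  qed
qed

lemma whpI:
  assumes lim: "err \<longlonglongrightarrow> 0"
    and bound: "\<forall>\<^sub>F n in sequentially. even (d * n) \<longrightarrow>
       measure_pmf.prob (deleted_regular_graph d \<alpha> n) {H. \<not> P n H} \<le> err n"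
    and imp: "\<And>n H. P n H \<Longrightarrow> R n H"
  shows "whp d \<alpha> R"
  unfolding whp_def
proof (rule tendsto_sandwich)
  let ?F = "inf at_top (principal {n. even (d * n)})"
  have "(\<lambda>n. 1 - err n) \<longlonglongrightarrow> 1 - 0" using lim by (intro tendsto_diff tendsto_const)
  then show "((\<lambda>n. 1 - err n) \<longlongrightarrow> 1) ?F" by (intro tendsto_mono[OF inf_le1]) simp
  show "\<forall>\<^sub>F n in ?F. 1 - err n \<le> measure_pmf.prob (deleted_regular_graph d \<alpha> n) {H. R n H}"
    unfolding eventually_inf_principal using bound
  proof (eventually_elim, intro impI)
    fix n assume n: "even (d * n) \<longrightarrow> measure_pmf.prob (deleted_regular_graph d \<alpha> n) {H. \<not> P n H} \<le> err n"
      and even: "n \<in> {n. even (d * n)}"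
    let ?P = "measure_pmf.prob (deleted_regular_graph d \<alpha> n)"
    have "?P {H. \<not> P n H} = 1 - ?P {H. P n H}"
      using measure_pmf.prob_compl[of "{H. P n H}" "deleted_regular_graph d \<alpha> n"]
      by (simp add: Compl_eq_Diff_UNIV[symmetric] Collect_neg_eq)
    moreover have "?P {H. P n H} \<le> ?P {H. R n H}"
      using imp by (intro measure_pmf.finite_measure_mono) auto
    moreover have "?P {H. \<not> P n H} \<le> err n" using n even by blast
    ultimately show "1 - err n \<le> ?P {H. R n H}" by linarith
  qed
  show "\<forall>\<^sub>F n in ?F. measure_pmf.prob (deleted_regular_graph d \<alpha> n) {H. R n H} \<le> 1"
    by (intro always_eventually allI measure_pmf.prob_le_1)
qed (rule tendsto_const)

lemma conn_components_singleton_connected: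
  assumes C: "C \<in> conn_components H" and only: "conn_components H - {C} = {}"
  shows "connected_graph H"
  unfolding connected_graph_def
proof (intro conjI ballI)
  show "verts H \<noteq> {}" using component_subset[OF C] by auto
  have eq: "C' = C" if "C' \<in> conn_components H" for C' using only that by blast
  fix u v assume uv: "u \<in> verts H" "v \<in> verts H"
  then have "u \<in> C" "v \<in> C" using component_exists[of _ H] eq by blast+
  then show "(u, v) \<in> (adjacency H)\<^sup>*" using component_eq[OF C] by blast
qed

theorem theorem3p9:
  fixes \<alpha> :: real and d :: nat
  assumes "\<alpha> > 0" and "d \<ge> 3"
  shows "\<exists>\<beta>>0.
    (\<exists>f :: nat \<Rightarrow> real. f \<in> o(\<lambda>n. real n) \<and>
      whp d \<alpha> (\<lambda>n H. \<exists>C \<in> conn_components H.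
        real (card C) \<ge> real n - f n \<and>
        expander \<beta> (induced_subgraph H C) \<and>
        (\<forall>C' \<in> conn_components H - {C}.
          real (card C') \<le> 4 * (real d - 1) / (\<alpha> * (real d - 2)\<^sup>2) + 1))) \<and>
    (\<alpha> > 1 / (2 * (real d - 1)) \<longrightarrow> whp d \<alpha> (\<lambda>n H. small_components_isolated H)) \<and>
    (\<alpha> > 1 / real d \<longrightarrow> whp d \<alpha> (\<lambda>n H. connected_graph H))"
proof -
  obtain \<beta> f err where \<beta>: "\<beta> > 0" and f: "f \<in> o(\<lambda>n. real n)" and err: "err \<longlonglongrightarrow> 0"
    "\<forall>\<^sub>F n in sequentially. even (d * n) \<longrightarrow>
       measure_pmf.prob (deleted_regular_graph d \<alpha> n) {H. \<not> giant_structure d \<alpha> f \<beta> n H} \<le> err n"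
    using prob_not_giant_structure[OF assms] by blast
  note whp = whpI[OF err]
  have d3: "real d \<ge> 3" using assms by simp
  have size: "real k \<le> 4 * (real d - 1) / (\<alpha> * (real d - 2)\<^sup>2) + 1"
    if k: "\<alpha> * ((real d - 2) * real k + 2) \<le> 1" for k
  proof -
    have "\<alpha> * (real d - 2) * real k \<le> 1"
      using k assms by (simp add: algebra_simps)
    then have "\<alpha> * (real d - 2) * real k * (real d - 2) \<le> 1 * (real d - 2)"
      using d3 by (intro mult_right_mono) auto
    also have "\<dots> \<le> 4 * (real d - 1)" using d3 by simp
    finally have "real k * (\<alpha> * (real d - 2)\<^sup>2) \<le> 4 * (real d - 1)"
      by (simp add: power2_eq_square mult_ac)
    moreover have "\<alpha> * (real d - 2)\<^sup>2 > 0" using assms d3 by simp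
    ultimately have "real k \<le> 4 * (real d - 1) / (\<alpha> * (real d - 2)\<^sup>2)" by (simp add: pos_le_divide_eq)
    then show ?thesis by simp
  qed
  have card_pos: "card C > 0" if "C \<in> conn_components H" "finite (verts H)" for C and H :: "nat graph"
    using component_subset[OF that(1)] that(2) finite_subset by (auto simp: card_gt_0_iff)
  have few: "card C' < j"
    if "\<alpha> * ((real d - 2) * real (card C') + 2) \<le> 1" "\<alpha> * ((real d - 2) * real j + 2) > 1"
    for C' :: "nat set" and j
  proof (rule ccontr)
    assume "\<not> card C' < j"
    then have "\<alpha> * ((real d - 2) * real j + 2) \<le> \<alpha> * ((real d - 2) * real (card C') + 2)"
      using assms d3 by (intro mult_left_mono add_right_mono) auto
    then show False using that by linarith
  qed
  have "whp d \<alpha> (\<lambda>n H. \<exists>C \<in> conn_components H.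
      real (card C) \<ge> real n - f n \<and> expander \<beta> (induced_subgraph H C) \<and>
      (\<forall>C' \<in> conn_components H - {C}.
        real (card C') \<le> 4 * (real d - 1) / (\<alpha> * (real d - 2)\<^sup>2) + 1))"
    by (rule whp) (use size in \<open>unfold giant_structure_def, blast\<close>)
  moreover have "whp d \<alpha> (\<lambda>n H. small_components_isolated H)" if \<alpha>: "\<alpha> > 1 / (2 * (real d - 1))"
  proof (rule whp)
    fix n and H :: "nat graph" assume "giant_structure d \<alpha> f \<beta> n H"
    then obtain C where fin: "finite (verts H)" and C: "C \<in> conn_components H"
      and others: "\<And>C'. C' \<in> conn_components H - {C} \<Longrightarrow> \<alpha> * ((real d - 2) * real (card C') + 2) \<le> 1"
      by (auto simp: giant_structure_def)
    have two: "\<alpha> * ((real d - 2) * real 2 + 2) > 1" using \<alpha> d3 by (simp add: field_simps)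
    have one: "card C' = 1" if "C' \<in> conn_components H - {C}" for C'
      using few[OF others[OF that] two] card_pos[OF _ fin, of C'] that by simp
    have "largest_component H C"
      unfolding largest_component_def using C one card_pos[OF C fin] by (metis DiffI One_nat_def Suc_leI empty_iff insert_iff le_refl)
    moreover have "\<exists>v. C' = {v}" if "C' \<in> conn_components H - {C}" for C'
      using one[OF that] by (meson card_1_singletonE)
    ultimately show "small_components_isolated H" unfolding small_components_isolated_def by blast
  qed
  moreover have "whp d \<alpha> (\<lambda>n H. connected_graph H)" if \<alpha>: "\<alpha> > 1 / real d"
  proof (rule whp)
    fix n and H :: "nat graph" assume "giant_structure d \<alpha> f \<beta> n H"
    then obtain C where fin: "finite (verts H)" and C: "C \<in> conn_components H"
      and others: "\<And>C'. C' \<in> conn_components H - {C} \<Longrightarrow> \<alpha> * ((real d - 2) * real (card C') + 2) \<le> 1"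
      by (auto simp: giant_structure_def)
    have "\<alpha> * ((real d - 2) * real 1 + 2) > 1" using \<alpha> d3 by (simp add: field_simps)
    then have "conn_components H - {C} = {}"
      using few[OF others] card_pos[OF _ fin] by (metis DiffD1 all_not_in_conv less_one less_irrefl)
    then show "connected_graph H" by (rule conn_components_singleton_connected[OF C])
  qed
  ultimately show ?thesis using \<beta> f by blast
qed

end
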